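(* In the setting of the context (Feynman–Kac model $(P_n,G_n,\eta_0)$ satisfying all the listed assumptions, with Lyapunov function $V$ and integer $\lambda$, and the associated $N$-walker Diffusion Monte Carlo occupation measures $\eta_n^N$), the following holds. For any $p\in\mathbb N^*$ there exist $c\in\mathbb R$ and $\beta\in(0,1]$ such that for any $f\in\mathcal C_{V^{\lambda/(4p)}}(E)$ and any $N\in\mathbb N^*$, $$\sup_{n\in\mathbb N}\mathbb E\left(|\eta_n(f)-\eta_n^N(f)|^p\right)^{1/p}\le c\,\|f\|_{V^{\lambda/(4p)}}\,N^{-\beta/2}.$$
   Context: Notation. $\mathbb N=\{0,1,2,\dots\}$, $\mathbb N^*=\mathbb N\setminus\{0\}$. $E$ is a locally compact Polish space with its Borel $\sigma$-field; $\mathcal C(E)$ (resp. $\mathcal C_b(E)$) is the set of continuous (resp. bounded continuous) real functions on $E$. $\mathcal C_\infty(E)$ is the set of $V\in\mathcal C(E)$ with $V_\star:=\inf_E V>0$ such that $\mathcal V(r):=\{V\le r\}$ is non-empty and compact for every $r\ge V_\star$ (understood as: uniformly positive continuous functions growing at infinity). $\mathcal C_0(E):=\{1/V: V\in\mathcal C_\infty(E)\}$. For a positive function $V\in\mathcal C(E)$, $\mathcal C_V(E)$ is the set of $f\in\mathcal C(E)$ with $\|f\|_V:=\sup_E|f|/V<\infty$, and $\mathcal P_V(E)$ is the set of probability measures $\mu$ on $E$ with $\mu(V)<\infty$. $\mu(f)=\int f\,d\mu$; for a kernel $Q$, $Q(f)(x)=\int Q(x,dy)f(y)$ and $(\mu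 Q)(f)=\mu(Q(f))$. Model. $(P_n)_{n\ge1}$ are Markov transitions on $E$ that are Feller ($P_n(\mathcal C_b(E))\subset\mathcal C_b(E)$), and $(G_n)_{n\ge0}$ are strictly positive bounded continuous functions. Put $Q_n(f):=G_{n-1}P_n(f)$, $Q_{k,n}:=Q_{k+1}\cdots Q_n$ for $k<n$, $Q_{n,n}=\mathrm{Id}$, and $\phi_{k,n}(\mu):=\mu Q_{k,n}/\mu Q_{k,n}(1)$. Boltzmann–Gibbs transform: $\psi_G(\mu)(dx)=G(x)\mu(dx)/\mu(G)$. The flow of measures is $\eta_{n+1}=\psi_{G_n}(\eta_n)P_{n+1}$, i.e. $\eta_n=\phi_{0,n}(\eta_0)$, from a given probability $\eta_0$. $Q$-Lyapunov functions. $U\in\mathcal C_\infty(E)$ with $U\ge1$ is a $Q$-Lyapunov function if there are $\epsilon\in[0,1)$, $c\in\mathbb R$, $\Theta\in\mathcal C_0(E)$ and a compact $K\subset E$ such that for all $n\ge1$: $P_n(U)\le\epsilon U+c$; $Q_n(U)/U\le\Theta$; and $(G_{n-1}(x)-G_{n-1}(y))(\mathbb 1_{E\setminus K}(x)U(x)-\mathbb 1_{E\setminus K}(y)U(y))\le0$ for all $x,y\in E$. Assumptions. (1) $V$ is a $Q$-Lyapunov function and $G_nP_{n+1}(V)/V\in\mathcal C_0(E)$ for all $n\geq 0$. (2) $P_n(x,dy)=p_n(x,y)\nu(dy)$ for a Radon measure $\nu$, and there is $r_1>0$ such that for all $r\ge r_1$: $0<\inf_{n\ge1}\inf_{\mathcal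 V(r)^2}p_n\le\sup_{n\ge1}\sup_{\mathcal V(r)^2}p_n<\infty$ and $0<\nu(\mathcal V(r))<\infty$, where $\mathcal V(r)=\{V\le r\}$. (3) There is $\gamma\in\mathcal P_V(E)$ with $\sup_{n\in\mathbb N}\phi_{0,n}(\gamma)(G_n)<\infty$. (In the time-homogeneous case below one takes $\gamma=\eta_\infty$.) (4) Let $\chi:=\sup_{n\in\mathbb N^*,x\in E}P_n(G_n)(x)$. There are a positive $W\in\mathcal C_V(E)$, $\alpha\in(0,1]$ and a $Q$-Lyapunov function $\bar W\in\mathcal C_V(E)$ with $Q_n(W)\ge\chi W$ for all $n\ge1$ and $W^{-\alpha}\le\bar W$. In the time-homogeneous case ($P_n=P$, $G_n=G$, $Q_n=Q$), the first inequality may be relaxed to $Q(W)\ge\min\{\chi,E_0\}W$, where $(h,E_0,\eta_\infty)\in\mathcal C_V(E)\times(0,\infty)\times\mathcal P_V(E)$, $h>0$, is the leading eigen-triple: $Q(h)=E_0h$, $\eta_\infty Q=E_0\eta_\infty$, $\eta_\infty(h)=1$ (it exists under the preceding assumptions). (5) There are a positive even integer $\lambda$ and a $Q$-Lyapunov function $\bar V\in\mathcal C(E)$ with $V^\lambda\le\bar V$. (6) $V,\bar V,\bar W$ are $\eta_0$-integrable. Diffusion Monte Carlo with $N$ walkers. For each $n$ and probability $\eta$, fix a tuning parameter $\epsilon_n(\eta)\in[0,1]$ with $\epsilon_n(\eta)G_n(x)\in[0,1]$ for $\eta$-a.e. $x$, and set $S_{n,\eta}(x,dy)=\epsilon_n(\eta)G_n(x)\delta_x(dy)+(1-\epsilon_n(\eta)G_n(x))\psi_{G_n}(\eta)(dy)$,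 $K_{n+1,\eta}=S_{n,\eta}P_{n+1}$. The walkers $\xi_0^1,\dots,\xi_0^N$ are i.i.d. with law $\eta_0$; given $\xi_n=(\xi_n^i)_{1\le i\le N}$, the $\xi_{n+1}^i$ are conditionally independent with laws $K_{n+1,\eta_n^N}(\xi_n^i,\cdot)$, where $\eta_n^N:=\frac1N\sum_{i=1}^N\delta_{\xi_n^i}$. *)

theory Defs
  imports "HOL-Probability.Probability"
begin

section \<open>Function spaces and sets of measures\<close>

definition sublevel :: "('a \<Rightarrow> real) \<Rightarrow> real \<Rightarrow> 'a set" where
  "sublevel V r = {x. V x \<le> r}"

definition C_infty :: "('a::topological_space \<Rightarrow> real) set" where
  "C_infty = {V. continuous_on UNIV V \<and> bdd_below (range V) \<and> 0 < (INF x. V x) \<and>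
     (\<forall>r \<ge> (INF x. V x). sublevel V r \<noteq> {} \<and> compact (sublevel V r))}"

definition C_zero :: "('a::topological_space \<Rightarrow> real) set" where
  "C_zero = {\<lambda>x. 1 / V x | V. V \<in> C_infty}"

definition C_wt :: "('a::topological_space \<Rightarrow> real) \<Rightarrow> ('a \<Rightarrow> real) set" where
  "C_wt V = {f. continuous_on UNIV f \<and> bdd_above (range (\<lambda>x. \<bar>f x\<bar> / V x))}"

definition wnorm :: "('a \<Rightarrow> real) \<Rightarrow> ('a \<Rightarrow> real) \<Rightarrow> real" where
  "wnorm V f = (SUP x. \<bar>f x\<bar> / V x)"

definition P_wt :: "('a::topological_space \<Rightarrow> real) \<Rightarrow> 'a measure set" where
  "P_wt V = {\<mu> \<in> space (prob_algebra borel). integrable \<mu> V}"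

definition radon_measure :: "'a::topological_space measure \<Rightarrow> bool" where
  "radon_measure \<nu> \<longleftrightarrow> sets \<nu> = sets borel \<and>
     (\<forall>K. compact K \<longrightarrow> emeasure \<nu> K < \<infinity>) \<and>
     (\<forall>A \<in> sets borel. emeasure \<nu> A = (SUP K \<in> {K. compact K \<and> K \<subseteq> A}. emeasure \<nu> K))"

section \<open>Feynman--Kac models\<close>

text \<open>Transitions are indexed from 1 and potentials from 0; the value \<open>P 0\<close> is never used.\<close>

definition feller_transitions :: "(nat \<Rightarrow> 'a::topological_space \<Rightarrow> 'a measure) \<Rightarrow> bool" where
  "feller_transitions P \<longleftrightarrow> (\<forall>n\<ge>1. P n \<in> borel \<rightarrow>\<^sub>M prob_algebra borel \<and>
     (\<forall>f :: 'a \<Rightarrow> real. continuous_on UNIV f \<and> bounded (range f) \<longrightarrow>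
        continuous_on UNIV (\<lambda>x. \<integral>y. f y \<partial>P n x) \<and> bounded (range (\<lambda>x. \<integral>y. f y \<partial>P n x))))"

definition potentials :: "(nat \<Rightarrow> 'a::topological_space \<Rightarrow> real) \<Rightarrow> bool" where
  "potentials G \<longleftrightarrow> (\<forall>n. continuous_on UNIV (G n) \<and> bounded (range (G n)) \<and> (\<forall>x. 0 < G n x))"

definition Q_op :: "(nat \<Rightarrow> 'a \<Rightarrow> 'a measure) \<Rightarrow> (nat \<Rightarrow> 'a \<Rightarrow> real) \<Rightarrow> nat \<Rightarrow> ('a \<Rightarrow> real) \<Rightarrow> 'a \<Rightarrow> real"
  where "Q_op P G n f x = G (n - 1) x * (\<integral>y. f y \<partial>P n x)"

text \<open>The measures \<open>\<mu>Q\<^sub>n\<close> and \<open>\<mu>Q\<^sub>k\<^sub>,\<^sub>n = \<mu>Q\<^sub>k\<^sub>+\<^sub>1\<cdots>Q\<^sub>n\<close>.\<close>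

definition Q_right ::
  "(nat \<Rightarrow> 'a \<Rightarrow> 'a measure) \<Rightarrow> (nat \<Rightarrow> 'a \<Rightarrow> real) \<Rightarrow> nat \<Rightarrow> 'a measure \<Rightarrow> 'a measure"
  where "Q_right P G n \<mu> = density \<mu> (\<lambda>x. ennreal (G (n - 1) x)) \<bind> P n"

definition Q_flow ::
  "(nat \<Rightarrow> 'a \<Rightarrow> 'a measure) \<Rightarrow> (nat \<Rightarrow> 'a \<Rightarrow> real) \<Rightarrow> nat \<Rightarrow> nat \<Rightarrow> 'a measure \<Rightarrow> 'a measure"
  where "Q_flow P G k n \<mu> = fold (Q_right P G) [Suc k..<Suc n] \<mu>"

definition phi ::
  "(nat \<Rightarrow> 'a \<Rightarrow> 'a measure) \<Rightarrow> (nat \<Rightarrow> 'a \<Rightarrow> real) \<Rightarrow> nat \<Rightarrow> nat \<Rightarrow> 'a measure \<Rightarrow> 'a measure"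
  where "phi P G k n \<mu> =
    scale_measure (inverse (emeasure (Q_flow P G k n \<mu>) UNIV)) (Q_flow P G k n \<mu>)"

definition boltzmann_gibbs :: "('a \<Rightarrow> real) \<Rightarrow> 'a measure \<Rightarrow> 'a measure" where
  "boltzmann_gibbs g \<mu> = density \<mu> (\<lambda>x. ennreal (g x / (\<integral>y. g y \<partial>\<mu>)))"

primrec FK_flow ::
  "(nat \<Rightarrow> 'a \<Rightarrow> 'a measure) \<Rightarrow> (nat \<Rightarrow> 'a \<Rightarrow> real) \<Rightarrow> 'a measure \<Rightarrow> nat \<Rightarrow> 'a measure" where
  "FK_flow P G \<eta>0 0 = \<eta>0"
| "FK_flow P G \<eta>0 (Suc n) = boltzmann_gibbs (G n) (FK_flow P G \<eta>0 n) \<bind> P (Suc n)"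

text \<open>
  Integrability of \<open>U\<close> is stated explicitly, since the Bochner integral of a
  non-integrable function is 0 by convention.
\<close>

definition Q_lyapunov ::
  "(nat \<Rightarrow> 'a::topological_space \<Rightarrow> 'a measure) \<Rightarrow> (nat \<Rightarrow> 'a \<Rightarrow> real) \<Rightarrow> ('a \<Rightarrow> real) \<Rightarrow> bool" where
  "Q_lyapunov P G U \<longleftrightarrow> U \<in> C_infty \<and> (\<forall>x. 1 \<le> U x) \<and>
     (\<exists>\<epsilon> c \<Theta> K. 0 \<le> \<epsilon> \<and> \<epsilon> < 1 \<and> \<Theta> \<in> C_zero \<and> compact K \<and>
       (\<forall>n\<ge>1. (\<forall>x. integrable (P n x) U \<and> (\<integral>y. U y \<partial>P n x) \<le> \<epsilon> * U x + c) \<and>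
          (\<forall>x. Q_op P G n U x / U x \<le> \<Theta> x) \<and>
          (\<forall>x y. (G (n - 1) x - G (n - 1) y) *
             (indicator (- K) x * U x - indicator (- K) y * U y) \<le> 0)))"

definition local_densities ::
  "(nat \<Rightarrow> 'a::topological_space \<Rightarrow> 'a measure) \<Rightarrow> ('a \<Rightarrow> real) \<Rightarrow> (nat \<Rightarrow> 'a \<Rightarrow> 'a \<Rightarrow> real) \<Rightarrow> 'a measure \<Rightarrow> bool"
  where
  "local_densities P V p \<nu> \<longleftrightarrow> radon_measure \<nu> \<and>
     (\<forall>n\<ge>1. \<forall>x. p n x \<in> borel_measurable borel \<and> (\<forall>y. 0 \<le> p n x y) \<and>
        P n x = density \<nu> (\<lambda>y. ennreal (p n x y))) \<and>
     (\<exists>r1>0. \<forall>r\<ge>r1.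
        0 < (INF n\<in>{1..}. INF x\<in>sublevel V r. INF y\<in>sublevel V r. ennreal (p n x y)) \<and>
        (SUP n\<in>{1..}. SUP x\<in>sublevel V r. SUP y\<in>sublevel V r. ennreal (p n x y)) < \<infinity> \<and>
        0 < emeasure \<nu> (sublevel V r) \<and> emeasure \<nu> (sublevel V r) < \<infinity>)"

definition chi :: "(nat \<Rightarrow> 'a \<Rightarrow> 'a measure) \<Rightarrow> (nat \<Rightarrow> 'a \<Rightarrow> real) \<Rightarrow> ennreal" where
  "chi P G = (SUP n\<in>{1..}. SUP x. \<integral>\<^sup>+y. ennreal (G n y) \<partial>P n x)"

definition time_homogeneous ::
  "(nat \<Rightarrow> 'a \<Rightarrow> 'a measure) \<Rightarrow> (nat \<Rightarrow> 'a \<Rightarrow> real) \<Rightarrow> bool" where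
  "time_homogeneous P G \<longleftrightarrow> (\<forall>n\<ge>1. P n = P 1) \<and> (\<forall>n. G n = G 0)"

text \<open>The operator \<open>Q\<close> of a time-homogeneous model is \<open>Q\<^sub>1\<close>.\<close>

definition leading_eigen_triple ::
  "(nat \<Rightarrow> 'a::topological_space \<Rightarrow> 'a measure) \<Rightarrow> (nat \<Rightarrow> 'a \<Rightarrow> real) \<Rightarrow> ('a \<Rightarrow> real) \<Rightarrow>
    ('a \<Rightarrow> real) \<Rightarrow> real \<Rightarrow> 'a measure \<Rightarrow> bool" where
  "leading_eigen_triple P G V h E0 \<eta>inf \<longleftrightarrow>
     h \<in> C_wt V \<and> (\<forall>x. 0 < h x) \<and> 0 < E0 \<and> \<eta>inf \<in> P_wt V \<and>
     (\<forall>x. Q_op P G 1 h x = E0 * h x) \<and>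
     Q_right P G 1 \<eta>inf = scale_measure (ennreal E0) \<eta>inf \<and>
     (\<integral>x. h x \<partial>\<eta>inf) = 1"

section \<open>Diffusion Monte Carlo\<close>

definition tuning_parameters ::
  "(nat \<Rightarrow> 'a::topological_space \<Rightarrow> real) \<Rightarrow> (nat \<Rightarrow> 'a measure \<Rightarrow> real) \<Rightarrow> bool" where
  "tuning_parameters G \<epsilon> \<longleftrightarrow> (\<forall>n. \<forall>\<eta> \<in> space (prob_algebra borel).
     \<epsilon> n \<eta> \<in> {0..1} \<and> (AE x in \<eta>. \<epsilon> n \<eta> * G n x \<in> {0..1}))"

text \<open>
  The mixture \<open>q \<delta>\<^sub>x + (1 - q) \<psi>\<close>, with \<open>q = \<epsilon>\<^sub>n(\<eta>) G\<^sub>n(x)\<close>, is written as a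
  Bernoulli choice; see \<open>emeasure_selection\<close> below.
\<close>

definition selection ::
  "(nat \<Rightarrow> 'a::topological_space \<Rightarrow> real) \<Rightarrow> (nat \<Rightarrow> 'a measure \<Rightarrow> real) \<Rightarrow> nat \<Rightarrow> 'a measure \<Rightarrow> 'a \<Rightarrow> 'a measure"
  where "selection G \<epsilon> n \<eta> x =
    measure_pmf (bernoulli_pmf (\<epsilon> n \<eta> * G n x)) \<bind>
      (\<lambda>b. if b then return borel x else boltzmann_gibbs (G n) \<eta>)"

text \<open>\<open>dmc_kernel P G \<epsilon> n \<eta>\<close> is \<open>K\<^sub>n\<^sub>+\<^sub>1\<^sub>,\<^sub>\<eta>\<close>.\<close>

definition dmc_kernel ::
  "(nat \<Rightarrow> 'a::topological_space \<Rightarrow> 'a measure) \<Rightarrow> (nat \<Rightarrow> 'a \<Rightarrow> real) \<Rightarrow> (nat \<Rightarrow> 'a measure \<Rightarrow> real) \<Rightarrow>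
    nat \<Rightarrow> 'a measure \<Rightarrow> 'a \<Rightarrow> 'a measure"
  where "dmc_kernel P G \<epsilon> n \<eta> x = selection G \<epsilon> n \<eta> x \<bind> P (Suc n)"

text \<open>
  The empirical measure is the law of \<open>x\<^sub>i\<close> for an index \<open>i\<close> uniform on \<open>{0,\<dots>,N-1}\<close>.
\<close>

definition empirical :: "nat \<Rightarrow> (nat \<Rightarrow> 'a::topological_space) \<Rightarrow> 'a measure" where
  "empirical N x = distr (uniform_count_measure {..<N}) borel x"

definition walkers_sigma ::
  "'w measure \<Rightarrow> nat \<Rightarrow> (nat \<Rightarrow> 'w \<Rightarrow> 'a::topological_space) \<Rightarrow> 'w measure" where
  "walkers_sigma M N X =
     vimage_algebra (space M) (\<lambda>\<omega>. \<lambda>i\<in>{..<N}. X i \<omega>) (PiM {..<N} (\<lambda>_. borel))"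

text \<open>
  \<open>\<xi> n i\<close> is the position at time \<open>n\<close> of walker number \<open>i < N\<close>. The last clause gives the
  conditional law of \<open>\<xi>\<^sub>n\<^sub>+\<^sub>1\<close> given \<open>\<xi>\<^sub>n\<close>: it is the product of the measures
  \<open>K\<^sub>n\<^sub>+\<^sub>1\<^sub>,\<^sub>\<eta>(\<xi>\<^sub>n\<^sup>i, \<cdot>)\<close> with \<open>\<eta>\<close> the empirical measure of \<open>\<xi>\<^sub>n\<close>, tested on rectangles.
\<close>

definition dmc_walkers ::
  "(nat \<Rightarrow> 'a::topological_space \<Rightarrow> 'a measure) \<Rightarrow> (nat \<Rightarrow> 'a \<Rightarrow> real) \<Rightarrow> (nat \<Rightarrow> 'a measure \<Rightarrow> real) \<Rightarrow>
    'a measure \<Rightarrow> nat \<Rightarrow> 'w measure \<Rightarrow> (nat \<Rightarrow> nat \<Rightarrow> 'w \<Rightarrow> 'a) \<Rightarrow> bool"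
  where
  "dmc_walkers P G \<epsilon> \<eta>0 N M \<xi> \<longleftrightarrow> prob_space M \<and>
     (\<forall>n. \<forall>i<N. \<xi> n i \<in> M \<rightarrow>\<^sub>M borel) \<and>
     prob_space.indep_vars M (\<lambda>_. borel) (\<xi> 0) {..<N} \<and>
     (\<forall>i<N. distr M borel (\<xi> 0 i) = \<eta>0) \<and>
     (\<forall>n A. (\<forall>i<N. A i \<in> sets borel) \<longrightarrow>
        (AE \<omega> in M.
           real_cond_exp M (walkers_sigma M N (\<xi> n))
             (indicator {\<omega> \<in> space M. \<forall>i<N. \<xi> (Suc n) i \<omega> \<in> A i}) \<omega> =
           (\<Prod>i<N. measure (dmc_kernel P G \<epsilon> n (empirical N (\<lambda>j. \<xi> n j \<omega>)) (\<xi> n i \<omega>)) (A i))))"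

section \<open>Consistency of the definitions\<close>

lemma emeasure_selection:
  fixes G :: "nat \<Rightarrow> 'a::topological_space \<Rightarrow> real"
  assumes q: "\<epsilon> n \<eta> * G n x \<in> {0..1}" and A: "A \<in> sets borel"
    and B: "boltzmann_gibbs (G n) \<eta> \<in> space (prob_algebra borel)"
  shows "emeasure (selection G \<epsilon> n \<eta> x) A =
    ennreal (\<epsilon> n \<eta> * G n x) * indicator A x +
    ennreal (1 - \<epsilon> n \<eta> * G n x) * emeasure (boltzmann_gibbs (G n) \<eta>) A"
proof -
  let ?k = "\<lambda>b. if b then return borel x else boltzmann_gibbs (G n) \<eta>"
  have "return borel x \<in> space (prob_algebra borel)"
    by (simp add: space_prob_algebra prob_space_return)
  with B have "?k b \<in> space (subprob_algebra borel)" for b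
    by (cases b) (simp_all add: space_subprob_algebra space_prob_algebra prob_space_imp_subprob_space)
  then have m: "?k \<in> measure_pmf (bernoulli_pmf (\<epsilon> n \<eta> * G n x)) \<rightarrow>\<^sub>M subprob_algebra borel"
    by (simp add: measurable_def)
  have "emeasure (selection G \<epsilon> n \<eta> x) A =
      (\<integral>\<^sup>+b. emeasure (?k b) A \<partial>measure_pmf (bernoulli_pmf (\<epsilon> n \<eta> * G n x)))"
    unfolding selection_def by (rule emeasure_bind[OF _ m A]) simp
  also have "\<dots> = ennreal (\<epsilon> n \<eta> * G n x) * emeasure (return borel x) A +
      ennreal (1 - \<epsilon> n \<eta> * G n x) * emeasure (boltzmann_gibbs (G n) \<eta>) A"
    using q by (simp add: mult.commute)
  finally show ?thesis
    using A by simp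
qed

lemma integral_empirical:
  fixes f :: "'a::topological_space \<Rightarrow> real"
  assumes f: "f \<in> borel_measurable borel"
  shows "(\<integral>y. f y \<partial>empirical N x) = (\<Sum>i<N. f (x i)) / N"
proof -
  have "x \<in> uniform_count_measure {..<N} \<rightarrow>\<^sub>M borel"
    by (auto simp: measurable_def space_uniform_count_measure sets_uniform_count_measure)
  then have "(\<integral>y. f y \<partial>empirical N x) = (\<integral>i. f (x i) \<partial>uniform_count_measure {..<N})"
    unfolding empirical_def using f by (rule integral_distr)
  also have "\<dots> = (\<Sum>i<N. f (x i)) / N"
    by (simp add: integral_uniform_count_measure)
  finally show ?thesis .
qed

lemma boltzmann_gibbs_prob:
  assumes G: "potentials G" and \<mu>: "\<mu> \<in> space (prob_algebra borel)"
  shows "0 < (\<integral>y. G n y \<partial>\<mu>)" and "boltzmann_gibbs (G n) \<mu> \<in> space (prob_algebra borel)"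
proof -
  interpret prob_space \<mu> using \<mu> by (simp add: space_prob_algebra)
  have sets: "sets \<mu> = sets borel" using \<mu> by (simp add: space_prob_algebra)
  have pos: "0 < G n x" for x using G by (simp add: potentials_def)
  have "G n \<in> borel_measurable borel"
    using G by (simp add: potentials_def borel_measurable_continuous_onI)
  then have m[measurable]: "G n \<in> borel_measurable \<mu>"
    using measurable_cong_sets[OF sets refl] by blast
  obtain b where "\<forall>x. norm (G n x) \<le> b"
    using G unfolding potentials_def bounded_iff by blast
  then have int: "integrable \<mu> (G n)"
    by (intro integrable_const_bound[where B = b]) auto
  have "(\<integral>y. G n y \<partial>\<mu>) \<noteq> 0"
  proof
    assume "(\<integral>y. G n y \<partial>\<mu>) = 0"
    then have "AE y in \<mu>. G n y = 0"
      using integral_nonneg_eq_0_iff_AE[OF int] pos by (simp add: less_imp_le)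
    then have "AE y in \<mu>. False"
      by eventually_elim (metis pos less_irrefl)
    then show False by simp
  qed
  then show Z: "0 < (\<integral>y. G n y \<partial>\<mu>)"
    using Bochner_Integration.integral_nonneg[of \<mu> "G n"] pos by (simp add: less_imp_le order_less_le)
  have "emeasure (boltzmann_gibbs (G n) \<mu>) (space \<mu>) =
      (\<integral>\<^sup>+x. ennreal (G n x / (\<integral>y. G n y \<partial>\<mu>)) \<partial>\<mu>)"
    unfolding boltzmann_gibbs_def
    by (subst emeasure_density) (auto intro!: nn_integral_cong)
  also have "\<dots> = ennreal (\<integral>x. G n x / (\<integral>y. G n y \<partial>\<mu>) \<partial>\<mu>)"
    using Z pos int by (intro nn_integral_eq_integral) (auto simp: less_imp_le)
  also have "\<dots> = 1"
    using Z by simp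
  finally show "boltzmann_gibbs (G n) \<mu> \<in> space (prob_algebra borel)"
    by (auto simp: space_prob_algebra sets boltzmann_gibbs_def intro!: prob_spaceI)
qed

lemma FK_flow_eq_phi:
  assumes P: "feller_transitions P" and G: "potentials G"
    and init: "\<eta>0 \<in> space (prob_algebra borel)"
  shows "FK_flow P G \<eta>0 n = phi P G 0 n \<eta>0"
proof -
  have "FK_flow P G \<eta>0 n \<in> space (prob_algebra borel) \<and>
    (\<exists>r>0. Q_flow P G 0 n \<eta>0 = scale_measure (ennreal r) (FK_flow P G \<eta>0 n))" for n
  proof (induction n)
    case 0
    have "scale_measure (ennreal 1) \<eta>0 = \<eta>0" by simp
    then show ?case using init unfolding Q_flow_def by (auto intro!: exI[of _ "1::real"])
  next
    case (Suc n)
    define \<mu> where "\<mu> = FK_flow P G \<eta>0 n"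
    define Z where "Z = (\<integral>y. G n y \<partial>\<mu>)"
    from Suc obtain r where \<mu>: "\<mu> \<in> space (prob_algebra borel)" and r: "0 < r"
      and Q: "Q_flow P G 0 n \<eta>0 = scale_measure (ennreal r) \<mu>"
      by (auto simp: \<mu>_def)
    note bg = boltzmann_gibbs_prob[OF G \<mu>, of n]
    have sets: "sets \<mu> = sets borel" and sp: "space \<mu> = UNIV"
      using \<mu> by (auto simp: space_prob_algebra dest: sets_eq_imp_space_eq)
    have kp: "P (Suc n) \<in> borel \<rightarrow>\<^sub>M prob_algebra borel"
      using P by (simp add: feller_transitions_def)
    then have k: "P (Suc n) \<in> borel \<rightarrow>\<^sub>M subprob_algebra borel"
      by (rule measurable_prob_algebraD)
    have km: "P (Suc n) \<in> N \<rightarrow>\<^sub>M subprob_algebra borel" if "sets N = sets borel" for N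
      using k measurable_cong_sets[OF that refl] by blast
    have "G n \<in> borel_measurable borel"
      using G by (simp add: potentials_def borel_measurable_continuous_onI)
    then have gm: "G n \<in> borel_measurable N" if "sets N = sets borel" for N :: "'a measure"
      using measurable_cong_sets[OF that refl] by blast
    have pos: "0 \<le> G n x" for x using G by (simp add: potentials_def less_imp_le)
    have new: "FK_flow P G \<eta>0 (Suc n) = boltzmann_gibbs (G n) \<mu> \<bind> P (Suc n)"
      by (simp add: \<mu>_def)
    have prob: "FK_flow P G \<eta>0 (Suc n) \<in> space (prob_algebra borel)"
      unfolding new
      by (auto simp: space_prob_algebra intro!: prob_space_bind'[OF bg(2) kp] sets_bind'[OF bg(2) kp])
    have step: "Q_flow P G 0 (Suc n) \<eta>0 = Q_right P G (Suc n) (Q_flow P G 0 n \<eta>0)"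
      by (simp add: Q_flow_def)
    have "Q_flow P G 0 (Suc n) \<eta>0 = scale_measure (ennreal (r * Z)) (FK_flow P G \<eta>0 (Suc n))"
    proof (rule measure_eqI)
      have s1: "sets (Q_flow P G 0 (Suc n) \<eta>0) = sets borel"
        unfolding step Q Q_right_def
        by (rule sets_bind) (simp_all add: sets_kernel[OF k] space_scale_measure sp)
      moreover have "sets (FK_flow P G \<eta>0 (Suc n)) = sets borel"
        using prob by (simp add: space_prob_algebra)
      ultimately show "sets (Q_flow P G 0 (Suc n) \<eta>0) =
          sets (scale_measure (ennreal (r * Z)) (FK_flow P G \<eta>0 (Suc n)))" by simp
      fix A assume "A \<in> sets (Q_flow P G 0 (Suc n) \<eta>0)"
      then have A: "A \<in> sets borel" using s1 by simp
      have em: "(\<lambda>x. emeasure (P (Suc n) x) A) \<in> borel_measurable \<mu>"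
        using measurable_emeasure_kernel[OF km[OF sets] A] .
      let ?I = "\<integral>\<^sup>+x. ennreal (G n x) * emeasure (P (Suc n) x) A \<partial>\<mu>"
      have "emeasure (Q_flow P G 0 (Suc n) \<eta>0) A =
          (\<integral>\<^sup>+x. emeasure (P (Suc n) x) A
            \<partial>density (scale_measure (ennreal r) \<mu>) (\<lambda>x. ennreal (G n x)))"
        unfolding step Q Q_right_def
        by (subst emeasure_bind[OF _ _ A]) (auto simp: sp sets space_scale_measure intro!: km)
      also have "\<dots> = (\<integral>\<^sup>+x. ennreal (G n x) * emeasure (P (Suc n) x) A
            \<partial>scale_measure (ennreal r) \<mu>)"
        using gm[OF sets] em by (subst nn_integral_density) auto
      also have "\<dots> = ennreal r * ?I"
        using gm[OF sets] em by (subst nn_integral_scale_measure) auto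
      finally have L: "emeasure (Q_flow P G 0 (Suc n) \<eta>0) A = ennreal r * ?I" .
      have "emeasure (FK_flow P G \<eta>0 (Suc n)) A =
          (\<integral>\<^sup>+x. emeasure (P (Suc n) x) A \<partial>boltzmann_gibbs (G n) \<mu>)"
        unfolding new
        by (subst emeasure_bind[OF _ _ A]) (auto simp: sp sets boltzmann_gibbs_def intro!: km)
      also have "\<dots> = (\<integral>\<^sup>+x. ennreal (G n x / Z) * emeasure (P (Suc n) x) A \<partial>\<mu>)"
        unfolding boltzmann_gibbs_def Z_def using gm[OF sets] em
        by (subst nn_integral_density) auto
      finally have "ennreal (r * Z) * emeasure (FK_flow P G \<eta>0 (Suc n)) A =
          ennreal r * (ennreal Z * (\<integral>\<^sup>+x. ennreal (G n x / Z) * emeasure (P (Suc n) x) A \<partial>\<mu>))"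
        using r bg(1) by (simp add: ennreal_mult Z_def mult.assoc less_imp_le)
      also have "ennreal Z * (\<integral>\<^sup>+x. ennreal (G n x / Z) * emeasure (P (Suc n) x) A \<partial>\<mu>) =
          (\<integral>\<^sup>+x. ennreal Z * (ennreal (G n x / Z) * emeasure (P (Suc n) x) A) \<partial>\<mu>)"
        using gm[OF sets] em by (subst nn_integral_cmult) auto
      also have "\<dots> = ?I"
        using bg(1) pos
        by (intro nn_integral_cong)
          (simp add: Z_def mult.assoc[symmetric] ennreal_mult[symmetric] less_imp_le)
      finally show "emeasure (Q_flow P G 0 (Suc n) \<eta>0) A =
          emeasure (scale_measure (ennreal (r * Z)) (FK_flow P G \<eta>0 (Suc n))) A"
        using L by simp
    qed
    moreover have "0 < r * Z" using r bg(1) by (simp add: Z_def)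
    ultimately show ?case using prob by blast
  qed
  then obtain r where prob: "FK_flow P G \<eta>0 n \<in> space (prob_algebra borel)" and r: "0 < r"
    and Q: "Q_flow P G 0 n \<eta>0 = scale_measure (ennreal r) (FK_flow P G \<eta>0 n)"
    by blast
  have "emeasure (FK_flow P G \<eta>0 n) UNIV = 1"
    using prob prob_space.emeasure_space_1[of "FK_flow P G \<eta>0 n"]
    by (auto simp: space_prob_algebra dest: sets_eq_imp_space_eq)
  moreover have "inverse (ennreal r) * ennreal r = 1"
    using r by (simp add: inverse_ennreal ennreal_mult[symmetric])
  ultimately show ?thesis
    by (simp add: phi_def Q)
qed

end

theory Submission
  imports Defs
begin

text \<open>
  Let \<open>\<kappa>\<close> be \<open>\<chi>\<close> or \<open>E0\<close>. The functions \<open>H = Q\<^bsub>k,n\<^esub>(1) / \<kappa>\<^bsup>n-k\<^esup>\<close> satisfy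
  \<open>W / (c V) \<le> H \<le> C V\<close> uniformly: the upper bound comes from the Lyapunov inequalities, the lower
  one from \<open>Q(W) \<ge> \<kappa> W\<close>. Hence \<open>V / H\<close> is a Lyapunov function for the time-inhomogeneous
  Markov transitions \<open>f \<mapsto> Q(f H) / Q(H)\<close>, and a Harris argument with a weighted oscillation in
  the style of Hairer and Mattingly shows that the normalised semigroup forgets its initial measure
  \<open>\<mu>\<close> geometrically fast, with constants polynomial in \<open>\<mu>(V)\<close> and \<open>1 / \<mu>(W)\<close>.

  Since large \<open>G\<close> goes with small \<open>U\<close> outside a compact set, selection increases
  \<open>\<mu>(U)\<close> by at most an additive constant, so all moments of Lyapunov functions under \<open>\<eta>\<^sub>n\<close> and, in mean, under
  the occupation measures are bounded uniformly in \<open>n\<close> and \<open>N\<close>; as \<open>W powr (- \<alpha>)\<close> is one of the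
  controlled functions, small values of \<open>\<mu>(W)\<close> are unlikely. One step of the walkers makes an
  \<open>L\<^sup>1\<close> error of order \<open>N\<^bsup>-1/2\<^esup>\<close>. Cutting off \<open>\<mu>(V)\<close> and \<open>1 / \<mu>(W)\<close> at the level
  \<open>r = N\<^bsup>1/8\<^esup>\<close>, summing the propagated errors of the last \<open>N\<^bsup>\<alpha>/16\<^esup>\<close> steps or so and forgetting
  everything before gives \<open>O(N\<^bsup>-\<alpha>/16\<^esup>)\<close> for test functions with values in \<open>[0, 1]\<close>. Truncating \<open>f\<close>
  at a small power of \<open>N\<close> and using the \<open>V\<^sup>\<lambda>\<close> moments yields the \<open>L\<^sup>p\<close> bound with \<open>\<beta> = \<alpha> / (16 p)\<close>.
\<close>

section \<open>Kernels and Lyapunov functions\<close>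

text \<open>Normalising divides by \<mu>(H), so the stability constants grow with
  \<open>mass_ratio \<mu>\<close>, the quotient of \<mu>(V) by \<mu>(W). For an occupation measure
  this quotient is random, and its moments are not controlled. Test functions with values in
  \<open>[0, 1]\<close> remove the difficulty: errors are then at most 1, so the event of a large
  quotient costs only its probability, which first moments of \<open>V\<close> and
  \<open>Wbar\<close> control. A second obstacle is measurability. The tuning parameter \<epsilon>
  is an arbitrary function of the measure, so nothing makes the kernel of a single walker measurable
  in \<omega>. It is known only to agree almost everywhere with a conditional expectation, hence to
  be measurable for the completion of \<open>M\<close>; mixed moments of the walkers are computed
  there. Averaging over the walkers eliminates \<epsilon>. Oscillations of quotients by
  \<open>H\<close> are treated with denominators cleared: the inequality is then linear in each
  variable, and kernels and measures act on it by positivity alone.\<close>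

definition dominated :: "('a \<Rightarrow> real) \<Rightarrow> ('a::topological_space \<Rightarrow> real) \<Rightarrow> bool" where
  "dominated U f \<longleftrightarrow> f \<in> borel_measurable borel \<and> (\<exists>c. \<forall>x. \<bar>f x\<bar> \<le> c * U x)"

lemma dominatedI:
  "f \<in> borel_measurable borel \<Longrightarrow> (\<And>x. \<bar>f x\<bar> \<le> c * U x) \<Longrightarrow> dominated U f"
  by (auto simp: dominated_def)

lemma dominated_measurable: "dominated U f \<Longrightarrow> f \<in> borel_measurable borel"
  unfolding dominated_def by (rule conjunct1)

lemma dominatedE:
  assumes "dominated U f" "\<And>x. 0 \<le> U x"
  obtains c where "0 \<le> c" "\<And>x. \<bar>f x\<bar> \<le> c * U x"
proof -
  from assms(1) obtain c where c: "\<And>x. \<bar>f x\<bar> \<le> c * U x"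
    by (auto simp: dominated_def)
  have "\<bar>f x\<bar> \<le> \<bar>c\<bar> * U x" for x
    using c[of x] mult_right_mono[OF abs_ge_self[of c] assms(2)[of x]] by linarith
  then show ?thesis by (intro that[of "\<bar>c\<bar>"]) auto
qed

lemma dominated_add:
  assumes "dominated U f" "dominated U g"
  shows "dominated U (\<lambda>x. f x + g x)"
proof -
  from assms obtain c d where c: "\<And>x. \<bar>f x\<bar> \<le> c * U x" and d: "\<And>x. \<bar>g x\<bar> \<le> d * U x"
    by (auto simp: dominated_def)
  show ?thesis
  proof (rule dominatedI[where c = "c + d"])
    show "(\<lambda>x. f x + g x) \<in> borel_measurable borel"
      using assms[THEN dominated_measurable] by simp
    show "\<bar>f x + g x\<bar> \<le> (c + d) * U x" for x
      using c[of x] d[of x] abs_triangle_ineq[of "f x" "g x"] by (simp add: distrib_right)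
  qed
qed

lemma dominated_cmult:
  assumes "dominated U f"
  shows "dominated U (\<lambda>x. a * f x)"
proof -
  from assms obtain c where c: "\<And>x. \<bar>f x\<bar> \<le> c * U x"
    by (auto simp: dominated_def)
  show ?thesis
  proof (rule dominatedI[where c = "\<bar>a\<bar> * c"])
    show "(\<lambda>x. a * f x) \<in> borel_measurable borel"
      using assms[THEN dominated_measurable] by simp
    show "\<bar>a * f x\<bar> \<le> \<bar>a\<bar> * c * U x" for x
      using mult_left_mono[OF c[of x], of "\<bar>a\<bar>"] by (simp add: abs_mult mult.assoc)
  qed
qed

lemma dominated_diff:
  "dominated U f \<Longrightarrow> dominated U g \<Longrightarrow> dominated U (\<lambda>x. f x - g x)"
  using dominated_add[of U f "\<lambda>x. (-1) * g x"] dominated_cmult[of U g "-1"] by simp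

lemma dominated_le:
  assumes "dominated U f" "g \<in> borel_measurable borel" "\<And>x. \<bar>g x\<bar> \<le> \<bar>f x\<bar>"
  shows "dominated U g"
  using assms unfolding dominated_def by (meson order_trans)

lemma dominated_self: "U \<in> borel_measurable borel \<Longrightarrow> (\<And>x. 0 \<le> U x) \<Longrightarrow> dominated U U"
  by (rule dominatedI[where c = 1]) auto

lemma dominated_const:
  assumes "\<And>x. (1::real) \<le> U x"
  shows "dominated U (\<lambda>_. a)"
proof (rule dominatedI[where c = "\<bar>a\<bar>"])
  show "\<bar>a\<bar> \<le> \<bar>a\<bar> * U x" for x
    using mult_left_mono[OF assms[of x], of "\<bar>a\<bar>"] by simp
qed simp

lemma borel_measurable_sets_eq:
  "sets \<mu> = sets borel \<Longrightarrow> f \<in> borel_measurable borel \<Longrightarrow> f \<in> borel_measurable \<mu>"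
  using measurable_cong_sets by blast

lemma borel_measurable_sets_eq_ennreal:
  "sets \<mu> = sets borel \<Longrightarrow> f \<in> borel_measurable borel \<Longrightarrow> f \<in> borel_measurable \<mu>"
  for f :: "_ \<Rightarrow> ennreal"
  using measurable_cong_sets by blast

text \<open>The class \<open>dominated U\<close> stands in for \<open>C_wt U\<close>, with
  measurability instead of continuity, so that cut-off functions and images under kernels stay
  inside it. Integrability is then a matter of the weight alone.\<close>

lemma integrable_dominated:
  fixes \<mu> :: "'a::topological_space measure"
  assumes "sets \<mu> = sets borel" "integrable \<mu> U" "dominated U f"
  shows "integrable \<mu> f"
proof -
  from assms(3) obtain c where c: "\<And>x. \<bar>f x\<bar> \<le> c * U x"
    by (auto simp: dominated_def)
  show ?thesis
  proof (rule Bochner_Integration.integrable_bound[where f = "\<lambda>x. c * U x"])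
    show "f \<in> borel_measurable \<mu>"
      using borel_measurable_sets_eq[OF assms(1) dominated_measurable[OF assms(3)]] .
    show "AE x in \<mu>. norm (f x) \<le> norm (c * U x)"
      using order_trans[OF c abs_ge_self] by (intro AE_I2) (simp only: real_norm_def)
  qed (use assms(2) in simp)
qed

abbreviation (input) borel_prob :: "'a::topological_space measure \<Rightarrow> bool" where
  "borel_prob \<mu> \<equiv> \<mu> \<in> space (prob_algebra borel)"

lemma borel_probD:
  assumes "borel_prob \<mu>"
  shows "prob_space \<mu>" "sets \<mu> = sets borel" "space \<mu> = UNIV"
  using assms by (auto simp: space_prob_algebra dest: sets_eq_imp_space_eq)

lemma Q_lyapunovD:
  assumes "Q_lyapunov P G U"
  shows "U \<in> C_infty" "1 \<le> U x" "U \<in> borel_measurable borel" "continuous_on UNIV U"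
  using assms by (auto simp: Q_lyapunov_def C_infty_def intro: borel_measurable_continuous_onI)

text \<open>The definition allows a negative additive constant; passing to its absolute value gives
  a drift that can be scaled and iterated.\<close>

lemma Q_lyapunov_transition:
  assumes "Q_lyapunov P G U"
  obtains e c where "0 \<le> e" "e < 1" "0 \<le> c"
    "\<And>n x. 1 \<le> n \<Longrightarrow> integrable (P n x) U"
    "\<And>n x. 1 \<le> n \<Longrightarrow> (\<integral>y. U y \<partial>P n x) \<le> e * U x + c"
proof -
  from assms obtain e c where "0 \<le> e" "e < 1"
    and "\<And>n x. 1 \<le> n \<Longrightarrow> integrable (P n x) U \<and> (\<integral>y. U y \<partial>P n x) \<le> e * U x + c"
    unfolding Q_lyapunov_def by blast
  then show ?thesis
    using abs_ge_self[of c] by (intro that[of e "\<bar>c\<bar>"]) (auto intro: order_trans[OF _ add_left_mono])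
qed

lemma Q_lyapunov_transition_bound:
  assumes "Q_lyapunov P G U"
  obtains b where "0 \<le> b" "\<And>n x. 1 \<le> n \<Longrightarrow> integrable (P n x) U"
    "\<And>n x. 1 \<le> n \<Longrightarrow> (\<integral>y. U y \<partial>P n x) \<le> b * U x"
proof -
  obtain e c where ec: "0 \<le> e" "e < 1" "0 \<le> c"
    and i: "\<And>n x. 1 \<le> n \<Longrightarrow> integrable (P n x) U"
    and d: "\<And>n x. 1 \<le> n \<Longrightarrow> (\<integral>y. U y \<partial>P n x) \<le> e * U x + c"
    using Q_lyapunov_transition[OF assms] by blast
  have "c \<le> c * U x" for x
    using mult_left_mono[OF Q_lyapunovD(2)[OF assms, of x] ec(3)] by simp
  then have "(\<integral>y. U y \<partial>P n x) \<le> (e + c) * U x" if "1 \<le> n" for n x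
    using d[OF that, of x] by (simp add: distrib_right) (meson add_left_mono order_trans)
  then show ?thesis using ec i by (intro that[of "e + c"]) auto
qed

section \<open>One step of the flow of measures and its action on weighted functions\<close>

locale fk_model =
  fixes P :: "nat \<Rightarrow> 'a::polish_space \<Rightarrow> 'a measure" and G :: "nat \<Rightarrow> 'a \<Rightarrow> real"
  assumes feller: "feller_transitions P" and pot: "potentials G"
begin

text \<open>This is \<phi> over a single time step. It is a map on measures because it is applied to
  the deterministic flow as well as to random occupation measures.\<close>

definition step :: "nat \<Rightarrow> 'a measure \<Rightarrow> 'a measure" where
  "step n \<mu> = boltzmann_gibbs (G n) \<mu> \<bind> P (Suc n)"

lemma kernel: "1 \<le> n \<Longrightarrow> P n \<in> borel \<rightarrow>\<^sub>M prob_algebra borel"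
  using feller by (simp add: feller_transitions_def)

lemma kernel_prob: "1 \<le> n \<Longrightarrow> borel_prob (P n x)"
  using measurable_space[OF kernel, of n x] by simp

lemma G_pos: "0 < G n x"
  using pot by (simp add: potentials_def)

lemma G_meas [measurable]: "G n \<in> borel_measurable borel"
  using pot by (simp add: potentials_def borel_measurable_continuous_onI)

lemma G_bounded: "\<exists>b>0. \<forall>x. G n x \<le> b"
proof -
  obtain b where b: "\<And>x. norm (G n x) \<le> b"
    using pot unfolding potentials_def bounded_iff by blast
  have "G n x \<le> b" for x using b[of x] by simp
  moreover have "0 < b" using b[of undefined] G_pos[of n undefined] by simp
  ultimately show ?thesis by blast
qed

lemma integrable_G: "borel_prob \<mu> \<Longrightarrow> integrable \<mu> (G n)"
proof -
  assume \<mu>: "borel_prob \<mu>"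
  interpret prob_space \<mu> using borel_probD[OF \<mu>] by simp
  obtain b where "\<And>x. G n x \<le> b" using G_bounded[of n] by blast
  then show ?thesis
    using borel_measurable_sets_eq[OF borel_probD(2)[OF \<mu>] G_meas]
    by (intro integrable_const_bound[where B = b]) (auto simp: less_imp_le[OF G_pos])
qed

lemma integral_G_pos: "borel_prob \<mu> \<Longrightarrow> 0 < (\<integral>x. G n x \<partial>\<mu>)"
  using boltzmann_gibbs_prob(1)[OF pot] by simp

lemma step_prob: "borel_prob \<mu> \<Longrightarrow> borel_prob (step n \<mu>)"
  unfolding step_def
  using boltzmann_gibbs_prob(2)[OF pot, of \<mu> n] kernel[of "Suc n"]
  by (auto simp: space_prob_algebra intro!: prob_space_bind' sets_bind')

lemma FK_flow_Suc: "FK_flow P G \<mu> (Suc n) = step n (FK_flow P G \<mu> n)"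
  by (simp add: step_def)

lemma FK_flow_prob: "borel_prob \<mu> \<Longrightarrow> borel_prob (FK_flow P G \<mu> n)"
  by (induction n) (simp_all only: FK_flow_Suc step_prob FK_flow.simps(1))

lemma nn_integral_kernel_meas [measurable]:
  "1 \<le> n \<Longrightarrow> f \<in> borel_measurable borel \<Longrightarrow> (\<lambda>x. \<integral>\<^sup>+y. f y \<partial>P n x) \<in> borel_measurable borel"
  by (rule measurable_compose[OF measurable_prob_algebraD[OF kernel]
        nn_integral_measurable_subprob_algebra])

lemma integral_kernel_meas [measurable]:
  fixes f :: "'a \<Rightarrow> real"
  shows "1 \<le> n \<Longrightarrow> f \<in> borel_measurable borel \<Longrightarrow> (\<lambda>x. \<integral>y. f y \<partial>P n x) \<in> borel_measurable borel"
  by (rule measurable_compose[OF measurable_prob_algebraD[OF kernel]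
        integral_measurable_subprob_algebra])

lemma nn_integral_boltzmann_gibbs:
  assumes \<mu>: "borel_prob \<mu>" and f: "f \<in> borel_measurable borel"
  shows "(\<integral>\<^sup>+x. f x \<partial>boltzmann_gibbs (G n) \<mu>) =
    (\<integral>\<^sup>+x. ennreal (G n x / (\<integral>y. G n y \<partial>\<mu>)) * f x \<partial>\<mu>)"
  unfolding boltzmann_gibbs_def
  using borel_measurable_sets_eq[OF borel_probD(2)[OF \<mu>] G_meas]
    borel_measurable_sets_eq[OF borel_probD(2)[OF \<mu>] f]
  by (subst nn_integral_density) auto

lemma nn_integral_step_bg:
  assumes \<mu>: "borel_prob \<mu>" and f: "f \<in> borel_measurable borel"
  shows "(\<integral>\<^sup>+y. f y \<partial>step n \<mu>) = (\<integral>\<^sup>+x. (\<integral>\<^sup>+y. f y \<partial>P (Suc n) x) \<partial>boltzmann_gibbs (G n) \<mu>)"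
proof -
  have "P (Suc n) \<in> boltzmann_gibbs (G n) \<mu> \<rightarrow>\<^sub>M subprob_algebra borel"
    using measurable_prob_algebraD[OF kernel[of "Suc n"]]
      measurable_cong_sets[OF borel_probD(2)[OF boltzmann_gibbs_prob(2)[OF pot \<mu>, of n]] refl]
    by auto
  then show ?thesis
    unfolding step_def by (rule nn_integral_bind[OF f])
qed

lemma nn_integral_step:
  assumes \<mu>: "borel_prob \<mu>" and f: "f \<in> borel_measurable borel"
  shows "(\<integral>\<^sup>+y. f y \<partial>step n \<mu>) =
    (\<integral>\<^sup>+x. ennreal (G n x / (\<integral>y. G n y \<partial>\<mu>)) * (\<integral>\<^sup>+y. f y \<partial>P (Suc n) x) \<partial>\<mu>)"
  unfolding nn_integral_step_bg[OF assms]
  by (rule nn_integral_boltzmann_gibbs[OF \<mu> nn_integral_kernel_meas[OF _ f]]) simp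

end

text \<open>The part of the Lyapunov property that lets \<open>Q_op\<close> act on
  \<open>dominated U\<close>; the constant may depend on \<open>n\<close>. It is instantiated with
  the Lyapunov functions and with the constant 1, for which \<open>dominated\<close> means
  measurable and bounded.\<close>

locale tame_weight = fk_model +
  fixes U :: "'a \<Rightarrow> real"
  assumes U_ge1: "\<And>x. 1 \<le> U x"
    and U_meas [measurable]: "U \<in> borel_measurable borel"
    and U_kernel: "\<And>n. 1 \<le> n \<Longrightarrow> \<exists>b\<ge>0. \<forall>x. integrable (P n x) U \<and> (\<integral>y. U y \<partial>P n x) \<le> b * U x"
begin

lemma U_nonneg: "0 \<le> U x" "0 < U x"
  using U_ge1[of x] by auto

lemma integrable_kernel:
  "1 \<le> n \<Longrightarrow> dominated U f \<Longrightarrow> integrable (P n x) f"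
  using integrable_dominated[of "P n x" U f] borel_probD(2)[OF kernel_prob] U_kernel[of n] by auto

lemma dominated_kernel:
  assumes n: "1 \<le> n" and f: "dominated U f"
  shows "dominated U (\<lambda>x. \<integral>y. f y \<partial>P n x)"
proof -
  obtain b where b: "0 \<le> b" "\<And>x. integrable (P n x) U" "\<And>x. (\<integral>y. U y \<partial>P n x) \<le> b * U x"
    using U_kernel[OF n] by auto
  obtain c where c: "0 \<le> c" "\<And>x. \<bar>f x\<bar> \<le> c * U x"
    using dominatedE[OF f U_nonneg(1)] by blast
  show ?thesis
  proof (rule dominatedI[where c = "c * b"])
    show "(\<lambda>x. \<integral>y. f y \<partial>P n x) \<in> borel_measurable borel"
      using n dominated_measurable[OF f] by simp
    fix x
    have "\<bar>\<integral>y. f y \<partial>P n x\<bar> \<le> (\<integral>y. \<bar>f y\<bar> \<partial>P n x)" by simp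
    also have "\<dots> \<le> (\<integral>y. c * U y \<partial>P n x)"
      using integrable_kernel[OF n f, of x] b(2) c(2) by (intro integral_mono) auto
    also have "\<dots> \<le> c * (b * U x)"
      using b(3) c(1) by (simp add: mult_left_mono)
    finally show "\<bar>\<integral>y. f y \<partial>P n x\<bar> \<le> c * b * U x" by simp
  qed
qed

lemma dominated_Q_op:
  assumes n: "1 \<le> n" and f: "dominated U f"
  shows "dominated U (Q_op P G n f)"
proof -
  obtain b where b: "0 < b" "\<And>x. G (n - 1) x \<le> b" using G_bounded[of "n - 1"] by blast
  have "dominated U (\<lambda>x. b * (\<integral>y. f y \<partial>P n x))"
    using dominated_cmult[OF dominated_kernel[OF n f]] .
  then show ?thesis
  proof (rule dominated_le)
    show "Q_op P G n f \<in> borel_measurable borel"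
      unfolding Q_op_def using n dominated_measurable[OF f] by simp
    show "\<bar>Q_op P G n f x\<bar> \<le> \<bar>b * (\<integral>y. f y \<partial>P n x)\<bar>" for x
      using b G_pos[of "n-1" x] by (auto simp: Q_op_def abs_mult intro!: mult_right_mono)
  qed
qed

lemma Q_op_mono:
  assumes "1 \<le> n" "dominated U f" "dominated U g" "\<And>x. f x \<le> g x"
  shows "Q_op P G n f x \<le> Q_op P G n g x"
  unfolding Q_op_def using assms integrable_kernel G_pos
  by (intro mult_left_mono integral_mono) (auto intro: less_imp_le)

lemma Q_op_add:
  assumes "1 \<le> n" "dominated U f" "dominated U g"
  shows "Q_op P G n (\<lambda>x. f x + g x) x = Q_op P G n f x + Q_op P G n g x"
  unfolding Q_op_def using assms integrable_kernel by (simp add: distrib_left)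

lemma Q_op_diff:
  assumes "1 \<le> n" "dominated U f" "dominated U g"
  shows "Q_op P G n (\<lambda>x. f x - g x) x = Q_op P G n f x - Q_op P G n g x"
  unfolding Q_op_def using assms integrable_kernel by (simp add: right_diff_distrib)

lemma Q_op_cmult: "Q_op P G n (\<lambda>x. a * f x) x = a * Q_op P G n f x"
  unfolding Q_op_def by simp

text \<open>For nonnegative \<open>f\<close> the computation runs in nonnegative integrals, where
  unfolding the composed measure is free, and the finite result yields integrability as well. The
  form \<open>has_bochner_integral\<close> keeps both facts.\<close>

lemma step_nonneg:
  assumes \<mu>: "borel_prob \<mu>" and U: "integrable \<mu> U" and f: "dominated U f" and pos: "\<And>x. 0 \<le> f x"
  shows "has_bochner_integral (step n \<mu>) f ((\<integral>x. Q_op P G (Suc n) f x \<partial>\<mu>) / (\<integral>x. G n x \<partial>\<mu>))"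
proof (rule has_bochner_integral_nn_integral)
  note Z = integral_G_pos[OF \<mu>, of n]
  have Qpos: "0 \<le> Q_op P G (Suc n) f x" for x
    unfolding Q_op_def using pos G_pos[of n x] by (simp add: less_imp_le)
  have Qint: "integrable \<mu> (Q_op P G (Suc n) f)"
    using integrable_dominated[OF borel_probD(2)[OF \<mu>] U dominated_Q_op[OF _ f]] by simp
  show "f \<in> borel_measurable (step n \<mu>)"
    using borel_measurable_sets_eq[OF borel_probD(2)[OF step_prob[OF \<mu>]] dominated_measurable[OF f]] .
  show "AE x in step n \<mu>. 0 \<le> f x" using pos by simp
  show "0 \<le> (\<integral>x. Q_op P G (Suc n) f x \<partial>\<mu>) / (\<integral>x. G n x \<partial>\<mu>)"
    using Z Qpos by (simp add: Bochner_Integration.integral_nonneg)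
  have "(\<integral>\<^sup>+x. ennreal (f x) \<partial>step n \<mu>) =
     (\<integral>\<^sup>+x. ennreal (G n x / (\<integral>y. G n y \<partial>\<mu>)) * (\<integral>\<^sup>+y. ennreal (f y) \<partial>P (Suc n) x) \<partial>\<mu>)"
    using dominated_measurable[OF f] by (intro nn_integral_step[OF \<mu>]) simp
  also have "\<dots> = (\<integral>\<^sup>+x. ennreal (Q_op P G (Suc n) f x / (\<integral>y. G n y \<partial>\<mu>)) \<partial>\<mu>)"
  proof (rule nn_integral_cong)
    fix x
    have "(\<integral>\<^sup>+y. ennreal (f y) \<partial>P (Suc n) x) = ennreal (\<integral>y. f y \<partial>P (Suc n) x)"
      using integrable_kernel[OF _ f, of "Suc n"] pos by (intro nn_integral_eq_integral) auto
    then show "ennreal (G n x / (\<integral>y. G n y \<partial>\<mu>)) * (\<integral>\<^sup>+y. ennreal (f y) \<partial>P (Suc n) x) =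
       ennreal (Q_op P G (Suc n) f x / (\<integral>y. G n y \<partial>\<mu>))"
      using Z G_pos[of n x] pos
      by (simp add: Q_op_def ennreal_mult[symmetric] Bochner_Integration.integral_nonneg)
  qed
  also have "\<dots> = ennreal (\<integral>x. Q_op P G (Suc n) f x / (\<integral>y. G n y \<partial>\<mu>) \<partial>\<mu>)"
    using Qint Qpos Z by (intro nn_integral_eq_integral) auto
  finally show "(\<integral>\<^sup>+x. ennreal (f x) \<partial>step n \<mu>) =
     ennreal ((\<integral>x. Q_op P G (Suc n) f x \<partial>\<mu>) / (\<integral>x. G n x \<partial>\<mu>))" by simp
qed

lemma integrable_step: "borel_prob \<mu> \<Longrightarrow> integrable \<mu> U \<Longrightarrow> integrable (step n \<mu>) U"
  using has_bochner_integral_integrable step_nonneg[of \<mu> U n] dominated_self[OF U_meas U_nonneg(1)]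
    U_nonneg(1) has_bochner_integral_iff by blast

lemma integral_step:
  assumes \<mu>: "borel_prob \<mu>" and U: "integrable \<mu> U" and f: "dominated U f"
  shows "(\<integral>x. f x \<partial>step n \<mu>) = (\<integral>x. Q_op P G (Suc n) f x \<partial>\<mu>) / (\<integral>x. G n x \<partial>\<mu>)"
proof -
  obtain c where c: "0 \<le> c" "\<And>x. \<bar>f x\<bar> \<le> c * U x"
    using dominatedE[OF f U_nonneg(1)] by blast
  \<comment> \<open>Shifting by \<open>c * U\<close> makes \<open>f\<close> nonnegative;
    \<open>g\<close> and \<open>c * U\<close> both fall under the nonnegative case.\<close>
  define g where "g x = f x + c * U x" for x
  note dU = dominated_cmult[OF dominated_self[OF U_meas U_nonneg(1)], of c]
  have g: "dominated U g" unfolding g_def by (rule dominated_add[OF f dU])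
  have gpos: "0 \<le> g x" for x unfolding g_def using c(2)[of x] by (simp add: abs_le_iff)
  note int = integrable_dominated[OF borel_probD(2)[OF \<mu>] U]
  have fe: "f = (\<lambda>x. g x - c * U x)" by (simp add: g_def)
  have "has_bochner_integral (step n \<mu>) (\<lambda>x. g x - c * U x)
     ((\<integral>x. Q_op P G (Suc n) g x \<partial>\<mu>) / (\<integral>x. G n x \<partial>\<mu>)
       - (\<integral>x. Q_op P G (Suc n) (\<lambda>x. c * U x) x \<partial>\<mu>) / (\<integral>x. G n x \<partial>\<mu>))"
    using c(1) U_nonneg(1)
    by (intro has_bochner_integral_diff step_nonneg[OF \<mu> U] g gpos dU) auto
  then have "(\<integral>x. f x \<partial>step n \<mu>) = ((\<integral>x. Q_op P G (Suc n) g x \<partial>\<mu>) / (\<integral>x. G n x \<partial>\<mu>)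
       - (\<integral>x. Q_op P G (Suc n) (\<lambda>x. c * U x) x \<partial>\<mu>) / (\<integral>x. G n x \<partial>\<mu>))"
    unfolding fe by (rule has_bochner_integral_integral_eq)
  also have "\<dots> = (\<integral>x. Q_op P G (Suc n) g x - Q_op P G (Suc n) (\<lambda>x. c * U x) x \<partial>\<mu>) / (\<integral>x. G n x \<partial>\<mu>)"
    using int[OF dominated_Q_op[OF _ g]] int[OF dominated_Q_op[OF _ dU]]
    by (subst Bochner_Integration.integral_diff) (auto simp: diff_divide_distrib)
  also have "(\<lambda>x. Q_op P G (Suc n) g x - Q_op P G (Suc n) (\<lambda>x. c * U x) x) = Q_op P G (Suc n) f"
    using Q_op_diff[OF _ g dU, of "Suc n"] by (intro ext) (simp add: fe)
  finally show ?thesis .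
qed

end

lemma (in fk_model) tame_weight_lyapunov:
  assumes "Q_lyapunov P G U"
  shows "tame_weight P G U"
proof
  obtain b where b: "0 \<le> b" "\<And>n x. 1 \<le> n \<Longrightarrow> integrable (P n x) U"
    "\<And>n x. 1 \<le> n \<Longrightarrow> (\<integral>y. U y \<partial>P n x) \<le> b * U x"
    using Q_lyapunov_transition_bound[OF assms] by blast
  then show "\<exists>b\<ge>0. \<forall>x. integrable (P n x) U \<and> (\<integral>y. U y \<partial>P n x) \<le> b * U x" if "1 \<le> n" for n
    using that by blast
qed (use Q_lyapunovD[OF assms] in auto)

section \<open>Positivity, covariance and compactness\<close>

lemma (in prob_space) integral_pos:
  fixes f :: "'a \<Rightarrow> real"
  assumes int: "integrable M f" and pos: "\<And>x. 0 < f x"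
  shows "0 < (\<integral>x. f x \<partial>M)"
proof -
  have "(\<integral>x. f x \<partial>M) \<noteq> 0"
  proof
    assume "(\<integral>x. f x \<partial>M) = 0"
    then have "AE x in M. f x = 0"
      using integral_nonneg_eq_0_iff_AE[OF int] pos by (simp add: less_imp_le)
    then have "AE x in M. False"
      by eventually_elim (metis pos less_irrefl)
    then show False by simp
  qed
  then show ?thesis
    using Bochner_Integration.integral_nonneg[of M f] pos by (simp add: less_imp_le order_less_le)
qed

text \<open>Chebyshev's association inequality: for two independent copies the mean of
  \<open>(g x - g y) * (u x - u y)\<close> is twice the covariance. The copies are integrated out
  one after the other, so no product measure is formed.\<close>

lemma (in prob_space) integral_mult_le_of_antimonotone:
  fixes g u :: "'a \<Rightarrow> real"
  assumes [simp]: "integrable M g" "integrable M u" "integrable M (\<lambda>x. g x * u x)"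
    and anti: "\<And>x y. (g x - g y) * (u x - u y) \<le> 0"
  shows "(\<integral>x. g x * u x \<partial>M) \<le> (\<integral>x. g x \<partial>M) * (\<integral>x. u x \<partial>M)"
proof -
  let ?a = "\<integral>x. g x * u x \<partial>M" and ?g = "\<integral>x. g x \<partial>M" and ?u = "\<integral>x. u x \<partial>M"
  have inner: "?a - ?g * u y - g y * ?u + g y * u y \<le> 0" for y
  proof -
    have "(\<integral>x. g x * u x - g x * u y - g y * u x + g y * u y \<partial>M) \<le> (\<integral>x. 0 \<partial>M)"
      using anti[of _ y] by (intro integral_mono) (auto simp: algebra_simps)
    then show ?thesis by (simp add: prob_space)
  qed
  have "(\<integral>y. ?a - ?g * u y - g y * ?u + g y * u y \<partial>M) \<le> (\<integral>x. 0 \<partial>M)"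
    using inner by (intro integral_mono) auto
  then show ?thesis by (simp add: prob_space)
qed

lemma continuous_bounded_above_on_compact:
  fixes f :: "'a::topological_space \<Rightarrow> real"
  assumes "compact K" "continuous_on K f"
  obtains b where "0 < b" "\<And>x. x \<in> K \<Longrightarrow> f x \<le> b"
proof -
  have "bounded (f ` K)"
    using compact_continuous_image[OF assms(2,1)] compact_imp_bounded by blast
  then obtain b where b: "\<And>x. x \<in> K \<Longrightarrow> \<bar>f x\<bar> \<le> b"
    unfolding bounded_iff by auto
  have "f x \<le> \<bar>b\<bar> + 1" if "x \<in> K" for x
    using b[OF that] by linarith
  then show ?thesis by (intro that[of "\<bar>b\<bar> + 1"]) auto
qed

lemma continuous_bounded_below_on_compact:
  fixes f :: "'a::topological_space \<Rightarrow> real"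
  assumes K: "compact K" "continuous_on K f" and pos: "\<And>x. x \<in> K \<Longrightarrow> 0 < f x"
  obtains b where "0 < b" "\<And>x. x \<in> K \<Longrightarrow> b \<le> f x"
proof -
  have inv: "continuous_on K (\<lambda>x. inverse (f x))"
    using K(2) pos by (intro continuous_on_inverse) (auto simp: less_imp_neq[symmetric])
  obtain b where b: "0 < b" "\<And>x. x \<in> K \<Longrightarrow> inverse (f x) \<le> b"
    by (fact continuous_bounded_above_on_compact[OF K(1) inv])
  have "inverse b \<le> f x" if "x \<in> K" for x
    using le_imp_inverse_le[OF b(2)[OF that]] pos[OF that] by simp
  then show ?thesis using b(1) by (intro that[of "inverse b"]) auto
qed

text \<open>\<open>C_infty\<close> speaks only of levels at or above the infimum; below it the
  sublevel set is empty.\<close>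

lemma C_infty_sublevel_compact:
  assumes "V \<in> C_infty"
  shows "compact (sublevel V r)"
proof (cases "(INF x. V x) \<le> r")
  case True
  then show ?thesis using assms by (auto simp: C_infty_def)
next
  case False
  have "bdd_below (range V)" using assms by (simp add: C_infty_def)
  then have "(INF x. V x) \<le> V x" for x by (rule cINF_lower) simp
  then have "sublevel V r = {}"
    using False unfolding sublevel_def by (auto intro: order_trans)
  then show ?thesis by simp
qed

lemma C_infty_pos:
  assumes "V \<in> C_infty"
  shows "0 < V x"
proof -
  have "bdd_below (range V)" using assms by (simp add: C_infty_def)
  then have "(INF x. V x) \<le> V x" by (rule cINF_lower) simp
  then show ?thesis using assms by (auto simp: C_infty_def)
qed

section \<open>Drift of Lyapunov functions, and the semigroup\<close>

context fk_model
begin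

text \<open>Let \<open>u\<close> be \<open>U\<close> cut to zero on \<open>K\<close>. It is
  antimonotone to \<open>G\<close>, so by the association inequality weighting with \<open>G\<close>
  does not increase its mean. The cut costs at most the bound \<open>s\<close> of \<open>U\<close>
  on \<open>K\<close>, and the transition contracts by \<open>e\<close>, whence the additive
  constant \<open>e * s + c\<close>.\<close>

lemma lyapunov_drift:
  assumes U: "Q_lyapunov P G U"
  obtains e c where "0 \<le> e" "e < 1" "0 \<le> c"
    "\<And>n \<mu>. borel_prob \<mu> \<Longrightarrow> integrable \<mu> U \<Longrightarrow> (\<integral>x. U x \<partial>step n \<mu>) \<le> e * (\<integral>x. U x \<partial>\<mu>) + c"
proof -
  interpret tame_weight P G U by (rule tame_weight_lyapunov[OF U])
  obtain e c where ec: "0 \<le> e" "e < 1" "0 \<le> c"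
    and "\<And>n x. 1 \<le> n \<Longrightarrow> integrable (P n x) U"
    and PU: "\<And>n x. 1 \<le> n \<Longrightarrow> (\<integral>y. U y \<partial>P n x) \<le> e * U x + c"
    by (fact Q_lyapunov_transition[OF U])
  obtain K where K: "compact K"
    and anti: "\<And>n x y. 1 \<le> n \<Longrightarrow> (G (n - 1) x - G (n - 1) y) *
             (indicator (- K) x * U x - indicator (- K) y * U y) \<le> 0"
    using U unfolding Q_lyapunov_def by blast
  obtain s where s: "0 < s" "\<And>x. x \<in> K \<Longrightarrow> U x \<le> s"
    by (fact continuous_bounded_above_on_compact[OF K
          continuous_on_subset[OF Q_lyapunovD(4)[OF U] subset_UNIV]])
  define u where "u x = indicator (- K) x * U x" for x
  have Kb: "- K \<in> sets borel"
    using borel_closed[OF compact_imp_closed[OF K]] by auto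
  have um: "u \<in> borel_measurable borel"
    unfolding u_def using Kb by simp
  have uU: "0 \<le> u x" "u x \<le> U x" "U x \<le> u x + s" for x
    using U_nonneg(1)[of x] s by (auto simp: u_def indicator_def)
  have du: "dominated U u"
    using uU by (intro dominatedI[where c = 1] um) auto
  show ?thesis
  proof (rule that[of e "e * s + c"])
    fix n \<mu> assume \<mu>: "borel_prob \<mu>" and int: "integrable \<mu> U"
    interpret prob_space \<mu> using borel_probD[OF \<mu>] by simp
    note dom = integrable_dominated[OF borel_probD(2)[OF \<mu>] int]
    note Z = integral_G_pos[OF \<mu>, of n]
    obtain b where b: "0 < b" "\<And>x. G n x \<le> b" using G_bounded[of n] by blast
    have dG: "dominated U (\<lambda>x. G n x * f x)" if "dominated U f" for f
      using dominated_measurable[OF that] b G_pos[of n]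
      by (intro dominated_le[OF dominated_cmult[OF that, of b]])
         (auto simp: abs_mult less_imp_le intro!: mult_mono)
    note dU = dominated_self[OF U_meas U_nonneg(1)] and d1 = dominated_const[OF U_ge1]
    have "(G n x - G n y) * (u x - u y) \<le> 0" for x y
      using anti[of "Suc n" x y] by (simp add: u_def)
    then have "(\<integral>x. G n x * u x \<partial>\<mu>) \<le> (\<integral>x. G n x \<partial>\<mu>) * (\<integral>x. u x \<partial>\<mu>)"
      by (rule integral_mult_le_of_antimonotone[OF integrable_G[OF \<mu>] dom[OF du] dom[OF dG[OF du]]])
    also have "\<dots> \<le> (\<integral>x. G n x \<partial>\<mu>) * (\<integral>x. U x \<partial>\<mu>)"
      using Z dom[OF du] int uU by (intro mult_left_mono integral_mono) auto
    finally have Gu: "(\<integral>x. G n x * u x \<partial>\<mu>) \<le> (\<integral>x. G n x \<partial>\<mu>) * (\<integral>x. U x \<partial>\<mu>)" .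
    have "(\<integral>x. Q_op P G (Suc n) U x \<partial>\<mu>) \<le> (\<integral>x. e * (G n x * u x) + (e * s + c) * G n x \<partial>\<mu>)"
    proof (rule integral_mono)
      show "integrable \<mu> (Q_op P G (Suc n) U)"
        using dom[OF dominated_Q_op[OF _ dU]] by simp
      show "integrable \<mu> (\<lambda>x. e * (G n x * u x) + (e * s + c) * G n x)"
        using integrable_G[OF \<mu>] dom[OF dG[OF du]] by simp
      fix x
      have "(\<integral>y. U y \<partial>P (Suc n) x) \<le> e * (u x + s) + c"
        using PU[of "Suc n" x] mult_left_mono[OF uU(3)[of x] ec(1)] by simp
      then have "Q_op P G (Suc n) U x \<le> G n x * (e * (u x + s) + c)"
        unfolding Q_op_def using G_pos[of n x] by (simp add: mult_left_mono)
      then show "Q_op P G (Suc n) U x \<le> e * (G n x * u x) + (e * s + c) * G n x"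
        by (simp add: algebra_simps)
    qed
    also have "\<dots> = e * (\<integral>x. G n x * u x \<partial>\<mu>) + (e * s + c) * (\<integral>x. G n x \<partial>\<mu>)"
      using integrable_G[OF \<mu>] dom[OF dG[OF du]] by simp
    also have "\<dots> \<le> e * ((\<integral>x. G n x \<partial>\<mu>) * (\<integral>x. U x \<partial>\<mu>)) + (e * s + c) * (\<integral>x. G n x \<partial>\<mu>)"
      using Gu ec(1) by (simp add: mult_left_mono)
    finally show "(\<integral>x. U x \<partial>step n \<mu>) \<le> e * (\<integral>x. U x \<partial>\<mu>) + (e * s + c)"
      unfolding integral_step[OF \<mu> int dU] using Z by (simp add: pos_divide_le_eq algebra_simps)
  qed (use ec s in auto)
qed

text \<open>Writing \<Theta> as \<open>1 / Vt\<close> turns decay at infinity into division by a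
  function with compact sublevel sets, the form in which it is split into a compact set and its
  complement later.\<close>

lemma Q_op_lyapunov_le:
  assumes U: "Q_lyapunov P G U"
  shows "\<exists>Vt\<in>C_infty. \<forall>n\<ge>1. \<forall>x. Q_op P G n U x \<le> U x / Vt x"
proof -
  obtain \<Theta> where "\<Theta> \<in> C_zero" and T: "\<And>n x. 1 \<le> n \<Longrightarrow> Q_op P G n U x / U x \<le> \<Theta> x"
    using U unfolding Q_lyapunov_def by blast
  then obtain Vt where Vt: "Vt \<in> C_infty" "\<Theta> = (\<lambda>x. 1 / Vt x)"
    unfolding C_zero_def by blast
  have "Q_op P G n U x \<le> U x / Vt x" if "1 \<le> n" for n x
    using T[OF that, of x] Q_lyapunovD(2)[OF U, of x] by (simp add: Vt(2) pos_divide_le_eq)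
  then show ?thesis using Vt(1) by blast
qed

text \<open>\<open>qit m k f\<close> is \<open>Q_{k,k+m}(f)\<close>. Counting by length, with the
  earliest operator outermost, makes induction on \<open>m\<close> with arbitrary \<open>k\<close>
  follow the backward recursion.\<close>

primrec qit :: "nat \<Rightarrow> nat \<Rightarrow> ('a \<Rightarrow> real) \<Rightarrow> 'a \<Rightarrow> real" where
  "qit 0 k f = f"
| "qit (Suc m) k f = Q_op P G (Suc k) (qit m (Suc k) f)"

text \<open>The integral of \<open>f\<close> under \<open>\<phi>_{k,k+m}(\<mu>)\<close>, kept as a
  quotient of two integrals so that estimates on numerator and denominator apply without
  constructing the measure.\<close>

definition nphi :: "nat \<Rightarrow> nat \<Rightarrow> 'a measure \<Rightarrow> ('a \<Rightarrow> real) \<Rightarrow> real" where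
  "nphi m k \<mu> f = (\<integral>x. qit m k f x \<partial>\<mu>) / (\<integral>x. qit m k (\<lambda>_. 1) x \<partial>\<mu>)"

lemma nphi_0: "borel_prob \<mu> \<Longrightarrow> nphi 0 k \<mu> f = (\<integral>x. f x \<partial>\<mu>)"
  using prob_space.prob_space[OF borel_probD(1)[of \<mu>]] by (simp add: nphi_def)

end

text \<open>With values in \<open>[0, 1]\<close> rather than \<open>[-1, 1]\<close>, errors between
  probability measures never exceed 1, and nonnegative integrals can be used without splitting
  signs.\<close>

definition unit_fun :: "('a::topological_space \<Rightarrow> real) \<Rightarrow> bool" where
  "unit_fun g \<longleftrightarrow> g \<in> borel_measurable borel \<and> (\<forall>x. 0 \<le> g x \<and> g x \<le> 1)"

context tame_weight
begin

lemma dominated_U: "dominated U U"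
  by (rule dominated_self[OF U_meas U_nonneg(1)])

lemma dominated_1: "dominated U (\<lambda>_. a)"
  by (rule dominated_const[OF U_ge1])

lemma dominated_qit: "dominated U f \<Longrightarrow> dominated U (qit m k f)"
  by (induction m arbitrary: k) (auto intro: dominated_Q_op)

lemma qit_mono:
  "dominated U f \<Longrightarrow> dominated U g \<Longrightarrow> (\<And>x. f x \<le> g x) \<Longrightarrow> qit m k f x \<le> qit m k g x"
  by (induction m arbitrary: k x) (auto intro!: Q_op_mono dominated_qit)

lemma qit_cmult: "qit m k (\<lambda>x. a * f x) x = a * qit m k f x"
proof (induction m arbitrary: k x)
  case (Suc m)
  have "qit m (Suc k) (\<lambda>x. a * f x) = (\<lambda>x. a * qit m (Suc k) f x)"
    using Suc by (intro ext)
  then show ?case by (simp add: Q_op_cmult)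
qed simp

lemma qit_nonneg: "dominated U f \<Longrightarrow> (\<And>x. 0 \<le> f x) \<Longrightarrow> 0 \<le> qit m k f x"
  using qit_mono[OF dominated_1[of 0], of f m k x] qit_cmult[of m k 0 "\<lambda>_. 0" x] by simp

lemma qit_pos: "dominated U f \<Longrightarrow> (\<And>x. 0 < f x) \<Longrightarrow> 0 < qit m k f x"
proof (induction m arbitrary: k x)
  case (Suc m)
  interpret prob_space "P (Suc k) x" using borel_probD(1)[OF kernel_prob] by simp
  have "0 < (\<integral>y. qit m (Suc k) f y \<partial>P (Suc k) x)"
    using Suc by (intro integral_pos integrable_kernel dominated_qit) auto
  then show ?case using G_pos[of k x] by (simp add: Q_op_def)
qed simp

lemma integrable_qit:
  "borel_prob \<mu> \<Longrightarrow> integrable \<mu> U \<Longrightarrow> dominated U f \<Longrightarrow> integrable \<mu> (qit m k f)"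
  using integrable_dominated[OF borel_probD(2) _ dominated_qit] by blast

lemma integral_qit_pos:
  assumes "borel_prob \<mu>" "integrable \<mu> U" "dominated U f" "\<And>x. 0 < f x"
  shows "0 < (\<integral>x. qit m k f x \<partial>\<mu>)"
  using prob_space.integral_pos[OF borel_probD(1)[OF assms(1)] integrable_qit[OF assms(1-3)]]
    qit_pos[OF assms(3,4)] by blast

lemma integral_qit_Suc:
  assumes "borel_prob \<mu>" "integrable \<mu> U" "dominated U f"
  shows "(\<integral>x. qit (Suc m) k f x \<partial>\<mu>) = (\<integral>x. G k x \<partial>\<mu>) * (\<integral>x. qit m (Suc k) f x \<partial>step k \<mu>)"
  using integral_step[OF assms(1,2) dominated_qit[OF assms(3)], of k m "Suc k"]
    integral_G_pos[OF assms(1), of k] by simp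

text \<open>Both integrals pick up the same factor, the mean of \<open>G k\<close> under \<mu>, and
  it cancels. This is the semigroup property of \<phi>.\<close>

lemma nphi_Suc:
  assumes "borel_prob \<mu>" "integrable \<mu> U" "dominated U f"
  shows "nphi (Suc m) k \<mu> f = nphi m (Suc k) (step k \<mu>) f"
  unfolding nphi_def integral_qit_Suc[OF assms] integral_qit_Suc[OF assms(1,2) dominated_1]
  using integral_G_pos[OF assms(1), of k] by simp

lemma integrable_FK_flow:
  "borel_prob \<mu> \<Longrightarrow> integrable \<mu> U \<Longrightarrow> integrable (FK_flow P G \<mu> n) U"
  by (induction n) (simp_all only: FK_flow_Suc FK_flow.simps(1) integrable_step FK_flow_prob)

lemma nphi_FK_flow:
  assumes "borel_prob \<mu>" "integrable \<mu> U" "dominated U f"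
  shows "nphi m k (FK_flow P G \<mu> k) f = (\<integral>x. f x \<partial>FK_flow P G \<mu> (k + m))"
proof (induction m arbitrary: k)
  case 0
  show ?case using nphi_0[OF FK_flow_prob[OF assms(1)]] by simp
next
  case (Suc m)
  show ?case
    using nphi_Suc[OF FK_flow_prob integrable_FK_flow, OF assms(1) assms(1,2,3), of m k k]
      Suc[of "Suc k"] by (simp only: FK_flow_Suc[symmetric] add_Suc add_Suc_right)
qed

lemma nphi_mono:
  assumes "borel_prob \<mu>" "integrable \<mu> U" "dominated U f" "dominated U g" "\<And>x. f x \<le> g x"
  shows "nphi m k \<mu> f \<le> nphi m k \<mu> g"
  unfolding nphi_def using integral_qit_pos[OF assms(1,2) dominated_1, of 1 m k]
    qit_mono[OF assms(3,4,5)] integrable_qit[OF assms(1,2)] assms(3,4)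
  by (intro divide_right_mono integral_mono) auto

lemma nphi_const:
  assumes "borel_prob \<mu>" "integrable \<mu> U"
  shows "nphi m k \<mu> (\<lambda>_. a) = a"
proof -
  have "qit m k (\<lambda>_. a) = (\<lambda>x. a * qit m k (\<lambda>_. 1) x)"
    using qit_cmult[of m k a "\<lambda>_. 1"] by (intro ext) simp
  then show ?thesis
    unfolding nphi_def using integral_qit_pos[OF assms dominated_1, of 1 m k] by simp
qed

lemma dominated_unit: "unit_fun g \<Longrightarrow> dominated U g"
  by (intro dominated_le[OF dominated_1[of 1]]) (auto simp: unit_fun_def)

lemma nphi_bounds:
  assumes \<mu>: "borel_prob \<mu>" "integrable \<mu> U" and g: "unit_fun g"
  shows "0 \<le> nphi m k \<mu> g" "nphi m k \<mu> g \<le> 1"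
  using nphi_mono[OF \<mu> dominated_1[of 0] dominated_unit[OF g], of m k]
    nphi_mono[OF \<mu> dominated_unit[OF g] dominated_1[of 1], of m k] g
  by (simp_all add: nphi_const[OF \<mu>] unit_fun_def)

end

text \<open>Turns the extended-real infimum into a real constant. The infimum is finite because a
  sublevel set of positive measure contains a point, and the value of \<open>pd\<close> there bounds
  it.\<close>

lemma local_densities_minorization:
  assumes dens: "local_densities P V pd \<nu>"
  obtains r1 where "0 < r1" "\<And>r. r1 \<le> r \<Longrightarrow> sublevel V r \<noteq> {} \<and>
    0 < emeasure \<nu> (sublevel V r) \<and> emeasure \<nu> (sublevel V r) < \<infinity> \<and>
    (\<exists>d>0. \<forall>n\<ge>1. \<forall>x\<in>sublevel V r. \<forall>y\<in>sublevel V r. d \<le> pd n x y)"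
proof -
  from dens obtain r1 where r1: "0 < r1" and R: "\<And>r. r1 \<le> r \<Longrightarrow>
        0 < (INF n\<in>{1..}. INF x\<in>sublevel V r. INF y\<in>sublevel V r. ennreal (pd n x y)) \<and>
        0 < emeasure \<nu> (sublevel V r) \<and> emeasure \<nu> (sublevel V r) < \<infinity>"
    unfolding local_densities_def by blast
  have pos: "0 \<le> pd n x y" if "1 \<le> n" for n x y
    using dens that unfolding local_densities_def by blast
  show ?thesis
  proof (rule that[OF r1])
    fix r assume r: "r1 \<le> r"
    let ?S = "sublevel V r"
    define I where "I = (INF n\<in>{1..}. INF x\<in>?S. INF y\<in>?S. ennreal (pd n x y))"
    have I0: "0 < I" using R[OF r] by (simp add: I_def)
    have le: "I \<le> ennreal (pd n x y)" if "1 \<le> n" "x \<in> ?S" "y \<in> ?S" for n x y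
      unfolding I_def using that
      by (intro INF_lower2[of n] INF_lower2[of x] INF_lower2[of y]) auto
    have ne: "?S \<noteq> {}" using R[OF r] by auto
    then obtain z where z: "z \<in> ?S" by blast
    have top: "I < \<top>" using le[of 1 z z] z by (auto intro: order_le_less_trans)
    have "\<exists>d>0. \<forall>n\<ge>1. \<forall>x\<in>?S. \<forall>y\<in>?S. d \<le> pd n x y"
    proof (intro exI conjI allI impI ballI)
      show "0 < enn2real I" using I0 top by (simp add: enn2real_positive_iff)
      fix n :: nat and x y assume n: "1 \<le> n" and xy: "x \<in> ?S" "y \<in> ?S"
      have "enn2real I \<le> enn2real (ennreal (pd n x y))"
        using le[OF n xy] by (intro enn2real_mono) auto
      then show "enn2real I \<le> pd n x y" using pos[OF n] by simp
    qed
    with ne R[OF r] show "?S \<noteq> {} \<and> 0 < emeasure \<nu> ?S \<and> emeasure \<nu> ?S < \<infinity> \<and>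
      (\<exists>d>0. \<forall>n\<ge>1. \<forall>x\<in>?S. \<forall>y\<in>?S. d \<le> pd n x y)" by blast
  qed
qed

section \<open>Stability of the normalised semigroup\<close>

text \<open>Positivity and linearity in one condition, restricted to the span of three functions:
  the integrals and kernels in question are linear only on integrable functions.\<close>

definition positive_on3 :: "(('a \<Rightarrow> real) \<Rightarrow> real) \<Rightarrow> ('a \<Rightarrow> real) \<Rightarrow> ('a \<Rightarrow> real) \<Rightarrow> ('a \<Rightarrow> real) \<Rightarrow> bool" where
  "positive_on3 L f g h \<longleftrightarrow> (\<forall>a b c. (\<forall>u. 0 \<le> a * f u + b * g u + c * h u) \<longrightarrow>
     0 \<le> a * L f + b * L g + c * L h)"

lemma positive_on3D:
  assumes "positive_on3 L f g h" "\<And>u. 0 \<le> a * f u + b * g u + c * h u"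
  shows "0 \<le> a * L f + b * L g + c * L h"
  using assms unfolding positive_on3_def by blast

text \<open>
  A bound on the oscillation of \<open>F / D\<close>, with denominators cleared, is inherited by the values
  of positive functionals.
\<close>

lemma oscillation_transfer:
  fixes F D V :: "'a \<Rightarrow> real" and L M :: "('a \<Rightarrow> real) \<Rightarrow> real"
  assumes L: "positive_on3 L D V F" and M: "positive_on3 M D V F"
    and osc: "\<And>u v. F u * D v - F v * D u \<le> t * (2 * (D u * D v) + b * (V u * D v + V v * D u))"
  shows "L F * M D - M F * L D \<le> t * (2 * (L D * M D) + b * (L V * M D + M V * L D))"
proof -
  \<comment> \<open>For fixed \<open>v\<close> the hypothesis says that a linear combination of
    \<open>D\<close>, \<open>V\<close> and \<open>F\<close> is nonnegative in \<open>u\<close>.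
    After \<open>L\<close> has acted, the result is such a combination in \<open>v\<close>, on which
    \<open>M\<close> acts.\<close>
  have 1: "0 \<le> (2 * t * D v + t * b * V v + F v) * L D + (t * b * D v) * L V + (- D v) * L F" for v
  proof (rule positive_on3D[OF L])
    fix u
    have eq: "(2 * t * D v + t * b * V v + F v) * D u + (t * b * D v) * V u + (- D v) * F u =
      t * (2 * (D u * D v) + b * (V u * D v + V v * D u)) - (F u * D v - F v * D u)"
      by (simp add: algebra_simps)
    show "0 \<le> (2 * t * D v + t * b * V v + F v) * D u + (t * b * D v) * V u + (- D v) * F u"
      unfolding eq using osc[of u v] by (simp only: diff_ge_0_iff_ge)
  qed
  have "0 \<le> (2 * t * L D + t * b * L V - L F) * M D + (t * b * L D) * M V + L D * M F"
  proof (rule positive_on3D[OF M])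
    fix v
    have eq: "(2 * t * L D + t * b * L V - L F) * D v + (t * b * L D) * V v + L D * F v =
      (2 * t * D v + t * b * V v + F v) * L D + (t * b * D v) * L V + (- D v) * L F"
      by (simp add: algebra_simps)
    show "0 \<le> (2 * t * L D + t * b * L V - L F) * D v + (t * b * L D) * V v + L D * F v"
      unfolding eq by (rule 1)
  qed
  then show ?thesis by (simp add: algebra_simps)
qed

lemma (in tame_weight) dominated_comb3:
  assumes "dominated U f" "dominated U g" "dominated U h"
  shows "dominated U (\<lambda>u. a * f u + b * g u + c * h u)"
  by (intro dominated_add dominated_cmult assms)

lemma (in tame_weight) Q_op_comb3:
  assumes "1 \<le> n" "dominated U f" "dominated U g" "dominated U h"
  shows "Q_op P G n (\<lambda>u. a * f u + b * g u + c * h u) x =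
    a * Q_op P G n f x + b * Q_op P G n g x + c * Q_op P G n h x"
  using assms by (simp add: Q_op_add Q_op_cmult dominated_add dominated_cmult)

lemma (in tame_weight) positive_on3_integral:
  assumes \<mu>: "borel_prob \<mu>" "integrable \<mu> U"
    and d: "dominated U f" "dominated U g" "dominated U h"
  shows "positive_on3 (\<lambda>f. \<integral>x. f x \<partial>\<mu>) f g h"
  unfolding positive_on3_def
proof (intro allI impI)
  fix a b c assume pos: "\<forall>u. 0 \<le> a * f u + b * g u + c * h u"
  note i = d[THEN integrable_dominated[OF borel_probD(2)[OF \<mu>(1)] \<mu>(2)]]
  have "0 \<le> (\<integral>u. a * f u + b * g u + c * h u \<partial>\<mu>)"
    using pos by (intro Bochner_Integration.integral_nonneg) auto
  then show "0 \<le> a * (\<integral>x. f x \<partial>\<mu>) + b * (\<integral>x. g x \<partial>\<mu>) + c * (\<integral>x. h x \<partial>\<mu>)"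
    using i by simp
qed

section \<open>Two-sided bounds on the normalised masses\<close>

locale fk_stable = fk_model P G
  for P :: "nat \<Rightarrow> 'a::polish_space \<Rightarrow> 'a measure" and G :: "nat \<Rightarrow> 'a \<Rightarrow> real" +
  fixes V W :: "'a \<Rightarrow> real" and \<kappa> :: real and pd :: "nat \<Rightarrow> 'a \<Rightarrow> 'a \<Rightarrow> real" and \<nu> :: "'a measure"
  assumes lyap: "Q_lyapunov P G V"
    and W: "W \<in> C_wt V" and W_pos: "\<And>x. 0 < W x"
    and kappa: "0 < \<kappa>"
    and QW: "\<And>n x. 1 \<le> n \<Longrightarrow> \<kappa> * W x \<le> Q_op P G n W x"
    and Q1: "\<exists>C. \<forall>m k x. qit m k (\<lambda>_. 1) x \<le> C * \<kappa> ^ m * V x"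
    and dens: "local_densities P V pd \<nu>"
begin

sublocale tame_weight P G V
  by (rule tame_weight_lyapunov[OF lyap])

text \<open>A finite-horizon substitute for the eigenfunction of a Doob transform:
  \<open>Q_{k+1}\<close> maps \<open>H m (k+1)\<close> to \<kappa> times \<open>H (m+1) k\<close>,
  as \<open>Q\<close> maps \<open>h\<close> to \<open>E0 * h\<close>.\<close>

definition H :: "nat \<Rightarrow> nat \<Rightarrow> 'a \<Rightarrow> real" where
  "H m k x = qit m k (\<lambda>_. 1) x / \<kappa> ^ m"

lemma W_cont: "continuous_on UNIV W"
  using W by (simp add: C_wt_def)

lemma W_le: "\<exists>w>0. \<forall>x. W x \<le> w * V x"
proof -
  obtain w where w: "\<And>x. \<bar>W x\<bar> / V x \<le> w"
    using W unfolding C_wt_def bdd_above_def by auto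
  have "W x \<le> w * V x" for x
    using w[of x] W_pos[of x] U_nonneg(2)[of x] by (simp add: divide_le_eq)
  moreover have "0 < w"
    using w[of undefined] W_pos[of undefined] U_nonneg(2)[of undefined]
    by (smt (verit) divide_pos_pos)
  ultimately show ?thesis by blast
qed

lemma dominated_W: "dominated V W"
proof -
  obtain w where "\<forall>x. W x \<le> w * V x" using W_le by blast
  then show ?thesis using W_cont W_pos
    by (intro dominatedI[where c = w]) (auto intro: borel_measurable_continuous_onI simp: less_imp_le)
qed

lemma qit_W: "\<kappa> ^ m * W x \<le> qit m k W x"
proof (induction m arbitrary: k x)
  case (Suc m)
  have "\<kappa> ^ Suc m * W x \<le> \<kappa> ^ m * Q_op P G (Suc k) W x"
    using mult_left_mono[OF QW[of "Suc k" x], of "\<kappa> ^ m"] kappa by (simp add: mult_ac)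
  also have "\<dots> = Q_op P G (Suc k) (\<lambda>y. \<kappa> ^ m * W y) x" by (simp add: Q_op_cmult)
  also have "\<dots> \<le> Q_op P G (Suc k) (qit m (Suc k) W) x"
    using Suc by (intro Q_op_mono dominated_cmult dominated_qit dominated_W) auto
  finally show ?case by simp
qed simp

lemma dominated_H: "dominated V (H m k)"
  unfolding H_def divide_inverse
  using dominated_cmult[OF dominated_qit[OF dominated_1[of 1], of m k], of "inverse (\<kappa> ^ m)"]
  by (simp add: mult.commute)

lemma H_pos: "0 < H m k x"
  unfolding H_def using qit_pos[OF dominated_1, of 1 m k x] kappa by simp

lemma H_0: "H 0 k x = 1"
  by (simp add: H_def)

lemma H_Suc: "H (Suc m) k x = Q_op P G (Suc k) (H m (Suc k)) x / \<kappa>"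
proof -
  have "Q_op P G (Suc k) (H m (Suc k)) x = inverse (\<kappa> ^ m) * qit (Suc m) k (\<lambda>_. 1) x"
    unfolding H_def divide_inverse
    by (subst mult.commute) (simp add: Q_op_cmult)
  then show ?thesis by (simp add: H_def field_simps)
qed

lemma H_le: "\<exists>C>0. \<forall>m k x. H m k x \<le> C * V x"
proof -
  obtain C where C: "\<And>m k x. qit m k (\<lambda>_. 1) x \<le> C * \<kappa> ^ m * V x" using Q1 by blast
  have "H m k x \<le> C * V x" for m k x
    using C[of m k x] kappa by (simp add: H_def divide_le_eq mult_ac)
  moreover have "0 < C"
  proof (rule zero_less_mult_pos2)
    show "0 < C * V undefined" using C[of 0 undefined undefined] by simp
  qed (rule U_nonneg(2))
  ultimately show ?thesis by blast
qed

text \<open>Every level \<open>s \<ge> b\<close> is preserved by the drift, since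
  \<open>e * s + c \<le> s\<close> there. The level \<open>b\<close> times \<mu>(V) is at least
  \<open>b\<close> and at least \<mu>(V), because \<open>1 \<le> b\<close> and
  \<open>1 \<le> V\<close>; so one multiple of the initial moment serves for all times.\<close>

lemma nphi_V: "\<exists>b\<ge>1. \<forall>\<mu> m k. borel_prob \<mu> \<longrightarrow> integrable \<mu> V \<longrightarrow>
    nphi m k \<mu> V \<le> b * (\<integral>x. V x \<partial>\<mu>)"
proof -
  obtain e c where ec: "0 \<le> e" "e < 1" "0 \<le> c"
    and drift: "\<And>n \<mu>. borel_prob \<mu> \<Longrightarrow> integrable \<mu> V \<Longrightarrow>
        (\<integral>x. V x \<partial>step n \<mu>) \<le> e * (\<integral>x. V x \<partial>\<mu>) + c"
    by (fact lyapunov_drift[OF lyap])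
  define b where "b = 1 + c / (1 - e)"
  have b1: "1 \<le> b" using ec by (simp add: b_def)
  have keep: "e * s + c \<le> s" if "b \<le> s" for s
  proof -
    have "c \<le> (b - 1) * (1 - e)" using ec by (simp add: b_def)
    also have "\<dots> \<le> s * (1 - e)" using that ec by (intro mult_right_mono) auto
    finally show ?thesis by (simp add: algebra_simps)
  qed
  have *: "nphi m k \<mu> V \<le> s"
    if "borel_prob \<mu>" "integrable \<mu> V" "b \<le> s" "(\<integral>x. V x \<partial>\<mu>) \<le> s" for m k \<mu> s
    using that
  proof (induction m arbitrary: k \<mu>)
    case 0
    then show ?case by (simp add: nphi_0)
  next
    case (Suc m)
    have "(\<integral>x. V x \<partial>step k \<mu>) \<le> e * s + c"
      using drift[OF Suc.prems(1,2), of k] mult_left_mono[OF Suc.prems(4) ec(1)] by simp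
    then have "(\<integral>x. V x \<partial>step k \<mu>) \<le> s" using keep[OF Suc.prems(3)] by simp
    then show ?case
      unfolding nphi_Suc[OF Suc.prems(1,2) dominated_U]
      using Suc.prems by (intro Suc.IH step_prob integrable_step)
  qed
  show ?thesis
  proof (intro exI conjI allI impI)
    fix \<mu> m k assume \<mu>: "borel_prob \<mu>" "integrable \<mu> V"
    interpret prob_space \<mu> using borel_probD[OF \<mu>(1)] by simp
    have "1 \<le> (\<integral>x. V x \<partial>\<mu>)"
      using integral_mono[of \<mu> "\<lambda>_. 1" V] \<mu>(2) U_ge1 by (simp add: prob_space)
    then show "nphi m k \<mu> V \<le> b * (\<integral>x. V x \<partial>\<mu>)"
      using b1 by (intro *[OF \<mu>]) (auto simp: mult_le_cancel_left1 mult_le_cancel_right1)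
  qed (fact b1)
qed

text \<open>\<open>\<kappa>^m \<mu>(W) \<le> \<mu>(Q^m W) \<le> w \<mu>(Q^m V)\<close>, and
  \<open>\<mu>(Q^m V)\<close> is the normalised moment of \<open>V\<close>, at most
  \<open>b \<mu>(V)\<close>, times \<open>\<mu>(Q^m 1)\<close>. The powers of \<kappa> cancel
  against those in \<open>H\<close>.\<close>

lemma integral_H_lower: "\<exists>c>0. \<forall>\<mu> m k. borel_prob \<mu> \<longrightarrow> integrable \<mu> V \<longrightarrow>
    (\<integral>x. W x \<partial>\<mu>) \<le> c * (\<integral>x. V x \<partial>\<mu>) * (\<integral>x. H m k x \<partial>\<mu>)"
proof -
  obtain b where b: "1 \<le> b" and nV: "\<And>\<mu> m k. borel_prob \<mu> \<Longrightarrow> integrable \<mu> V \<Longrightarrow>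
    nphi m k \<mu> V \<le> b * (\<integral>x. V x \<partial>\<mu>)" using nphi_V by blast
  obtain w where w: "0 < w" "\<And>x. W x \<le> w * V x" using W_le by blast
  have "(\<integral>x. W x \<partial>\<mu>) \<le> (w * b) * (\<integral>x. V x \<partial>\<mu>) * (\<integral>x. H m k x \<partial>\<mu>)"
    if \<mu>: "borel_prob \<mu>" "integrable \<mu> V" for \<mu> m k
  proof -
    note dom = integrable_dominated[OF borel_probD(2)[OF \<mu>(1)] \<mu>(2)]
    note kp = zero_less_power[OF kappa, of m]
    have "\<kappa> ^ m * (\<integral>x. W x \<partial>\<mu>) = (\<integral>x. \<kappa> ^ m * W x \<partial>\<mu>)" by simp
    also have "\<dots> \<le> (\<integral>x. qit m k W x \<partial>\<mu>)"
      using qit_W by (intro integral_mono dom dominated_cmult dominated_qit dominated_W)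
    also have "\<dots> \<le> (\<integral>x. w * qit m k V x \<partial>\<mu>)"
      using qit_mono[OF dominated_W dominated_cmult[OF dominated_U] w(2), of m k]
      unfolding qit_cmult
      by (intro integral_mono dom dominated_cmult dominated_qit dominated_W dominated_U)
    also have "\<dots> = w * (\<integral>x. qit m k V x \<partial>\<mu>)" by simp
    also have "\<dots> \<le> w * (b * (\<integral>x. V x \<partial>\<mu>) * (\<integral>x. qit m k (\<lambda>_. 1) x \<partial>\<mu>))"
      using nV[OF \<mu>, of m k] integral_qit_pos[OF \<mu> dominated_1, of 1 m k] w(1)
      unfolding nphi_def by (intro mult_left_mono) (auto simp: divide_le_eq)
    also have "(\<integral>x. qit m k (\<lambda>_. 1) x \<partial>\<mu>) = \<kappa> ^ m * (\<integral>x. H m k x \<partial>\<mu>)"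
      unfolding H_def using kappa by simp
    finally have "\<kappa> ^ m * (\<integral>x. W x \<partial>\<mu>) \<le> \<kappa> ^ m * ((w * b) * (\<integral>x. V x \<partial>\<mu>) * (\<integral>x. H m k x \<partial>\<mu>))"
      by (simp add: mult_ac)
    then show ?thesis using kp by (simp only: mult_le_cancel_left_pos)
  qed
  then show ?thesis using w(1) b by (intro exI[of _ "w * b"]) auto
qed

text \<open>The integrated bound, taken at Dirac masses.\<close>

lemma H_lower: "\<exists>c>0. \<forall>m k x. W x \<le> c * V x * H m k x"
proof -
  obtain c where c: "0 < c" "\<And>\<mu> m k. borel_prob \<mu> \<Longrightarrow> integrable \<mu> V \<Longrightarrow>
    (\<integral>x. W x \<partial>\<mu>) \<le> c * (\<integral>x. V x \<partial>\<mu>) * (\<integral>x. H m k x \<partial>\<mu>)"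
    using integral_H_lower by blast
  have "W x \<le> c * V x * H m k x" for m k x
  proof -
    have p: "borel_prob (return borel x)"
      by (simp add: space_prob_algebra prob_space_return)
    interpret prob_space "return borel x" by (simp add: prob_space_return)
    have "integrable (return borel x) V"
      by (rule integrable_const_bound[where B = "V x"]) (simp_all add: AE_return U_nonneg)
    from c(2)[OF p this, of m k] show ?thesis
      using dominated_measurable[OF dominated_W] dominated_measurable[OF dominated_H, of m k]
      by (simp add: integral_return)
  qed
  then show ?thesis using c(1) by blast
qed

text \<open>\<open>\<kappa> W \<le> G P(W) \<le> w G P(V)\<close> and \<open>P(V) \<le> b V\<close>.
  Hence the potentials are bounded below on compact sets uniformly in time. The \<open>b + 1\<close>
  keeps the constant positive if \<open>b = 0\<close>.\<close>

lemma G_lower: "\<exists>c>0. \<forall>n x. W x \<le> c * (G n x * V x)"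
proof -
  obtain b where b: "0 \<le> b" "\<And>n x. 1 \<le> n \<Longrightarrow> integrable (P n x) V"
    "\<And>n x. 1 \<le> n \<Longrightarrow> (\<integral>y. V y \<partial>P n x) \<le> b * V x"
    by (fact Q_lyapunov_transition_bound[OF lyap])
  obtain w where w: "0 < w" "\<And>x. W x \<le> w * V x" using W_le by blast
  have "W x \<le> (w * (b + 1) / \<kappa>) * (G n x * V x)" for n x
  proof -
    have "(\<integral>y. W y \<partial>P (Suc n) x) \<le> (\<integral>y. w * V y \<partial>P (Suc n) x)"
      using w(2) by (intro integral_mono integrable_kernel dominated_W dominated_cmult dominated_U) auto
    also have "\<dots> \<le> w * (b * V x)" using b(3)[of "Suc n" x] w(1) by simp
    also have "\<dots> \<le> w * ((b + 1) * V x)"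
      using w(1) U_nonneg(1)[of x] by (simp add: distrib_right)
    finally have "Q_op P G (Suc n) W x \<le> G n x * (w * ((b + 1) * V x))"
      unfolding Q_op_def using G_pos[of n x] by (simp add: mult_left_mono)
    then have "\<kappa> * W x \<le> G n x * (w * ((b + 1) * V x))" using QW[of "Suc n" x] by simp
    then show ?thesis using kappa by (simp add: field_simps)
  qed
  moreover have "0 < w * (b + 1) / \<kappa>" using w b kappa by simp
  ultimately show ?thesis by blast
qed

lemma V_continuous: "continuous_on UNIV V"
  using Q_lyapunovD(4)[OF lyap] .

text \<open>Divided by \<open>H (Suc m) k\<close>, this is a drift condition for the weight
  \<open>V / H\<close> under the transformed kernels. Where \<open>Vt\<close> exceeds
  \<open>2 / \<kappa>\<close>, the factor \<open>1 / Vt\<close> alone halves \<open>V\<close>. The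
  remaining set is compact, and there \<open>W / (c V)\<close> bounds \<open>H\<close> from below,
  continuously in \<open>x\<close> and independently of \<open>m\<close> and
  \<open>k\<close>.\<close>

lemma drift_H: "\<exists>K>0. \<forall>m k x. Q_op P G (Suc k) V x / \<kappa> \<le> V x / 2 + K * H (Suc m) k x"
proof -
  obtain Vt where Vt: "Vt \<in> C_infty" and QV: "\<And>n x. 1 \<le> n \<Longrightarrow> Q_op P G n V x \<le> V x / Vt x"
    using Q_op_lyapunov_le[OF lyap] by blast
  obtain c where c: "0 < c" "\<And>m k x. W x \<le> c * V x * H m k x" using H_lower by blast
  note Vtp = C_infty_pos[OF Vt]
  have cont: "continuous_on UNIV Vt" using Vt by (simp add: C_infty_def)
  define S where "S = sublevel Vt (2 / \<kappa>)"
  have S: "compact S" unfolding S_def by (rule C_infty_sublevel_compact[OF Vt])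
  have "continuous_on UNIV (\<lambda>x. V x / (Vt x * \<kappa>) * (c * V x) / W x)"
    using kappa Vtp W_pos
    by (intro continuous_intros V_continuous W_cont cont) (auto simp: less_imp_neq[symmetric])
  then have cS: "continuous_on S (\<lambda>x. V x / (Vt x * \<kappa>) * (c * V x) / W x)"
    by (rule continuous_on_subset) simp
  obtain s where s: "0 < s" "\<And>x. x \<in> S \<Longrightarrow> V x / (Vt x * \<kappa>) * (c * V x) / W x \<le> s"
    by (fact continuous_bounded_above_on_compact[OF S cS])
  have "Q_op P G (Suc k) V x / \<kappa> \<le> V x / 2 + s * H (Suc m) k x" for m k x
  proof (cases "x \<in> S")
    case True
    have "V x / (Vt x * \<kappa>) * (c * V x) \<le> s * W x"
      using s(2)[OF True] unfolding pos_divide_le_eq[OF W_pos] .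
    also have "\<dots> \<le> s * (c * V x * H (Suc m) k x)" using c(2) s(1) by (intro mult_left_mono) auto
    finally have "V x / (Vt x * \<kappa>) * (c * V x) \<le> (s * H (Suc m) k x) * (c * V x)"
      by (simp add: mult_ac)
    then have "V x / (Vt x * \<kappa>) \<le> s * H (Suc m) k x"
      by (rule mult_right_le_imp_le) (simp add: c(1) U_nonneg(2))
    moreover have "Q_op P G (Suc k) V x / \<kappa> \<le> V x / (Vt x * \<kappa>)"
      using divide_right_mono[OF QV[of "Suc k" x], of \<kappa>] kappa by simp
    ultimately show ?thesis using U_nonneg(1)[of x] by simp
  next
    case False
    then have "2 / \<kappa> \<le> Vt x" by (simp add: S_def sublevel_def)
    then have "2 \<le> Vt x * \<kappa>" using kappa by (simp add: divide_le_eq)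
    then have "V x / (Vt x * \<kappa>) \<le> V x / 2"
      using U_nonneg(1)[of x] by (intro divide_left_mono) auto
    moreover have "Q_op P G (Suc k) V x / \<kappa> \<le> V x / (Vt x * \<kappa>)"
      using divide_right_mono[OF QV[of "Suc k" x], of \<kappa>] kappa by simp
    moreover have "0 \<le> s * H (Suc m) k x" using s(1) H_pos[of "Suc m" k x] by simp
    ultimately show ?thesis by linarith
  qed
  then show ?thesis using s(1) by blast
qed

text \<open>The weight \<open>V / H\<close> grows at infinity because \<open>H\<close> is dominated by \<open>\<Theta> V\<close>.\<close>

lemma sublevel_V_div_H: "\<exists>r. \<forall>m k x. V x \<le> R * H (Suc m) k x \<longrightarrow> V x \<le> r"
proof -
  obtain Vt where Vt: "Vt \<in> C_infty" and QV: "\<And>n x. 1 \<le> n \<Longrightarrow> Q_op P G n V x \<le> V x / Vt x"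
    using Q_op_lyapunov_le[OF lyap] by blast
  note Vtp = C_infty_pos[OF Vt]
  obtain C where C: "0 < C" "\<And>m k x. H m k x \<le> C * V x" using H_le by blast
  \<comment> \<open>From \<open>H \<le> C V\<close> comes \<open>H (Suc m) k \<le> C Q(V) / \<kappa>
    \<le> C V / (\<kappa> Vt)\<close>, the factor \<open>1 / Vt\<close> being supplied by the one
    application of \<open>Q\<close> that \<open>Suc m\<close> guarantees. So
    \<open>V \<le> R H\<close> confines \<open>x\<close> to this compact set, whatever
    \<open>m\<close> and \<open>k\<close> are.\<close>
  define S where "S = sublevel Vt (\<bar>R\<bar> * (C / \<kappa>))"
  have S: "compact S" unfolding S_def by (rule C_infty_sublevel_compact[OF Vt])
  obtain r where r: "0 < r" "\<And>x. x \<in> S \<Longrightarrow> V x \<le> r"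
    by (fact continuous_bounded_above_on_compact[OF S continuous_on_subset[OF V_continuous subset_UNIV]])
  have "V x \<le> r" if le: "V x \<le> R * H (Suc m) k x" for m k x
  proof -
    have "H (Suc m) k x \<le> Q_op P G (Suc k) (\<lambda>y. C * V y) x / \<kappa>"
      unfolding H_Suc using C(2) kappa
      by (intro divide_right_mono Q_op_mono dominated_H dominated_cmult dominated_U) auto
    also have "\<dots> \<le> C * (V x / Vt x) / \<kappa>"
      using divide_right_mono[OF mult_left_mono[OF QV[of "Suc k" x], of C], of \<kappa>] C(1) kappa
      by (simp add: Q_op_cmult)
    finally have "\<bar>R\<bar> * H (Suc m) k x \<le> \<bar>R\<bar> * (C * (V x / Vt x) / \<kappa>)"
      by (intro mult_left_mono) auto
    moreover have "R * H (Suc m) k x \<le> \<bar>R\<bar> * H (Suc m) k x"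
      using H_pos[of "Suc m" k x] by (intro mult_right_mono) auto
    ultimately have "V x \<le> V x * (\<bar>R\<bar> * (C / \<kappa>) / Vt x)"
      using le by (simp add: field_simps)
    then have "1 \<le> \<bar>R\<bar> * (C / \<kappa>) / Vt x"
      using U_nonneg(2)[of x] by (simp only: mult_le_cancel_left1 if_True simp_thms)
    then have "x \<in> S"
      unfolding S_def sublevel_def using Vtp[of x] kappa by (simp add: field_simps)
    then show ?thesis by (rule r(2))
  qed
  then show ?thesis by blast
qed

text \<open>On a sublevel set the density is at least \<open>d\<close> and, by
  \<open>G_lower\<close>, the potential at least \<open>w / (c * r)\<close>; \<beta> is the product
  of the two. The level may exceed any given \<open>r0\<close>, since the contraction argument
  prescribes how large the set must be.\<close>

lemma minorization:
  obtains r \<beta> where "r0 \<le> r" "0 < \<beta>" "sublevel V r \<in> sets borel"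
    "0 < emeasure \<nu> (sublevel V r)" "emeasure \<nu> (sublevel V r) < \<infinity>"
    "\<And>F. dominated V F \<Longrightarrow> integrable \<nu> (\<lambda>y. indicator (sublevel V r) y * F y)"
    "\<And>n x F. 1 \<le> n \<Longrightarrow> x \<in> sublevel V r \<Longrightarrow> dominated V F \<Longrightarrow> (\<And>y. 0 \<le> F y) \<Longrightarrow>
      \<beta> * (\<integral>y. indicator (sublevel V r) y * F y \<partial>\<nu>) \<le> Q_op P G n F x"
proof -
  obtain r1 where r1: "0 < r1" and R: "\<And>r. r1 \<le> r \<Longrightarrow> sublevel V r \<noteq> {} \<and>
    0 < emeasure \<nu> (sublevel V r) \<and> emeasure \<nu> (sublevel V r) < \<infinity> \<and>
    (\<exists>d>0. \<forall>n\<ge>1. \<forall>x\<in>sublevel V r. \<forall>y\<in>sublevel V r. d \<le> pd n x y)"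
    by (fact local_densities_minorization[OF dens])
  define r where "r = max r0 r1"
  let ?S = "sublevel V r"
  have nu: "0 < emeasure \<nu> ?S" "emeasure \<nu> ?S < \<infinity>"
    using R[of r] by (auto simp: r_def)
  obtain d where d: "0 < d" "\<And>n x y. 1 \<le> n \<Longrightarrow> x \<in> ?S \<Longrightarrow> y \<in> ?S \<Longrightarrow> d \<le> pd n x y"
    using R[of r] unfolding r_def by auto
  have sets: "sets \<nu> = sets borel" using dens by (simp add: local_densities_def radon_measure_def)
  note nm = borel_measurable_sets_eq[OF sets]
  have Sc: "compact ?S"
    by (rule C_infty_sublevel_compact[OF Q_lyapunovD(1)[OF lyap]])
  have Sb: "?S \<in> sets borel" using borel_closed[OF compact_imp_closed[OF Sc]] .
  obtain w where w: "0 < w" "\<And>x. x \<in> ?S \<Longrightarrow> w \<le> W x"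
    by (fact continuous_bounded_below_on_compact[OF Sc continuous_on_subset[OF W_cont subset_UNIV] W_pos])
  obtain c where c: "0 < c" "\<And>n x. W x \<le> c * (G n x * V x)" using G_lower by blast
  have rp: "0 < r" using r1 by (simp add: r_def)
  define g where "g = w / (c * r)"
  have g0: "0 < g" using w c rp by (simp add: g_def)
  have g: "g \<le> G n x" if "x \<in> ?S" for n x
  proof -
    have "w \<le> c * (G n x * V x)" using w(2)[OF that] c(2)[of x n] by simp
    also have "\<dots> \<le> c * (G n x * r)"
      using that c(1) G_pos[of n x] by (intro mult_left_mono) (auto simp: sublevel_def)
    finally show ?thesis unfolding g_def using c(1) rp by (simp add: divide_le_eq mult_ac)
  qed
  have int: "integrable \<nu> (\<lambda>y. indicator ?S y * F y)" if F: "dominated V F" for F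
  proof -
    obtain a where a: "0 \<le> a" "\<And>x. \<bar>F x\<bar> \<le> a * V x"
      by (fact dominatedE[OF F U_nonneg(1)])
    have a': "\<bar>F x\<bar> \<le> a * r" if "x \<in> ?S" for x
      using a(2)[of x] mult_left_mono[OF _ a(1), of "V x" r] that by (simp add: sublevel_def)
    show ?thesis
    proof (rule Bochner_Integration.integrable_bound)
      show "integrable \<nu> (\<lambda>y. a * r * indicator ?S y :: real)"
        using nu(2) Sb sets by (intro integrable_mult_right integrable_real_indicator) auto
      show "(\<lambda>y. indicator ?S y * F y) \<in> borel_measurable \<nu>"
        using Sb dominated_measurable[OF F] by (intro nm) simp
      show "AE y in \<nu>. norm (indicator ?S y * F y) \<le> norm (a * r * indicator ?S y :: real)"
        using a' a(1) rp by (intro AE_I2) (auto simp: indicator_def abs_mult)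
    qed
  qed
  have minor: "(g * d) * (\<integral>y. indicator ?S y * F y \<partial>\<nu>) \<le> Q_op P G n F x"
    if n: "1 \<le> n" and x: "x \<in> ?S" and F: "dominated V F" "\<And>y. 0 \<le> F y" for n x F
  proof -
    have p: "pd n x \<in> borel_measurable borel" "\<And>y. 0 \<le> pd n x y"
      "P n x = density \<nu> (\<lambda>y. ennreal (pd n x y))"
      using dens n by (auto simp: local_densities_def)
    have Fn: "F \<in> borel_measurable \<nu>" using dominated_measurable[OF F(1)] by (rule nm)
    have pn: "pd n x \<in> borel_measurable \<nu>" using p(1) by (rule nm)
    have PF: "(\<integral>y. F y \<partial>P n x) = (\<integral>y. pd n x y * F y \<partial>\<nu>)"
      unfolding p(3) by (subst integral_density[OF Fn pn]) (use p(2) in auto)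
    have iF: "integrable \<nu> (\<lambda>y. pd n x y * F y)"
      using integrable_kernel[OF n F(1), of x] unfolding p(3)
      by (subst (asm) integrable_density[OF Fn pn]) (use p(2) in auto)
    have "d * (\<integral>y. indicator ?S y * F y \<partial>\<nu>) = (\<integral>y. d * (indicator ?S y * F y) \<partial>\<nu>)" by simp
    also have "\<dots> \<le> (\<integral>y. pd n x y * F y \<partial>\<nu>)"
      using d(2)[OF n x] F(2) p(2)
      by (intro integral_mono iF integrable_mult_right int F(1)) (auto simp: indicator_def intro: mult_right_mono)
    finally have 1: "d * (\<integral>y. indicator ?S y * F y \<partial>\<nu>) \<le> (\<integral>y. F y \<partial>P n x)" using PF by simp
    have "0 \<le> (\<integral>y. indicator ?S y * F y \<partial>\<nu>)"
      using F(2) by (intro Bochner_Integration.integral_nonneg) auto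
    then have "g * (d * (\<integral>y. indicator ?S y * F y \<partial>\<nu>)) \<le> G (n - 1) x * (\<integral>y. F y \<partial>P n x)"
      using 1 g[OF x] g0 d(1) G_pos[of "n-1" x] by (intro mult_mono) auto
    then show ?thesis by (simp add: Q_op_def mult.assoc)
  qed
  have gd: "0 < g * d" using g0 d(1) by simp
  have "r0 \<le> r" by (simp add: r_def)
  from that[OF this gd Sb nu int minor] show ?thesis by blast
qed

lemma positive_on3_Q:
  assumes "1 \<le> n" "dominated V f" "dominated V g" "dominated V h"
  shows "positive_on3 (\<lambda>f. Q_op P G n f x / \<kappa>) f g h"
  unfolding positive_on3_def
proof (intro allI impI)
  fix a b c assume pos: "\<forall>u. 0 \<le> a * f u + b * g u + c * h u"
  have "Q_op P G n (\<lambda>_. 0) x \<le> Q_op P G n (\<lambda>u. a * f u + b * g u + c * h u) x"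
    using pos by (intro Q_op_mono[OF assms(1) dominated_1 dominated_comb3[OF assms(2-4)]]) auto
  then have "0 \<le> (a * Q_op P G n f x + b * Q_op P G n g x + c * Q_op P G n h x) / \<kappa>"
    using kappa by (simp add: Q_op_comb3[OF assms]) (simp add: Q_op_def)
  then show "0 \<le> a * (Q_op P G n f x / \<kappa>) + b * (Q_op P G n g x / \<kappa>) + c * (Q_op P G n h x / \<kappa>)"
    by (simp add: add_divide_distrib)
qed

end

text \<open>The case of small weights. The minorisation lowers the coefficient 2 by
  \<open>2 * q\<close>, and the choice \<open>2 * b * K = q0\<close> lets the additive constant of
  the drift give back only \<open>q0\<close>, which leaves
  \<open>2 - q0 \<le> 2 * a\<close>.\<close>

lemma contraction_small:
  fixes P s a b K q q0 t :: real
  assumes "0 \<le> P" "0 \<le> s" "0 < b" "0 \<le> t" "2 * b * K = q0" "q0 \<le> q" "1 - q0 / 2 \<le> a" "1/2 \<le> a"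
  shows "t * (2 * ((1 - q) * P) + b * (s / 2 + 2 * K * P)) \<le> t * a * (2 * P + b * s)"
proof -
  have "(2 * (1 - q) + 2 * b * K) * P \<le> (2 * a) * P"
    using assms by (intro mult_right_mono) auto
  moreover have "(1/2) * (b * s) \<le> a * (b * s)"
    using assms by (intro mult_right_mono) auto
  ultimately have "2 * ((1 - q) * P) + b * (s / 2 + 2 * K * P) \<le> a * (2 * P + b * s)"
    by (simp add: algebra_simps)
  then show ?thesis using mult_left_mono[OF _ assms(4)] by (simp add: mult.assoc)
qed

text \<open>The case of large weights, where the drift alone gains. A quarter of
  \<open>b * s\<close> is at least \<open>b * (8 * K + 1) * P / 4\<close>: the part with
  \<open>8 * K\<close> pays for \<open>2 * b * K * P\<close>, the remaining \<open>b * P / 4\<close>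
  for lowering the coefficient 2 to \<open>2 * (1 - b / 8)\<close>.\<close>

lemma contraction_large:
  fixes P s a b K t :: real
  assumes "0 \<le> P" "(8 * K + 1) * P \<le> s" "0 < b" "0 \<le> t" "1 - b / 8 \<le> a" "3/4 \<le> a" "0 < K"
  shows "t * (2 * P + b * (s / 2 + 2 * K * P)) \<le> t * a * (2 * P + b * s)"
proof -
  have s: "0 \<le> s" using assms by (auto intro: order_trans[OF _ assms(2)])
  have "(3/4) * (b * s) \<le> a * (b * s)"
    using assms s by (intro mult_right_mono) auto
  moreover have "b * ((8 * K + 1) * P) \<le> b * s" using assms by (intro mult_left_mono) auto
  moreover have "(1 - b / 8) * P \<le> a * P" using assms by (intro mult_right_mono) auto
  ultimately have "2 * P + b * (s / 2 + 2 * K * P) \<le> a * (2 * P + b * s)"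
    by (simp add: algebra_simps)
  then show ?thesis using mult_left_mono[OF _ assms(4)] by (simp add: mult.assoc)
qed

section \<open>Contraction of the weighted oscillation\<close>

context fk_stable
begin

definition nqit :: "nat \<Rightarrow> nat \<Rightarrow> ('a \<Rightarrow> real) \<Rightarrow> 'a \<Rightarrow> real" where
  "nqit m k g x = qit m k g x / \<kappa> ^ m"

lemma nqit_Suc: "nqit (Suc m) k g x = Q_op P G (Suc k) (nqit m (Suc k) g) x / \<kappa>"
proof -
  have "Q_op P G (Suc k) (nqit m (Suc k) g) x = inverse (\<kappa> ^ m) * qit (Suc m) k g x"
    unfolding nqit_def divide_inverse
    by (subst mult.commute) (simp add: Q_op_cmult)
  then show ?thesis by (simp add: nqit_def field_simps)
qed

lemma dominated_nqit: "dominated V g \<Longrightarrow> dominated V (nqit m k g)"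
  unfolding nqit_def divide_inverse
  using dominated_cmult[OF dominated_qit, of g "inverse (\<kappa> ^ m)" m k]
  by (simp add: mult.commute)

text \<open>With \<open>f = nqit m k g / H m k\<close> this says
  \<open>f x - f y \<le> a^m * (2 + b * (V x / H x + V y / H y))\<close>, multiplied by
  \<open>H x * H y\<close>. The weight \<open>V / H m k\<close> changes with \<open>m\<close> and
  \<open>k\<close>, so each step compares two different weights; the constants of drift and
  minorisation do not depend on either, which lets the same \<open>a\<close> and \<open>b\<close>
  serve throughout.\<close>

lemma oscillation_decay:
  "\<exists>a b. 0 \<le> a \<and> a < 1 \<and> 0 < b \<and> (\<forall>g m k x y. unit_fun g \<longrightarrow>
     nqit m k g x * H m k y - nqit m k g y * H m k x \<le>
       a ^ m * (2 * (H m k x * H m k y) + b * (V x * H m k y + V y * H m k x)))"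
proof -
  obtain K where K: "0 < K"
    and drift: "\<And>m k x. Q_op P G (Suc k) V x / \<kappa> \<le> V x / 2 + K * H (Suc m) k x"
    using drift_H by blast
  \<comment> \<open>The threshold required by \<open>contraction_large\<close>; below it, both
    points lie in a fixed sublevel set of \<open>V\<close>.\<close>
  define R where "R = 8 * K + 1"
  obtain r0 where r0: "\<And>m k x. V x \<le> R * H (Suc m) k x \<Longrightarrow> V x \<le> r0"
    using sublevel_V_div_H[of R] by blast
  obtain r \<beta> where r: "r0 \<le> r" and \<beta>: "0 < \<beta>" and Sb: "sublevel V r \<in> sets borel"
    and nu: "0 < emeasure \<nu> (sublevel V r)" "emeasure \<nu> (sublevel V r) < \<infinity>"
    and int: "\<And>F. dominated V F \<Longrightarrow> integrable \<nu> (\<lambda>y. indicator (sublevel V r) y * F y)"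
    and minor: "\<And>n x F. 1 \<le> n \<Longrightarrow> x \<in> sublevel V r \<Longrightarrow> dominated V F \<Longrightarrow> (\<And>y. 0 \<le> F y) \<Longrightarrow>
      \<beta> * (\<integral>y. indicator (sublevel V r) y * F y \<partial>\<nu>) \<le> Q_op P G n F x"
    by (fact minorization[of r0])
  define S where "S = sublevel V r"
  define Mu where "Mu F = (\<integral>y. indicator S y * F y \<partial>\<nu>)" for F :: "'a \<Rightarrow> real"
  obtain C where C: "0 < C" "\<And>m k x. H m k x \<le> C * V x" using H_le by blast
  obtain c where c: "0 < c" "\<And>m k x. W x \<le> c * V x * H m k x" using H_lower by blast
  have Sc: "compact S" unfolding S_def
    by (rule C_infty_sublevel_compact[OF Q_lyapunovD(1)[OF lyap]])
  obtain w where w: "0 < w" "\<And>x. x \<in> S \<Longrightarrow> w \<le> W x"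
    by (fact continuous_bounded_below_on_compact[OF Sc continuous_on_subset[OF W_cont subset_UNIV] W_pos])
  have "S \<noteq> {}" using nu(1) by (auto simp: S_def)
  then have rp: "0 < r" using U_nonneg(2) by (auto simp: S_def sublevel_def intro: less_le_trans)
  define h0 where "h0 = w / (c * r)"
  have h0: "0 < h0" using w c rp by (simp add: h0_def)
  have Hlow: "h0 \<le> H m k x" if "x \<in> S" for m k x
  proof -
    have "w \<le> c * V x * H m k x" using w(2)[OF that] c(2)[of x m k] by simp
    also have "\<dots> \<le> c * r * H m k x"
      using that c(1) H_pos[of m k x] by (intro mult_right_mono) (auto simp: S_def sublevel_def)
    finally show ?thesis unfolding h0_def using c(1) rp by (simp add: divide_le_eq mult_ac)
  qed
  have half_le: "y / 2 \<le> y" if "0 < y" for y :: real using that by simp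
  \<comment> \<open>Half of what the minorisation and \<open>H \<le> C * r\<close> on
    \<open>S\<close> permit. The factor 2 makes \<open>q \<le> 1 / 2\<close> below, so that
    \<open>1 - q\<close> can be cancelled.\<close>
  define \<theta> where "\<theta> = \<beta> / (\<kappa> * (2 * C * r))"
  have \<theta>: "0 < \<theta>" using \<beta> kappa C rp by (simp add: \<theta>_def)
  have \<theta>H: "\<theta> * H m k x \<le> \<beta> / \<kappa> / 2" if "x \<in> S" for m k x
  proof -
    have "H m k x \<le> C * r"
      using that C(1)
      by (intro order_trans[OF C(2)[of m k x] mult_left_mono]) (auto simp: S_def sublevel_def)
    then have "\<theta> * H m k x \<le> \<theta> * (C * r)" using \<theta> by (intro mult_left_mono) auto
    also have "\<dots> = \<beta> / \<kappa> / 2" using C(1) rp kappa by (simp add: \<theta>_def field_simps)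
    finally show ?thesis .
  qed
  \<comment> \<open>The guaranteed size of the common part of two transformed kernels, independent
    of time because \<open>h0\<close> bounds \<open>H\<close> from below on \<open>S\<close> for all
    \<open>m\<close> and \<open>k\<close>.\<close>
  define q0 where "q0 = \<theta> * (h0 * measure \<nu> S)"
  have mS: "0 < measure \<nu> S"
    using nu unfolding S_def measure_def by (simp add: enn2real_positive_iff)
  have q0: "0 < q0" using \<theta> h0 mS by (simp add: q0_def)
  have MuH: "q0 \<le> \<theta> * Mu (H m k)" for m k
  proof -
    have "h0 * measure \<nu> S = (\<integral>y. h0 * indicator S y \<partial>\<nu>)"
      using dens Sb by (simp add: local_densities_def radon_measure_def S_def)
    also have "\<dots> \<le> Mu (H m k)" unfolding Mu_def
    proof (rule integral_mono)
      show "integrable \<nu> (\<lambda>y. h0 * indicator S y)"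
        using int[OF dominated_1[of 1]] by (simp add: S_def)
      show "integrable \<nu> (\<lambda>y. indicator S y * H m k y)"
        using int[OF dominated_H] by (simp add: S_def)
    qed (use Hlow in \<open>auto simp: indicator_def\<close>)
    finally show ?thesis unfolding q0_def using \<theta> by (intro mult_left_mono) auto
  qed
  define b where "b = q0 / (2 * K)"
  have b: "0 < b" "2 * b * K = q0" using q0 K by (auto simp: b_def)
  define a where "a = max (max (3/4) (1 - b / 8)) (1 - q0 / 2)"
  have a: "3/4 \<le> a" "1 - b / 8 \<le> a" "1 - q0 / 2 \<le> a" "a < 1"
    using b(1) q0 by (simp_all add: a_def le_max_iff_disj)
  have main: "nqit m k g x * H m k y - nqit m k g y * H m k x \<le>
       a ^ m * (2 * (H m k x * H m k y) + b * (V x * H m k y + V y * H m k x))"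
    if g: "unit_fun g" for g m k x y
  proof (induction m arbitrary: k x y)
    case 0
    have "g x \<le> 1" "0 \<le> g y" using g by (auto simp: unit_fun_def)
    then have "g x - g y \<le> 2" by linarith
    moreover have "0 \<le> b * (V x + V y)" using b(1) U_nonneg(1)[of x] U_nonneg(1)[of y] by simp
    ultimately show ?case by (simp add: nqit_def H_0)
  next
    case (Suc m)
    let ?D = "H m (Suc k)" and ?F = "nqit m (Suc k) g"
    define T where "T z = (\<lambda>f. Q_op P G (Suc k) f z / \<kappa>)" for z
    define Hx where "Hx = H (Suc m) k x"
    define Hy where "Hy = H (Suc m) k y"
    define p where "p = Hx * Hy"
    define s where "s = V x * Hy + V y * Hx"
    note dF = dominated_nqit[OF dominated_unit[OF g], of m "Suc k"]
    note dD = dominated_H[of m "Suc k"]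
    have TD: "T z ?D = H (Suc m) k z" for z unfolding T_def H_Suc ..
    have TF: "T z ?F = nqit (Suc m) k g z" for z unfolding T_def nqit_Suc ..
    have TV: "T z V \<le> V z / 2 + K * H (Suc m) k z" for z unfolding T_def by (rule drift)
    have T: "positive_on3 (T z) ?D V ?F" for z
      unfolding T_def by (rule positive_on3_Q[OF _ dD dominated_U dF]) simp
    have pos: "0 < Hx" "0 < Hy" "0 < p" "0 \<le> s"
      using H_pos[of "Suc m" k x] H_pos[of "Suc m" k y] U_nonneg(1)[of x] U_nonneg(1)[of y]
      by (auto simp: Hx_def Hy_def p_def s_def)
    have t0: "0 \<le> a ^ m" using a(1) by simp
    have TVs: "T x V * Hy + T y V * Hx \<le> s / 2 + 2 * K * p"
      using mult_right_mono[OF TV[of x], of Hy] mult_right_mono[OF TV[of y], of Hx] pos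
      unfolding Hx_def[symmetric] Hy_def[symmetric] by (simp add: s_def p_def field_simps)
    \<comment> \<open>\<open>s / p\<close> is \<open>V x / H x + V y / H y\<close>. If it exceeds
      \<open>R\<close> the drift contracts; otherwise both points are in \<open>S\<close> and the
      kernels have a common part.\<close>
    have "T x ?F * Hy - T y ?F * Hx \<le> a ^ m * a * (2 * p + b * s)"
    proof (cases "s \<le> R * p")
      case False
      have "T x ?F * T y ?D - T y ?F * T x ?D \<le>
          a ^ m * (2 * (T x ?D * T y ?D) + b * (T x V * T y ?D + T y V * T x ?D))"
        by (rule oscillation_transfer[OF T T Suc])
      then have "T x ?F * Hy - T y ?F * Hx \<le> a ^ m * (2 * p + b * (T x V * Hy + T y V * Hx))"
        by (simp add: TD Hx_def Hy_def p_def)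
      also have "\<dots> \<le> a ^ m * (2 * p + b * (s / 2 + 2 * K * p))"
        using TVs t0 b(1) by (intro mult_left_mono add_left_mono) auto
      also have "\<dots> \<le> a ^ m * a * (2 * p + b * s)"
        using False pos t0 K a b unfolding R_def by (intro contraction_large) auto
      finally show ?thesis .
    next
      case True
      have nn: "0 \<le> V x * Hy" "0 \<le> V y * Hx" using pos U_nonneg(1) by (simp_all add: less_imp_le)
      have e: "(R * Hx) * Hy = R * (Hx * Hy)" "(R * Hy) * Hx = R * (Hx * Hy)" by simp_all
      have "V x * Hy \<le> (R * Hx) * Hy" "V y * Hx \<le> (R * Hy) * Hx"
        unfolding e using True nn unfolding s_def p_def by linarith+
      then have "V x \<le> R * Hx" "V y \<le> R * Hy" using pos(1,2) by (blast dest: mult_right_le_imp_le)+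
      then have xS: "x \<in> S" and yS: "y \<in> S"
        using r0 r unfolding Hx_def Hy_def S_def sublevel_def by (auto intro: order_trans)
      \<comment> \<open>The removed part is proportional to \<open>H (Suc m) k z\<close>. It
        therefore cancels in \<open>L x F * Hy - L y F * Hx\<close>, while \<open>L z D\<close>
        becomes \<open>H (Suc m) k z * (1 - q)\<close>. What remains is still positive on
        \<open>S\<close> by the minorisation.\<close>
      define L where "L z = (\<lambda>f. T z f - \<theta> * H (Suc m) k z * Mu f)" for z
      have L: "positive_on3 (L z) f1 f2 f3"
        if zS: "z \<in> S" and d: "dominated V f1" "dominated V f2" "dominated V f3" for z f1 f2 f3
        unfolding positive_on3_def
      proof (intro allI impI)
        fix a1 a2 a3 assume nn: "\<forall>u. 0 \<le> a1 * f1 u + a2 * f2 u + a3 * f3 u"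
        let ?f = "\<lambda>u. a1 * f1 u + a2 * f2 u + a3 * f3 u"
        have df: "dominated V ?f" by (rule dominated_comb3[OF d])
        have Mul: "Mu ?f = a1 * Mu f1 + a2 * Mu f2 + a3 * Mu f3"
          using int[OF d(1)] int[OF d(2)] int[OF d(3)]
          unfolding Mu_def S_def by (simp add: distrib_left mult.left_commute)
        have Mu0: "0 \<le> Mu ?f" unfolding Mu_def
          using nn by (intro Bochner_Integration.integral_nonneg) auto
        have "\<beta> / \<kappa> / 2 \<le> \<beta> / \<kappa>"
          using divide_pos_pos[OF \<beta> kappa] by (rule half_le)
        then have "\<theta> * H (Suc m) k z \<le> \<beta> / \<kappa>"
          by (rule order_trans[OF \<theta>H[OF zS]])
        then have "\<theta> * H (Suc m) k z * Mu ?f \<le> \<beta> / \<kappa> * Mu ?f"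
          using Mu0 by (rule mult_right_mono)
        also have "\<dots> \<le> T z ?f"
          using minor[of "Suc k" z ?f] zS df nn kappa
          unfolding T_def Mu_def S_def by (auto intro!: divide_right_mono)
        also have "\<dots> = a1 * T z f1 + a2 * T z f2 + a3 * T z f3"
          unfolding T_def using Q_op_comb3[OF _ d, of "Suc k" a1 a2 a3 z]
          by (simp add: add_divide_distrib)
        finally show "0 \<le> a1 * L z f1 + a2 * L z f2 + a3 * L z f3"
          unfolding L_def Mul by (simp add: algebra_simps)
      qed
      define q where "q = \<theta> * Mu ?D"
      have q: "q0 \<le> q" unfolding q_def by (rule MuH)
      have LD: "L z ?D = H (Suc m) k z * (1 - q)" for z
        unfolding L_def TD q_def by (simp add: algebra_simps)
      have "q \<le> 1 / 2"
      proof -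
        have "\<beta> / \<kappa> * Mu ?D \<le> T x ?D"
          using minor[of "Suc k" x ?D] xS dD less_imp_le[OF H_pos] kappa
          unfolding T_def Mu_def S_def by (auto intro!: divide_right_mono)
        then have "\<theta> * (\<beta> / \<kappa> * Mu ?D) \<le> \<theta> * H (Suc m) k x"
          unfolding TD using \<theta> by (intro mult_left_mono) auto
        also have "\<dots> \<le> \<beta> / \<kappa> / 2" by (rule \<theta>H[OF xS])
        finally have "\<beta> / \<kappa> * q \<le> \<beta> / \<kappa> * (1 / 2)" unfolding q_def by (simp add: mult_ac)
        then show ?thesis
          by (rule mult_left_le_imp_le) (use \<beta> kappa in simp)
      qed
      then have q1: "0 < 1 - q" by simp
      have "L x ?F * L y ?D - L y ?F * L x ?D \<le>
          a ^ m * (2 * (L x ?D * L y ?D) + b * (L x V * L y ?D + L y V * L x ?D))"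
        by (rule oscillation_transfer[OF L[OF xS dD dominated_U dF] L[OF yS dD dominated_U dF] Suc])
      moreover have "L x ?F * L y ?D - L y ?F * L x ?D = (1 - q) * (T x ?F * Hy - T y ?F * Hx)"
        unfolding LD by (simp add: L_def Hx_def Hy_def algebra_simps)
      moreover have "a ^ m * (2 * (L x ?D * L y ?D) + b * (L x V * L y ?D + L y V * L x ?D)) =
         (1 - q) * (a ^ m * (2 * ((1 - q) * p) + b * (L x V * Hy + L y V * Hx)))"
        unfolding LD by (simp add: Hx_def Hy_def p_def algebra_simps)
      ultimately have "(1 - q) * (T x ?F * Hy - T y ?F * Hx) \<le>
         (1 - q) * (a ^ m * (2 * ((1 - q) * p) + b * (L x V * Hy + L y V * Hx)))" by simp
      then have "T x ?F * Hy - T y ?F * Hx \<le> a ^ m * (2 * ((1 - q) * p) + b * (L x V * Hy + L y V * Hx))"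
        using q1 by (rule mult_left_le_imp_le)
      also have "\<dots> \<le> a ^ m * (2 * ((1 - q) * p) + b * (s / 2 + 2 * K * p))"
      proof -
        have "0 \<le> Mu V" unfolding Mu_def
          using U_nonneg(1) by (intro Bochner_Integration.integral_nonneg) auto
        then have "L z V \<le> T z V" for z
          unfolding L_def using \<theta> H_pos[of "Suc m" k z] by simp
        then have "L x V * Hy + L y V * Hx \<le> T x V * Hy + T y V * Hx"
          using pos by (intro add_mono mult_right_mono) auto
        then show ?thesis
          using TVs t0 b(1) by (intro mult_left_mono add_left_mono) auto
      qed
      also have "\<dots> \<le> a ^ m * a * (2 * p + b * s)"
        using pos t0 a b q by (intro contraction_small) auto
      finally show ?thesis .
    qed
    then show ?case
      unfolding TF by (simp add: Hx_def Hy_def p_def s_def mult_ac)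
  qed
  show ?thesis
  proof (intro exI conjI allI impI)
    show "0 \<le> a" "a < 1" "0 < b" using a b by auto
  qed (rule main, auto)
qed

section \<open>Dependence of the normalised semigroup on the initial measure\<close>

lemma nphi_nqit: "nphi m k \<mu> g = (\<integral>x. nqit m k g x \<partial>\<mu>) / (\<integral>x. H m k x \<partial>\<mu>)"
  unfolding nphi_def nqit_def H_def using kappa by simp

lemma integral_H_pos:
  assumes "borel_prob \<mu>" "integrable \<mu> V"
  shows "0 < (\<integral>x. H m k x \<partial>\<mu>)"
  using prob_space.integral_pos[OF borel_probD(1)[OF assms(1)]
      integrable_dominated[OF borel_probD(2)[OF assms(1)] assms(2) dominated_H]] H_pos by blast

lemma integral_W_pos:
  assumes "borel_prob \<mu>" "integrable \<mu> V"
  shows "0 < (\<integral>x. W x \<partial>\<mu>)"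
  using prob_space.integral_pos[OF borel_probD(1)[OF assms(1)]
      integrable_dominated[OF borel_probD(2)[OF assms(1)] assms(2) dominated_W]] W_pos by blast

lemma integral_V_ge_1:
  assumes "borel_prob \<mu>" "integrable \<mu> V"
  shows "1 \<le> (\<integral>x. V x \<partial>\<mu>)"
proof -
  interpret prob_space \<mu> using borel_probD[OF assms(1)] by simp
  show ?thesis
    using integral_mono[of \<mu> "\<lambda>_. 1" V] assms(2) U_ge1 by (simp add: prob_space)
qed

text \<open>Up to a constant this bounds the inverse of \<mu>(H) for all \<open>m\<close> and
  \<open>k\<close> at once, so it measures how much normalisation can amplify an error.\<close>

definition mass_ratio :: "'a measure \<Rightarrow> real" where
  "mass_ratio \<mu> = (\<integral>x. V x \<partial>\<mu>) / (\<integral>x. W x \<partial>\<mu>)"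

lemma mass_ratio_pos: "borel_prob \<mu> \<Longrightarrow> integrable \<mu> V \<Longrightarrow> 0 < mass_ratio \<mu>"
  unfolding mass_ratio_def using integral_W_pos integral_V_ge_1
  by (metis divide_pos_pos less_le_trans zero_less_one)

lemma inverse_integral_H: "\<exists>c>0. \<forall>\<mu> m k. borel_prob \<mu> \<longrightarrow> integrable \<mu> V \<longrightarrow>
    1 / (\<integral>x. H m k x \<partial>\<mu>) \<le> c * mass_ratio \<mu>"
proof -
  obtain c where c: "0 < c" "\<And>\<mu> m k. borel_prob \<mu> \<Longrightarrow> integrable \<mu> V \<Longrightarrow>
    (\<integral>x. W x \<partial>\<mu>) \<le> c * (\<integral>x. V x \<partial>\<mu>) * (\<integral>x. H m k x \<partial>\<mu>)"
    using integral_H_lower by blast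
  have "1 / (\<integral>x. H m k x \<partial>\<mu>) \<le> c * mass_ratio \<mu>"
    if "borel_prob \<mu>" "integrable \<mu> V" for \<mu> m k
    using c(2)[OF that, of m k] integral_H_pos[OF that, of m k] integral_W_pos[OF that]
    unfolding mass_ratio_def by (simp add: field_simps)
  then show ?thesis using c(1) by blast
qed

text \<open>The oscillation inequality is linear in each of the two points, so it integrates against
  \<mu> in one and \<eta> in the other. Division by the two masses of \<open>H\<close> gives the
  difference of quotients and leaves means of \<open>V\<close> over means of \<open>H\<close>, which
  \<open>mass_ratio\<close> controls.\<close>

lemma nphi_stability:
  "\<exists>a c. 0 \<le> a \<and> a < 1 \<and> 0 < c \<and> (\<forall>g m k \<mu> \<eta>. unit_fun g \<longrightarrow>
     borel_prob \<mu> \<longrightarrow> integrable \<mu> V \<longrightarrow> borel_prob \<eta> \<longrightarrow> integrable \<eta> V \<longrightarrow>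
     \<bar>nphi m k \<mu> g - nphi m k \<eta> g\<bar> \<le>
       c * a ^ m * (1 + (\<integral>x. V x \<partial>\<mu>) * mass_ratio \<mu> + (\<integral>x. V x \<partial>\<eta>) * mass_ratio \<eta>))"
proof -
  obtain a b where ab: "0 \<le> a" "a < 1" "0 < b"
    and osc: "\<And>g m k x y. unit_fun g \<Longrightarrow>
     nqit m k g x * H m k y - nqit m k g y * H m k x \<le>
       a ^ m * (2 * (H m k x * H m k y) + b * (V x * H m k y + V y * H m k x))"
    using oscillation_decay by blast
  obtain c where c: "0 < c" "\<And>\<mu> m k. borel_prob \<mu> \<Longrightarrow> integrable \<mu> V \<Longrightarrow>
    1 / (\<integral>x. H m k x \<partial>\<mu>) \<le> c * mass_ratio \<mu>"
    using inverse_integral_H by blast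
  have half: "nphi m k \<mu> g - nphi m k \<eta> g \<le>
       (2 + b * c) * a ^ m * (1 + (\<integral>x. V x \<partial>\<mu>) * mass_ratio \<mu> + (\<integral>x. V x \<partial>\<eta>) * mass_ratio \<eta>)"
    if g: "unit_fun g"
      and \<mu>: "borel_prob \<mu>" "integrable \<mu> V" and \<eta>: "borel_prob \<eta>" "integrable \<eta> V" for g m k \<mu> \<eta>
  proof -
    let ?F = "nqit m k g" and ?H = "H m k"
    define Ma where "Ma f = (\<integral>x. f x \<partial>\<mu>)" for f :: "'a \<Rightarrow> real"
    define Na where "Na f = (\<integral>x. f x \<partial>\<eta>)" for f :: "'a \<Rightarrow> real"
    have dF: "dominated V ?F" by (intro dominated_nqit dominated_unit g)
    have pos: "0 < Ma ?H" "0 < Na ?H" unfolding Ma_def Na_def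
      by (rule integral_H_pos[OF \<mu>] integral_H_pos[OF \<eta>])+
    have VM: "Ma V / Ma ?H \<le> c * (Ma V * mass_ratio \<mu>)" "Na V / Na ?H \<le> c * (Na V * mass_ratio \<eta>)"
      using mult_left_mono[OF c(2)[OF \<mu>, of m k], of "Ma V"] integral_V_ge_1[OF \<mu>]
        mult_left_mono[OF c(2)[OF \<eta>, of m k], of "Na V"] integral_V_ge_1[OF \<eta>]
      by (auto simp: Ma_def Na_def mult_ac)
    have m0: "0 \<le> Ma V * mass_ratio \<mu>" "0 \<le> Na V * mass_ratio \<eta>"
      using mass_ratio_pos[OF \<mu>] integral_V_ge_1[OF \<mu>] mass_ratio_pos[OF \<eta>] integral_V_ge_1[OF \<eta>]
      by (auto simp: Ma_def Na_def)
    have "Ma ?F * Na ?H - Na ?F * Ma ?H \<le>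
        a ^ m * (2 * (Ma ?H * Na ?H) + b * (Ma V * Na ?H + Na V * Ma ?H))"
      unfolding Ma_def Na_def
      by (rule oscillation_transfer[OF positive_on3_integral[OF \<mu> dominated_H[of m k] dominated_U dF]
            positive_on3_integral[OF \<eta> dominated_H[of m k] dominated_U dF] osc[OF g, of m k]])
    then have "(Ma ?F * Na ?H - Na ?F * Ma ?H) / (Ma ?H * Na ?H) \<le>
        a ^ m * (2 * (Ma ?H * Na ?H) + b * (Ma V * Na ?H + Na V * Ma ?H)) / (Ma ?H * Na ?H)"
      using pos by (intro divide_right_mono) auto
    moreover have "(Ma ?F * Na ?H - Na ?F * Ma ?H) / (Ma ?H * Na ?H) = nphi m k \<mu> g - nphi m k \<eta> g"
      unfolding nphi_nqit using pos unfolding Ma_def[symmetric] Na_def[symmetric]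
      by (simp add: field_simps)
    moreover have "a ^ m * (2 * (Ma ?H * Na ?H) + b * (Ma V * Na ?H + Na V * Ma ?H)) / (Ma ?H * Na ?H) =
        a ^ m * (2 + b * (Ma V / Ma ?H + Na V / Na ?H))"
      using pos by (simp add: field_simps)
    ultimately have "nphi m k \<mu> g - nphi m k \<eta> g \<le> a ^ m * (2 + b * (Ma V / Ma ?H + Na V / Na ?H))"
      by simp
    also have "\<dots> \<le> a ^ m * ((2 + b * c) * (1 + Ma V * mass_ratio \<mu> + Na V * mass_ratio \<eta>))"
    proof (rule mult_left_mono)
      have "b * (Ma V / Ma ?H + Na V / Na ?H) \<le> b * (c * (Ma V * mass_ratio \<mu>) + c * (Na V * mass_ratio \<eta>))"
        using VM ab(3) by (intro mult_left_mono add_mono) auto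
      moreover have "0 \<le> b * c" using ab c by simp
      ultimately show "2 + b * (Ma V / Ma ?H + Na V / Na ?H) \<le>
          (2 + b * c) * (1 + Ma V * mass_ratio \<mu> + Na V * mass_ratio \<eta>)"
        using m0 by (simp add: algebra_simps)
    qed (use ab in simp)
    finally show ?thesis by (simp add: Ma_def Na_def mult_ac)
  qed
  have "\<bar>nphi m k \<mu> g - nphi m k \<eta> g\<bar> \<le>
       (2 + b * c) * a ^ m * (1 + (\<integral>x. V x \<partial>\<mu>) * mass_ratio \<mu> + (\<integral>x. V x \<partial>\<eta>) * mass_ratio \<eta>)"
    if g: "unit_fun g"
      and \<mu>: "borel_prob \<mu>" "integrable \<mu> V" and \<eta>: "borel_prob \<eta>" "integrable \<eta> V" for g m k \<mu> \<eta>
    using half[OF g \<mu> \<eta>, of m k] half[OF g \<eta> \<mu>, of m k] by (simp add: abs_le_iff add_ac)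
  moreover have "0 < 2 + b * c" using ab c by (simp add: add_pos_pos)
  ultimately show ?thesis using ab(1,2) by blast
qed

text \<open>\<open>A / C - B / D = ((A - B) + B / D * (D - C)) / C\<close> with
  \<open>0 \<le> B / D \<le> 1\<close>. Only the denominator belonging to \<mu> survives, so only
  \<open>mass_ratio \<mu>\<close> has to be truncated; the occupation measure takes that place
  later.\<close>

lemma nphi_local_error:
  "\<exists>c>0. \<forall>g m k \<mu> \<eta>. unit_fun g \<longrightarrow>
     borel_prob \<mu> \<longrightarrow> integrable \<mu> V \<longrightarrow> borel_prob \<eta> \<longrightarrow> integrable \<eta> V \<longrightarrow>
     \<bar>nphi m k \<mu> g - nphi m k \<eta> g\<bar> \<le> c * mass_ratio \<mu> *
       (\<bar>(\<integral>x. nqit m k g x \<partial>\<mu>) - (\<integral>x. nqit m k g x \<partial>\<eta>)\<bar> + \<bar>(\<integral>x. H m k x \<partial>\<mu>) - (\<integral>x. H m k x \<partial>\<eta>)\<bar>)"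
proof -
  obtain c where c: "0 < c" "\<And>\<mu> m k. borel_prob \<mu> \<Longrightarrow> integrable \<mu> V \<Longrightarrow>
    1 / (\<integral>x. H m k x \<partial>\<mu>) \<le> c * mass_ratio \<mu>"
    using inverse_integral_H by blast
  have "\<bar>nphi m k \<mu> g - nphi m k \<eta> g\<bar> \<le> c * mass_ratio \<mu> *
       (\<bar>(\<integral>x. nqit m k g x \<partial>\<mu>) - (\<integral>x. nqit m k g x \<partial>\<eta>)\<bar> + \<bar>(\<integral>x. H m k x \<partial>\<mu>) - (\<integral>x. H m k x \<partial>\<eta>)\<bar>)"
    if g: "unit_fun g"
      and \<mu>: "borel_prob \<mu>" "integrable \<mu> V" and \<eta>: "borel_prob \<eta>" "integrable \<eta> V" for g m k \<mu> \<eta>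
  proof -
    define A B C D where "A = (\<integral>x. nqit m k g x \<partial>\<mu>)" and "B = (\<integral>x. nqit m k g x \<partial>\<eta>)"
      and "C = (\<integral>x. H m k x \<partial>\<mu>)" and "D = (\<integral>x. H m k x \<partial>\<eta>)"
    note ABCD = A_def[symmetric] B_def[symmetric] C_def[symmetric] D_def[symmetric]
    have pos: "0 < C" "0 < D" unfolding C_def D_def
      by (rule integral_H_pos[OF \<mu>] integral_H_pos[OF \<eta>])+
    have n: "0 \<le> B / D" "B / D \<le> 1"
      using nphi_bounds[OF \<eta> g, of m k] unfolding nphi_nqit ABCD by auto
    have "nphi m k \<mu> g - nphi m k \<eta> g = ((A - B) + B / D * (D - C)) * (1 / C)"
      unfolding nphi_nqit ABCD using pos by (simp add: field_simps)
    then have "\<bar>nphi m k \<mu> g - nphi m k \<eta> g\<bar> = \<bar>(A - B) + B / D * (D - C)\<bar> * (1 / C)"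
      using pos by (simp add: abs_mult)
    also have "\<dots> \<le> (\<bar>A - B\<bar> + \<bar>C - D\<bar>) * (1 / C)"
    proof (rule mult_right_mono)
      have "\<bar>B / D * (D - C)\<bar> \<le> 1 * \<bar>D - C\<bar>"
        unfolding abs_mult using n by (intro mult_right_mono) auto
      then show "\<bar>(A - B) + B / D * (D - C)\<bar> \<le> \<bar>A - B\<bar> + \<bar>C - D\<bar>"
        using abs_triangle_ineq[of "A - B" "B / D * (D - C)"] by (simp add: abs_minus_commute)
    qed (use pos in simp)
    also have "\<dots> \<le> (\<bar>A - B\<bar> + \<bar>C - D\<bar>) * (c * mass_ratio \<mu>)"
      using c(2)[OF \<mu>, of m k] by (intro mult_left_mono) (auto simp: C_def)
    finally show ?thesis unfolding ABCD by (simp add: mult_ac)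
  qed
  then show ?thesis using c(1) by blast
qed

lemma nqit_le: "\<exists>C>0. \<forall>m k g x. unit_fun g \<longrightarrow>
   0 \<le> nqit m k g x \<and> nqit m k g x \<le> C * V x"
proof -
  obtain C where C: "0 < C" "\<And>m k x. H m k x \<le> C * V x" using H_le by blast
  have "0 \<le> nqit m k g x \<and> nqit m k g x \<le> C * V x"
    if g: "unit_fun g" for m k g x
  proof -
    have d: "dominated V g" by (rule dominated_unit[OF g])
    have "nqit m k g x \<le> H m k x"
      unfolding nqit_def H_def using qit_mono[OF d dominated_1[of 1], of m k x] g kappa
      by (intro divide_right_mono) (auto simp: unit_fun_def)
    moreover have "0 \<le> nqit m k g x"
      unfolding nqit_def using qit_nonneg[OF d, of m k x] g kappa by (simp add: unit_fun_def)
    ultimately show ?thesis using C(2)[of m k x] by simp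
  qed
  then show ?thesis using C(1) by blast
qed

text \<open>The bound depends on \<open>m\<close> and \<open>k\<close>. It makes integrands bounded,
  and its value enters no rate.\<close>

lemma qit_1_bounded: "\<exists>b. \<forall>x. qit m k (\<lambda>_. 1) x \<le> b"
proof (induction m arbitrary: k)
  case (Suc m)
  then obtain b where b: "\<And>x. qit m (Suc k) (\<lambda>_. 1) x \<le> b" by blast
  obtain g where g: "0 < g" "\<And>x. G k x \<le> g" using G_bounded[of k] by blast
  have "qit (Suc m) k (\<lambda>_. 1) x \<le> g * \<bar>b\<bar>" for x
  proof -
    interpret prob_space "P (Suc k) x" using borel_probD(1)[OF kernel_prob] by simp
    have "(\<integral>y. qit m (Suc k) (\<lambda>_. 1) y \<partial>P (Suc k) x) \<le> (\<integral>y. \<bar>b\<bar> \<partial>P (Suc k) x)"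
      using b by (intro integral_mono integrable_kernel dominated_qit dominated_1)
        (auto intro: order_trans[OF _ abs_ge_self])
    then have "(\<integral>y. qit m (Suc k) (\<lambda>_. 1) y \<partial>P (Suc k) x) \<le> \<bar>b\<bar>" by (simp add: prob_space)
    then show ?thesis
      using g G_pos[of k x] by (auto simp: Q_op_def intro: mult_mono' order_trans[OF mult_left_mono mult_right_mono])
  qed
  then show ?case by blast
qed auto

lemma nqit_bounded:
  assumes g: "unit_fun g"
  shows "\<exists>b. \<forall>x. nqit m k g x \<le> b"
proof -
  obtain b where b: "\<And>x. qit m k (\<lambda>_. 1) x \<le> b" using qit_1_bounded[of m k] by blast
  have "nqit m k g x \<le> b / \<kappa> ^ m" for x
    unfolding nqit_def using kappa g
    by (intro divide_right_mono order_trans[OF qit_mono[OF dominated_unit[OF g] dominated_1[of 1]] b])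
      (auto simp: unit_fun_def)
  then show ?thesis by blast
qed

lemma H_eq_nqit: "H m k = nqit m k (\<lambda>_. 1)"
  by (intro ext) (simp add: H_def nqit_def)

end

section \<open>The walkers and their one-step error\<close>

text \<open>Makes the walker kernels measurable in \<omega>: they are given only as versions of
  conditional expectations.\<close>

lemma measurable_completion_cong_AE:
  assumes f: "f \<in> M \<rightarrow>\<^sub>M N" and ae: "AE x in M. f x = g x" and g: "g \<in> space M \<rightarrow> space N"
  shows "g \<in> completion M \<rightarrow>\<^sub>M N"
proof (rule measurableI)
  show "\<And>x. x \<in> space (completion M) \<Longrightarrow> g x \<in> space N" using g by auto
  fix A assume A: "A \<in> sets N"
  have fA: "f -` A \<inter> space M \<in> sets (completion M)"
    using measurable_sets[OF f A] by simp
  show "g -` A \<inter> space (completion M) \<in> sets (completion M)"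
  proof (rule complete_measure.in_sets_AE[OF _ _ fA])
    show "complete_measure (completion M)" by (rule completion.complete_measure_axioms)
    show "AE x in completion M. (x \<in> f -` A \<inter> space M) = (x \<in> g -` A \<inter> space (completion M))"
      using AE_completion[OF ae] by eventually_elim auto
  qed simp
qed

text \<open>Monotone class argument from indicators to nonnegative functions. Measurability and the
  identity go through the induction together, since additivity and monotone convergence on the right
  need the former. The weights \<open>z\<close> and \<open>w\<close> are separate so that another
  walker may enter by its position on the left and by its kernel on the right.\<close>

lemma nn_integral_kernel_extend:
  fixes \<kappa> :: "'w \<Rightarrow> 'a::topological_space measure"
  assumes X [measurable]: "X \<in> M \<rightarrow>\<^sub>M borel"
    and \<kappa>: "\<And>\<omega>. borel_prob (\<kappa> \<omega>)"
    and z [measurable]: "z \<in> borel_measurable M" and w [measurable]: "w \<in> borel_measurable M"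
    and \<kappa>m: "\<And>A. A \<in> sets borel \<Longrightarrow> (\<lambda>\<omega>. emeasure (\<kappa> \<omega>) A) \<in> borel_measurable M"
    and eq: "\<And>A. A \<in> sets borel \<Longrightarrow>
      (\<integral>\<^sup>+\<omega>. indicator A (X \<omega>) * z \<omega> \<partial>M) = (\<integral>\<^sup>+\<omega>. emeasure (\<kappa> \<omega>) A * w \<omega> \<partial>M)"
    and F: "F \<in> borel_measurable borel"
  shows "(\<lambda>\<omega>. \<integral>\<^sup>+x. F x \<partial>\<kappa> \<omega>) \<in> borel_measurable M \<and>
    (\<integral>\<^sup>+\<omega>. F (X \<omega>) * z \<omega> \<partial>M) = (\<integral>\<^sup>+\<omega>. (\<integral>\<^sup>+x. F x \<partial>\<kappa> \<omega>) * w \<omega> \<partial>M)"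
  using F
proof (induction rule: borel_measurable_induct)
  case (cong f g)
  then have "f = g" by auto
  then show ?case using cong(4) by simp
next
  case (set A)
  have "(\<integral>\<^sup>+x. indicator A x \<partial>\<kappa> \<omega>) = emeasure (\<kappa> \<omega>) A" for \<omega>
    using set borel_probD(2)[OF \<kappa>] by simp
  then show ?case using \<kappa>m[OF set] eq[OF set] by simp
next
  case (mult u c)
  have [measurable]: "u \<in> borel_measurable borel" by (rule mult)
  have 1: "(\<integral>\<^sup>+x. c * u x \<partial>\<kappa> \<omega>) = c * (\<integral>\<^sup>+x. u x \<partial>\<kappa> \<omega>)" for \<omega>
    by (rule nn_integral_cmult) (rule borel_measurable_sets_eq_ennreal[OF borel_probD(2)[OF \<kappa>] mult(2)])
  have [measurable]: "(\<lambda>\<omega>. \<integral>\<^sup>+x. u x \<partial>\<kappa> \<omega>) \<in> borel_measurable M" using mult by simp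
  have "(\<integral>\<^sup>+\<omega>. c * u (X \<omega>) * z \<omega> \<partial>M) = c * (\<integral>\<^sup>+\<omega>. u (X \<omega>) * z \<omega> \<partial>M)"
    unfolding mult.assoc by (rule nn_integral_cmult) measurable
  also have "\<dots> = c * (\<integral>\<^sup>+\<omega>. (\<integral>\<^sup>+x. u x \<partial>\<kappa> \<omega>) * w \<omega> \<partial>M)" using mult by simp
  also have "\<dots> = (\<integral>\<^sup>+\<omega>. c * (\<integral>\<^sup>+x. u x \<partial>\<kappa> \<omega>) * w \<omega> \<partial>M)"
    unfolding mult.assoc by (rule nn_integral_cmult[symmetric]) measurable
  finally show ?case unfolding 1 by simp
next
  case (add u v)
  have [measurable]: "u \<in> borel_measurable borel" "v \<in> borel_measurable borel" by (rule add)+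
  have 1: "(\<integral>\<^sup>+x. v x + u x \<partial>\<kappa> \<omega>) = (\<integral>\<^sup>+x. v x \<partial>\<kappa> \<omega>) + (\<integral>\<^sup>+x. u x \<partial>\<kappa> \<omega>)" for \<omega>
    by (rule nn_integral_add) (rule borel_measurable_sets_eq_ennreal[OF borel_probD(2)[OF \<kappa>]], rule add)+
  have [measurable]: "(\<lambda>\<omega>. \<integral>\<^sup>+x. u x \<partial>\<kappa> \<omega>) \<in> borel_measurable M"
    "(\<lambda>\<omega>. \<integral>\<^sup>+x. v x \<partial>\<kappa> \<omega>) \<in> borel_measurable M" using add by simp_all
  have "(\<integral>\<^sup>+\<omega>. (v (X \<omega>) + u (X \<omega>)) * z \<omega> \<partial>M) =
     (\<integral>\<^sup>+\<omega>. v (X \<omega>) * z \<omega> \<partial>M) + (\<integral>\<^sup>+\<omega>. u (X \<omega>) * z \<omega> \<partial>M)"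
    unfolding distrib_right by (rule nn_integral_add) measurable
  also have "\<dots> = (\<integral>\<^sup>+\<omega>. (\<integral>\<^sup>+x. v x \<partial>\<kappa> \<omega>) * w \<omega> \<partial>M) + (\<integral>\<^sup>+\<omega>. (\<integral>\<^sup>+x. u x \<partial>\<kappa> \<omega>) * w \<omega> \<partial>M)"
    using add by simp
  also have "\<dots> = (\<integral>\<^sup>+\<omega>. ((\<integral>\<^sup>+x. v x \<partial>\<kappa> \<omega>) + (\<integral>\<^sup>+x. u x \<partial>\<kappa> \<omega>)) * w \<omega> \<partial>M)"
    unfolding distrib_right by (rule nn_integral_add[symmetric]) measurable
  finally show ?case unfolding 1 by simp
next
  case (seq U)
  have Um [measurable]: "U i \<in> borel_measurable borel" for i by (rule seq)
  have inc: "incseq U" by fact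
  then have incx: "incseq (\<lambda>i. U i x)" for x by (auto simp: incseq_def le_fun_def)
  have 1: "(\<integral>\<^sup>+x. (SUP i. U i) x \<partial>\<kappa> \<omega>) = (SUP i. \<integral>\<^sup>+x. U i x \<partial>\<kappa> \<omega>)" for \<omega>
    unfolding SUP_apply
    by (rule nn_integral_monotone_convergence_SUP[OF inc])
       (rule borel_measurable_sets_eq_ennreal[OF borel_probD(2)[OF \<kappa>] Um])
  have [measurable]: "(\<lambda>\<omega>. \<integral>\<^sup>+x. U i x \<partial>\<kappa> \<omega>) \<in> borel_measurable M" for i
    using seq.IH[of i] by simp
  have inck: "incseq (\<lambda>i. \<integral>\<^sup>+x. U i x \<partial>\<kappa> \<omega>)" for \<omega>
    using inc by (auto simp: incseq_def le_fun_def intro!: nn_integral_mono)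
  have "(\<integral>\<^sup>+\<omega>. (SUP i. U i) (X \<omega>) * z \<omega> \<partial>M) = (\<integral>\<^sup>+\<omega>. (SUP i. U i (X \<omega>) * z \<omega>) \<partial>M)"
    unfolding SUP_apply by (simp add: SUP_mult_right_ennreal)
  also have "\<dots> = (SUP i. \<integral>\<^sup>+\<omega>. U i (X \<omega>) * z \<omega> \<partial>M)"
    using incx by (intro nn_integral_monotone_convergence_SUP)
      (auto simp: incseq_def le_fun_def intro!: mult_right_mono)
  also have "\<dots> = (SUP i. \<integral>\<^sup>+\<omega>. (\<integral>\<^sup>+x. U i x \<partial>\<kappa> \<omega>) * w \<omega> \<partial>M)"
    using seq.IH by simp
  also have "\<dots> = (\<integral>\<^sup>+\<omega>. (SUP i. (\<integral>\<^sup>+x. U i x \<partial>\<kappa> \<omega>) * w \<omega>) \<partial>M)"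
    using inck by (intro nn_integral_monotone_convergence_SUP[symmetric])
      (auto simp: incseq_def le_fun_def intro!: mult_right_mono)
  also have "\<dots> = (\<integral>\<^sup>+\<omega>. (SUP i. \<integral>\<^sup>+x. U i x \<partial>\<kappa> \<omega>) * w \<omega> \<partial>M)"
    by (simp add: SUP_mult_right_ennreal)
  finally show ?case unfolding 1 by simp
qed

section \<open>Empirical measures and the selection kernel\<close>

lemma measurable_into_empirical:
  "x \<in> uniform_count_measure {..<N} \<rightarrow>\<^sub>M (borel :: 'a::topological_space measure)"
  by (auto simp: measurable_def space_uniform_count_measure sets_uniform_count_measure)

lemma empirical_prob:
  assumes "1 \<le> N"
  shows "borel_prob (empirical N x)"
proof -
  interpret prob_space "uniform_count_measure {..<N}"
    using assms by (intro prob_space_uniform_count_measure) (auto simp: lessThan_empty_iff)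
  show ?thesis
    unfolding empirical_def using prob_space_distr[OF measurable_into_empirical, of x]
    by (simp add: space_prob_algebra)
qed

lemma nn_integral_empirical:
  assumes "f \<in> borel_measurable borel"
  shows "(\<integral>\<^sup>+y. f y \<partial>empirical N x) = (\<Sum>i<N. ennreal (1 / N) * f (x i))"
proof -
  have "(\<integral>\<^sup>+y. f y \<partial>empirical N x) = (\<integral>\<^sup>+i. f (x i) \<partial>uniform_count_measure {..<N})"
    unfolding empirical_def using assms by (intro nn_integral_distr measurable_into_empirical) simp
  then show ?thesis
    unfolding uniform_count_measure_def by (simp add: nn_integral_point_measure_finite)
qed

lemma integrable_empirical:
  fixes f :: "'a::topological_space \<Rightarrow> real"
  assumes f: "f \<in> borel_measurable borel"
  shows "integrable (empirical N x) f"
proof (rule integrableI_bounded)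
  show "f \<in> borel_measurable (empirical N x)"
    using f by (simp add: empirical_def)
  have "(\<integral>\<^sup>+y. ennreal (norm (f y)) \<partial>empirical N x) = (\<Sum>i<N. ennreal (1 / N) * ennreal (norm (f (x i))))"
    using f by (intro nn_integral_empirical) simp
  also have "\<dots> < \<infinity>" by (simp add: ennreal_mult[symmetric] sum_ennreal)
  finally show "(\<integral>\<^sup>+y. ennreal (norm (f y)) \<partial>empirical N x) < \<infinity>" .
qed

text \<open>Each of the \<open>N\<close> points carries positive mass. Admissibility of the tuning
  parameter, required only almost everywhere, thus holds at each walker.\<close>

lemma AE_empirical_iff:
  assumes "1 \<le> N" "{y. Q y} \<in> sets borel"
  shows "(AE y in empirical N x. Q y) \<longleftrightarrow> (\<forall>i<N. Q (x i))"
proof -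
  have "(AE y in empirical N x. Q y) \<longleftrightarrow> (AE i in uniform_count_measure {..<N}. Q (x i))"
    unfolding empirical_def using assms(2) by (intro AE_distr_iff measurable_into_empirical) simp
  also have "\<dots> \<longleftrightarrow> (\<forall>i<N. Q (x i))"
    unfolding uniform_count_measure_def AE_point_measure using assms(1) by auto
  finally show ?thesis .
qed

context fk_model
begin

lemma selection_sets: "borel_prob \<eta> \<Longrightarrow> sets (selection G \<epsilon> n \<eta> x) = sets borel"
  unfolding selection_def
  using boltzmann_gibbs_prob(2)[OF pot, of \<eta> n]
  by (intro sets_bind) (auto simp: space_prob_algebra)

lemma nn_integral_selection:
  assumes q: "\<epsilon> n \<eta> * G n x \<in> {0..1}" and \<eta>: "borel_prob \<eta>" and f: "f \<in> borel_measurable borel"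
  shows "(\<integral>\<^sup>+y. f y \<partial>selection G \<epsilon> n \<eta> x) =
    ennreal (\<epsilon> n \<eta> * G n x) * f x +
    ennreal (1 - \<epsilon> n \<eta> * G n x) * (\<integral>\<^sup>+y. f y \<partial>boltzmann_gibbs (G n) \<eta>)"
proof -
  let ?k = "\<lambda>b. if b then return borel x else boltzmann_gibbs (G n) \<eta>"
  have "return borel x \<in> space (prob_algebra borel)"
    by (simp add: space_prob_algebra prob_space_return)
  with boltzmann_gibbs_prob(2)[OF pot \<eta>, of n] have "?k b \<in> space (subprob_algebra borel)" for b
    by (cases b) (simp_all add: space_subprob_algebra space_prob_algebra prob_space_imp_subprob_space)
  then have m: "?k \<in> measure_pmf (bernoulli_pmf (\<epsilon> n \<eta> * G n x)) \<rightarrow>\<^sub>M subprob_algebra borel"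
    by (simp add: measurable_def)
  have "(\<integral>\<^sup>+y. f y \<partial>selection G \<epsilon> n \<eta> x) =
      (\<integral>\<^sup>+b. (\<integral>\<^sup>+y. f y \<partial>?k b) \<partial>measure_pmf (bernoulli_pmf (\<epsilon> n \<eta> * G n x)))"
    unfolding selection_def by (rule nn_integral_bind[OF f m])
  also have "\<dots> = ennreal (\<epsilon> n \<eta> * G n x) * (\<integral>\<^sup>+y. f y \<partial>return borel x) +
      ennreal (1 - \<epsilon> n \<eta> * G n x) * (\<integral>\<^sup>+y. f y \<partial>boltzmann_gibbs (G n) \<eta>)"
    using q by (simp add: mult.commute)
  finally show ?thesis using f by (simp add: nn_integral_return)
qed

lemma nn_integral_dmc_kernel:
  assumes q: "\<epsilon> n \<eta> * G n x \<in> {0..1}" and \<eta>: "borel_prob \<eta>" and f: "f \<in> borel_measurable borel"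
  shows "(\<integral>\<^sup>+y. f y \<partial>dmc_kernel P G \<epsilon> n \<eta> x) =
    ennreal (\<epsilon> n \<eta> * G n x) * (\<integral>\<^sup>+y. f y \<partial>P (Suc n) x) +
    ennreal (1 - \<epsilon> n \<eta> * G n x) * (\<integral>\<^sup>+y. f y \<partial>step n \<eta>)"
proof -
  have "P (Suc n) \<in> selection G \<epsilon> n \<eta> x \<rightarrow>\<^sub>M subprob_algebra borel"
    using measurable_prob_algebraD[OF kernel[of "Suc n"]]
    unfolding measurable_cong_sets[OF selection_sets[OF \<eta>] refl] by simp
  then have "(\<integral>\<^sup>+y. f y \<partial>dmc_kernel P G \<epsilon> n \<eta> x) =
     (\<integral>\<^sup>+z. (\<integral>\<^sup>+y. f y \<partial>P (Suc n) z) \<partial>selection G \<epsilon> n \<eta> x)"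
    unfolding dmc_kernel_def by (rule nn_integral_bind[OF f])
  also have "\<dots> = ennreal (\<epsilon> n \<eta> * G n x) * (\<integral>\<^sup>+y. f y \<partial>P (Suc n) x) +
    ennreal (1 - \<epsilon> n \<eta> * G n x) * (\<integral>\<^sup>+z. (\<integral>\<^sup>+y. f y \<partial>P (Suc n) z) \<partial>boltzmann_gibbs (G n) \<eta>)"
    by (intro nn_integral_selection q \<eta> nn_integral_kernel_meas f) simp
  finally show ?thesis unfolding nn_integral_step_bg[OF \<eta> f] .
qed

lemma dmc_kernel_prob:
  assumes q: "\<epsilon> n \<eta> * G n x \<in> {0..1}" and \<eta>: "borel_prob \<eta>"
  shows "borel_prob (dmc_kernel P G \<epsilon> n \<eta> x)"
proof -
  have ne: "space (selection G \<epsilon> n \<eta> x) \<noteq> {}"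
    using sets_eq_imp_space_eq[OF selection_sets[OF \<eta>]] by simp
  have s: "sets (dmc_kernel P G \<epsilon> n \<eta> x) = sets borel"
    unfolding dmc_kernel_def using borel_probD(2)[OF kernel_prob] by (intro sets_bind ne) simp
  have "emeasure (dmc_kernel P G \<epsilon> n \<eta> x) (space (dmc_kernel P G \<epsilon> n \<eta> x)) =
    (\<integral>\<^sup>+y. 1 \<partial>dmc_kernel P G \<epsilon> n \<eta> x)" by simp
  also have "\<dots> = ennreal (\<epsilon> n \<eta> * G n x) * (\<integral>\<^sup>+y. 1 \<partial>P (Suc n) x) +
    ennreal (1 - \<epsilon> n \<eta> * G n x) * (\<integral>\<^sup>+y. 1 \<partial>step n \<eta>)"
    by (rule nn_integral_dmc_kernel[of \<epsilon> n \<eta> x, OF q \<eta>]) simp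
  also have "\<dots> = ennreal (\<epsilon> n \<eta> * G n x) + ennreal (1 - \<epsilon> n \<eta> * G n x)"
    using prob_space.emeasure_space_1[OF borel_probD(1)[OF kernel_prob[of "Suc n" x]]]
      prob_space.emeasure_space_1[OF borel_probD(1)[OF step_prob[OF \<eta>, of n]]] by simp
  also have "\<dots> = 1" using q by (simp add: ennreal_plus[symmetric] del: ennreal_plus)
  finally show ?thesis using s by (auto simp: space_prob_algebra intro: prob_spaceI)
qed

text \<open>Averaged over the walkers, the tuning parameter drops out of the transition kernel.\<close>

lemma sum_dmc_kernel:
  fixes x :: "nat \<Rightarrow> 'a"
  assumes N: "1 \<le> N" and \<epsilon>: "0 \<le> \<epsilon> n (empirical N x)"
    and q: "\<And>i. i < N \<Longrightarrow> \<epsilon> n (empirical N x) * G n (x i) \<in> {0..1}"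
    and f: "f \<in> borel_measurable borel"
  shows "(\<Sum>i<N. \<integral>\<^sup>+y. f y \<partial>dmc_kernel P G \<epsilon> n (empirical N x) (x i)) =
    of_nat N * (\<integral>\<^sup>+y. f y \<partial>step n (empirical N x))"
proof -
  let ?\<eta> = "empirical N x"
  define e where "e = \<epsilon> n ?\<eta>"
  define Z where "Z = (\<Sum>i<N. G n (x i))"
  define s where "s = (\<integral>\<^sup>+y. f y \<partial>step n ?\<eta>)"
  define h where "h z = (\<integral>\<^sup>+y. f y \<partial>P (Suc n) z)" for z
  note \<eta> = empirical_prob[OF N, of x]
  have Z: "0 < Z" unfolding Z_def using N G_pos by (intro sum_pos) (auto simp: lessThan_empty_iff)
  have hm: "h \<in> borel_measurable borel"
    unfolding h_def using nn_integral_kernel_meas[OF _ f, of "Suc n"] by simp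
  have "s = (\<integral>\<^sup>+z. ennreal (G n z / (Z / N)) * h z \<partial>?\<eta>)"
    unfolding s_def nn_integral_step[OF \<eta> f] h_def Z_def integral_empirical[OF G_meas] ..
  also have "\<dots> = (\<Sum>i<N. ennreal (1 / N) * (ennreal (G n (x i) / (Z / N)) * h (x i)))"
    using hm by (intro nn_integral_empirical) simp
  also have "\<dots> = (\<Sum>i<N. ennreal (1 / Z) * (ennreal (G n (x i)) * h (x i)))"
    using N Z G_pos[of n]
    by (intro sum.cong refl) (simp add: mult.assoc[symmetric] ennreal_mult[symmetric] less_imp_le)
  also have "\<dots> = ennreal (1 / Z) * (\<Sum>i<N. ennreal (G n (x i)) * h (x i))"
    by (simp add: sum_distrib_left)
  finally have "ennreal Z * s = (\<Sum>i<N. ennreal (G n (x i)) * h (x i))"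
    using Z by (simp add: mult.assoc[symmetric] ennreal_mult[symmetric])
  \<comment> \<open>As \<open>s\<close> is the average of \<open>h (x i)\<close> weighted by
    \<open>G n (x i)\<close>, the walkers that stay contribute \<open>e * Z\<close> times
    \<open>s\<close> in total and the resampled ones \<open>N - e * Z\<close> times
    \<open>s\<close>, so \<open>e\<close> disappears from the sum.\<close>
  then have Zs: "ennreal (e * Z) * s = (\<Sum>i<N. ennreal (e * G n (x i)) * h (x i))"
    using \<epsilon> Z G_pos[of n]
    by (simp add: e_def ennreal_mult less_imp_le mult.assoc sum_distrib_left)
  have eZ: "e * Z \<le> N"
  proof -
    have "(\<Sum>i<N. e * G n (x i)) \<le> (\<Sum>i<N. 1)" using q by (intro sum_mono) (auto simp: e_def)
    then show ?thesis by (simp add: Z_def sum_distrib_left)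
  qed
  have "(\<Sum>i<N. \<integral>\<^sup>+y. f y \<partial>dmc_kernel P G \<epsilon> n ?\<eta> (x i)) =
     (\<Sum>i<N. ennreal (e * G n (x i)) * h (x i) + ennreal (1 - e * G n (x i)) * s)"
    using q nn_integral_dmc_kernel[OF _ \<eta> f] unfolding e_def h_def s_def
    by (intro sum.cong refl) auto
  also have "\<dots> = ennreal (e * Z) * s + (\<Sum>i<N. ennreal (1 - e * G n (x i))) * s"
    unfolding sum.distrib Zs by (simp add: sum_distrib_right)
  also have "(\<Sum>i<N. ennreal (1 - e * G n (x i))) = ennreal (\<Sum>i<N. 1 - e * G n (x i))"
    using q by (intro sum_ennreal) (auto simp: e_def)
  also have "(\<Sum>i<N. 1 - e * G n (x i)) = N - e * Z"
    by (simp add: sum_subtractf Z_def sum_distrib_left)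
  also have "ennreal (e * Z) * s + ennreal (N - e * Z) * s = ennreal (e * Z + (N - e * Z)) * s"
    using eZ \<epsilon> Z by (subst ennreal_plus) (auto simp: e_def distrib_right)
  finally show ?thesis by (simp add: s_def ennreal_of_nat_eq_real_of_nat)
qed

end

section \<open>Mean deviation of averages through second moments\<close>

lemma (in prob_space) integral_abs_le_sqrt:
  fixes X :: "'a \<Rightarrow> real"
  assumes [simp]: "integrable M X" "integrable M (\<lambda>\<omega>. (X \<omega>)\<^sup>2)" and q: "(\<integral>\<omega>. (X \<omega>)\<^sup>2 \<partial>M) \<le> q"
  shows "(\<integral>\<omega>. \<bar>X \<omega>\<bar> \<partial>M) \<le> sqrt q"
proof -
  define m where "m = (\<integral>\<omega>. \<bar>X \<omega>\<bar> \<partial>M)"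
  \<comment> \<open>Nonnegativity of the variance of \<open>|X|\<close> is the instance of
    Cauchy-Schwarz that is wanted.\<close>
  have "0 \<le> (\<integral>\<omega>. (\<bar>X \<omega>\<bar> - m)\<^sup>2 \<partial>M)" by (intro Bochner_Integration.integral_nonneg) simp
  also have "(\<lambda>\<omega>. (\<bar>X \<omega>\<bar> - m)\<^sup>2) = (\<lambda>\<omega>. (X \<omega>)\<^sup>2 - 2 * m * \<bar>X \<omega>\<bar> + m\<^sup>2)"
    by (intro ext) (simp add: power2_diff algebra_simps)
  also have "(\<integral>\<omega>. (X \<omega>)\<^sup>2 - 2 * m * \<bar>X \<omega>\<bar> + m\<^sup>2 \<partial>M) = (\<integral>\<omega>. (X \<omega>)\<^sup>2 \<partial>M) - 2 * m * m + m\<^sup>2"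
    by (simp add: prob_space m_def)
  finally have "m\<^sup>2 \<le> q" using q by (simp add: power2_eq_square)
  then show ?thesis unfolding m_def[symmetric] by (rule real_le_rsqrt)
qed

text \<open>
  \<open>S\<close> is a sum of \<open>n\<close> terms whose conditional mean is \<open>s\<close>; the hypothesis on the second moment
  is what conditional independence of the terms gives.
\<close>

lemma (in prob_space) mean_deviation_bound:
  fixes S s :: "'a \<Rightarrow> real"
  assumes [measurable]: "S \<in> borel_measurable M" "s \<in> borel_measurable M"
    and n: "1 \<le> n" and Sb: "\<And>\<omega>. \<bar>S \<omega>\<bar> \<le> b" and sb: "\<And>\<omega>. \<bar>s \<omega>\<bar> \<le> b"
    and S2: "(\<integral>\<omega>. (S \<omega>)\<^sup>2 \<partial>M) \<le> real n * q + (real n)\<^sup>2 * (\<integral>\<omega>. (s \<omega>)\<^sup>2 \<partial>M)"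
    and Ss: "(\<integral>\<omega>. S \<omega> * s \<omega> \<partial>M) = real n * (\<integral>\<omega>. (s \<omega>)\<^sup>2 \<partial>M)"
  shows "(\<integral>\<omega>. \<bar>S \<omega> / real n - s \<omega>\<bar> \<partial>M) \<le> sqrt (q / real n)"
proof (rule integral_abs_le_sqrt)
  have b: "0 \<le> b" using Sb[of undefined] by linarith
  have i: "integrable M (\<lambda>\<omega>. f \<omega> * g \<omega>)"
    if [measurable]: "f \<in> borel_measurable M" "g \<in> borel_measurable M"
      and fg: "\<And>\<omega>. \<bar>f \<omega>\<bar> \<le> b" "\<And>\<omega>. \<bar>g \<omega>\<bar> \<le> b" for f g :: "'a \<Rightarrow> real"
  proof (rule integrable_const_bound[where B = "b * b"])
    show "AE \<omega> in M. norm (f \<omega> * g \<omega>) \<le> b * b"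
      unfolding real_norm_def abs_mult using fg b by (intro AE_I2 mult_mono) auto
  qed measurable
  have i1: "integrable M S" "integrable M s"
    using Sb sb by (auto intro!: integrable_const_bound[where B = b])
  have i2: "integrable M (\<lambda>\<omega>. S \<omega> * S \<omega>)" "integrable M (\<lambda>\<omega>. S \<omega> * s \<omega>)" "integrable M (\<lambda>\<omega>. s \<omega> * s \<omega>)"
    by (rule i; fact)+
  show "integrable M (\<lambda>\<omega>. S \<omega> / real n - s \<omega>)" using i1 by simp
  have e: "(\<lambda>\<omega>. (S \<omega> / real n - s \<omega>)\<^sup>2) =
     (\<lambda>\<omega>. (S \<omega> * S \<omega>) / (real n)\<^sup>2 - 2 / real n * (S \<omega> * s \<omega>) + s \<omega> * s \<omega>)"
    by (simp add: power2_eq_square algebra_simps)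
  show "integrable M (\<lambda>\<omega>. (S \<omega> / real n - s \<omega>)\<^sup>2)" unfolding e using i2 by simp
  \<comment> \<open>The mixed term equals minus twice the mean square of \<open>s\<close>, so that
    mean square survives once with a negative sign and cancels the second summand in
    \<open>S2\<close>.\<close>
  have "(\<integral>\<omega>. (S \<omega> / real n - s \<omega>)\<^sup>2 \<partial>M) =
     (\<integral>\<omega>. (S \<omega>)\<^sup>2 \<partial>M) / (real n)\<^sup>2 - 2 / real n * (\<integral>\<omega>. S \<omega> * s \<omega> \<partial>M) + (\<integral>\<omega>. (s \<omega>)\<^sup>2 \<partial>M)"
    unfolding e using i2 by (simp add: power2_eq_square)
  also have "\<dots> = (\<integral>\<omega>. (S \<omega>)\<^sup>2 \<partial>M) / (real n)\<^sup>2 - (\<integral>\<omega>. (s \<omega>)\<^sup>2 \<partial>M)"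
    unfolding Ss using n by simp
  also have "\<dots> \<le> (real n * q + (real n)\<^sup>2 * (\<integral>\<omega>. (s \<omega>)\<^sup>2 \<partial>M)) / (real n)\<^sup>2 - (\<integral>\<omega>. (s \<omega>)\<^sup>2 \<partial>M)"
    using S2 by (intro diff_right_mono divide_right_mono) auto
  also have "\<dots> = q / real n" using n by (simp add: add_divide_distrib power2_eq_square)
  finally show "(\<integral>\<omega>. (S \<omega> / real n - s \<omega>)\<^sup>2 \<partial>M) \<le> q / real n" .
qed

lemma sum_square_split:
  fixes a :: "nat \<Rightarrow> 'b::comm_semiring_1"
  shows "(\<Sum>i<n. a i) * (\<Sum>i<n. a i) = (\<Sum>i<n. a i * a i) + (\<Sum>i<n. \<Sum>j\<in>{..<n} - {i}. a i * a j)"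
proof -
  have "(\<Sum>i<n. a i) * (\<Sum>i<n. a i) = (\<Sum>i<n. \<Sum>j<n. a i * a j)" by (rule sum_product)
  also have "\<dots> = (\<Sum>i<n. a i * a i + (\<Sum>j\<in>{..<n} - {i}. a i * a j))"
    by (intro sum.cong refl sum.remove) auto
  finally show ?thesis by (simp add: sum.distrib)
qed

section \<open>Conditional laws of the walkers\<close>

locale dmc = fk_model P G
  for P :: "nat \<Rightarrow> 'a::polish_space \<Rightarrow> 'a measure" and G :: "nat \<Rightarrow> 'a \<Rightarrow> real" +
  fixes \<epsilon> :: "nat \<Rightarrow> 'a measure \<Rightarrow> real" and \<eta>0 :: "'a measure" and N :: nat
    and M :: "'w measure" and \<xi> :: "nat \<Rightarrow> nat \<Rightarrow> 'w \<Rightarrow> 'a"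
  assumes tuning: "tuning_parameters G \<epsilon>" and N: "1 \<le> N"
    and walkers: "dmc_walkers P G \<epsilon> \<eta>0 N M \<xi>"
begin

sublocale M: prob_space M
  using walkers by (simp add: dmc_walkers_def)

abbreviation "emp n \<omega> \<equiv> empirical N (\<lambda>i. \<xi> n i \<omega>)"

definition walker_kernel :: "nat \<Rightarrow> nat \<Rightarrow> 'w \<Rightarrow> 'a measure" where
  "walker_kernel n i \<omega> = dmc_kernel P G \<epsilon> n (emp n \<omega>) (\<xi> n i \<omega>)"

abbreviation "past n \<equiv> walkers_sigma M N (\<xi> n)"

lemma xi_meas: "i < N \<Longrightarrow> \<xi> n i \<in> M \<rightarrow>\<^sub>M borel"
  using walkers by (simp add: dmc_walkers_def)

lemma emp_prob: "borel_prob (emp n \<omega>)"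
  by (rule empirical_prob[OF N])

lemma integral_emp: "f \<in> borel_measurable borel \<Longrightarrow> (\<integral>x. f x \<partial>emp n \<omega>) = (\<Sum>i<N. f (\<xi> n i \<omega>)) / N"
  for f :: "'a \<Rightarrow> real"
  by (rule integral_empirical)

lemma integrable_emp: "f \<in> borel_measurable borel \<Longrightarrow> integrable (emp n \<omega>) f"
  for f :: "'a \<Rightarrow> real"
  by (rule integrable_empirical)

lemma tuning_emp: "0 \<le> \<epsilon> n (emp n \<omega>)" "i < N \<Longrightarrow> \<epsilon> n (emp n \<omega>) * G n (\<xi> n i \<omega>) \<in> {0..1}"
proof -
  have t: "\<epsilon> n (emp n \<omega>) \<in> {0..1}" "AE x in emp n \<omega>. \<epsilon> n (emp n \<omega>) * G n x \<in> {0..1}"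
    using tuning emp_prob unfolding tuning_parameters_def by auto
  then show "0 \<le> \<epsilon> n (emp n \<omega>)" by simp
  have "{y. \<epsilon> n (emp n \<omega>) * G n y \<in> {0..1}} \<in> sets borel" by measurable
  from t(2)[unfolded AE_empirical_iff[OF N this]]
  show "i < N \<Longrightarrow> \<epsilon> n (emp n \<omega>) * G n (\<xi> n i \<omega>) \<in> {0..1}" by blast
qed

lemma walker_kernel_prob: "i < N \<Longrightarrow> borel_prob (walker_kernel n i \<omega>)"
  unfolding walker_kernel_def by (intro dmc_kernel_prob tuning_emp emp_prob)

lemma sum_walker_kernel:
  assumes f: "f \<in> borel_measurable borel"
  shows "(\<Sum>i<N. \<integral>\<^sup>+y. f y \<partial>walker_kernel n i \<omega>) = of_nat N * (\<integral>\<^sup>+y. f y \<partial>step n (emp n \<omega>))"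
  unfolding walker_kernel_def
  using tuning_emp(1)[of n \<omega>] tuning_emp(2)[of _ n \<omega>] by (intro sum_dmc_kernel N f) auto

lemma past_subalgebra: "subalgebra M (past n)"
proof -
  have "(\<lambda>\<omega>. \<lambda>i\<in>{..<N}. \<xi> n i \<omega>) \<in> M \<rightarrow>\<^sub>M PiM {..<N} (\<lambda>_. borel)"
    using xi_meas by (intro measurable_restrict) auto
  then show ?thesis
    unfolding subalgebra_def walkers_sigma_def using sets_image_in_sets[OF refl] by auto
qed

lemma xi_past_meas: "i < N \<Longrightarrow> \<xi> n i \<in> past n \<rightarrow>\<^sub>M borel"
proof -
  assume i: "i < N"
  have "(\<lambda>\<omega>. \<lambda>i\<in>{..<N}. \<xi> n i \<omega>) \<in> past n \<rightarrow>\<^sub>M PiM {..<N} (\<lambda>_. borel)"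
    unfolding walkers_sigma_def by (rule measurable_vimage_algebra1) (auto simp: space_PiM)
  from measurable_compose[OF this measurable_component_singleton[of i]] i
  show ?thesis by simp
qed

lemma past_meas: "f \<in> past n \<rightarrow>\<^sub>M L \<Longrightarrow> f \<in> M \<rightarrow>\<^sub>M L"
  by (rule measurable_from_subalg[OF past_subalgebra])

lemma cond_exp_rect:
  assumes "\<And>i. i < N \<Longrightarrow> A i \<in> sets borel"
  shows "AE \<omega> in M. real_cond_exp M (past n) (indicator {\<omega> \<in> space M. \<forall>i<N. \<xi> (Suc n) i \<omega> \<in> A i}) \<omega> =
           (\<Prod>i<N. measure (walker_kernel n i \<omega>) (A i))"
  using walkers assms unfolding dmc_walkers_def walker_kernel_def by blast

lemma rect_sets:
  assumes "\<And>i. i < N \<Longrightarrow> A i \<in> sets borel"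
  shows "{\<omega> \<in> space M. \<forall>i<N. \<xi> (Suc n) i \<omega> \<in> A i} \<in> sets M"
proof -
  have "{\<omega> \<in> space M. \<forall>i\<in>{..<N}. \<xi> (Suc n) i \<omega> \<in> A i} \<in> sets M"
    using xi_meas assms by (intro sets.sets_Collect_finite_All) (auto intro: measurable_sets_Collect)
  then show ?thesis unfolding Ball_def lessThan_iff .
qed

text \<open>The characterisation of conditional expectation, tested against a bounded function of
  the current configuration. In nonnegative integrals the product of kernel measures may replace the
  conditional expectation almost everywhere before its measurability is known.\<close>

lemma nn_integral_rect:
  assumes A: "\<And>i. i < N \<Longrightarrow> A i \<in> sets borel"
    and Z: "Z \<in> borel_measurable (past n)" "\<And>\<omega>. 0 \<le> Z \<omega>" "\<And>\<omega>. Z \<omega> \<le> b"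
  shows "(\<integral>\<^sup>+\<omega>. ennreal (Z \<omega>) * indicator {\<omega> \<in> space M. \<forall>i<N. \<xi> (Suc n) i \<omega> \<in> A i} \<omega> \<partial>M) =
    (\<integral>\<^sup>+\<omega>. ennreal (Z \<omega>) * ennreal (\<Prod>i<N. measure (walker_kernel n i \<omega>) (A i)) \<partial>M)"
proof -
  interpret S: finite_measure_subalgebra M "past n"
    by unfold_locales (rule past_subalgebra)
  define R where "R = {\<omega> \<in> space M. \<forall>i<N. \<xi> (Suc n) i \<omega> \<in> A i}"
  let ?c = "real_cond_exp M (past n) (indicator R)"
  have R [measurable]: "R \<in> sets M" unfolding R_def by (rule rect_sets[OF A])
  have [measurable]: "Z \<in> borel_measurable M" by (rule past_meas[OF Z(1)])
  have int: "integrable M (\<lambda>\<omega>. Z \<omega> * indicator R \<omega>)"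
  proof (rule M.integrable_const_bound[where B = b])
    have "norm (Z \<omega> * indicator R \<omega>) \<le> b" for \<omega>
      using Z(2)[of \<omega>] Z(3)[of \<omega>] by (cases "\<omega> \<in> R") simp_all
    then show "AE \<omega> in M. norm (Z \<omega> * indicator R \<omega>) \<le> b" by simp
  qed measurable
  have Rm: "indicator R \<in> borel_measurable M" by measurable
  note c = S.real_cond_exp_intg[OF int Z(1) Rm]
  have prod: "AE \<omega> in M. ?c \<omega> = (\<Prod>i<N. measure (walker_kernel n i \<omega>) (A i))"
    unfolding R_def by (rule cond_exp_rect[OF A])
  have pos: "0 \<le> (\<Prod>i<N. measure (walker_kernel n i \<omega>) (A i))" for \<omega>
    by (intro prod_nonneg) simp
  have cpos: "AE \<omega> in M. 0 \<le> Z \<omega> * ?c \<omega>"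
    using prod by eventually_elim (use Z(2) pos in simp)
  have "(\<integral>\<^sup>+\<omega>. ennreal (Z \<omega>) * indicator R \<omega> \<partial>M) = (\<integral>\<^sup>+\<omega>. ennreal (Z \<omega> * indicator R \<omega>) \<partial>M)"
    by (intro nn_integral_cong) (simp add: indicator_def)
  also have "\<dots> = ennreal (\<integral>\<omega>. Z \<omega> * indicator R \<omega> \<partial>M)"
    using Z(2) by (intro nn_integral_eq_integral int) simp
  also have "\<dots> = ennreal (\<integral>\<omega>. Z \<omega> * ?c \<omega> \<partial>M)"
    unfolding c(2) ..
  also have "\<dots> = (\<integral>\<^sup>+\<omega>. ennreal (Z \<omega> * ?c \<omega>) \<partial>M)"
    by (intro nn_integral_eq_integral[symmetric] c(1) cpos)
  also have "\<dots> = (\<integral>\<^sup>+\<omega>. ennreal (Z \<omega>) * ennreal (\<Prod>i<N. measure (walker_kernel n i \<omega>) (A i)) \<partial>M)"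
  proof (rule nn_integral_cong_AE)
    show "AE \<omega> in M. ennreal (Z \<omega> * ?c \<omega>) =
        ennreal (Z \<omega>) * ennreal (\<Prod>i<N. measure (walker_kernel n i \<omega>) (A i))"
      using prod by eventually_elim (use Z(2) pos in \<open>simp add: ennreal_mult\<close>)
  qed
  finally show ?thesis unfolding R_def .
qed

lemma measure_walker_UNIV: "i < N \<Longrightarrow> measure (walker_kernel n i \<omega>) UNIV = 1"
  using prob_space.prob_space[OF borel_probD(1)[OF walker_kernel_prob[of i n \<omega>]]]
    borel_probD(3)[OF walker_kernel_prob[of i n \<omega>]] by simp

lemma ennreal_measure_walker: "i < N \<Longrightarrow> ennreal (measure (walker_kernel n i \<omega>) A) = emeasure (walker_kernel n i \<omega>) A"
proof -
  assume "i < N"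
  then interpret prob_space "walker_kernel n i \<omega>" using borel_probD(1)[OF walker_kernel_prob] by blast
  show ?thesis by (simp add: emeasure_eq_measure)
qed

lemma prod_single:
  assumes "i < N"
  shows "(\<Prod>l<N. measure (walker_kernel n l \<omega>) (if l = i then A else UNIV)) = measure (walker_kernel n i \<omega>) A"
proof -
  have "(\<Prod>l<N. measure (walker_kernel n l \<omega>) (if l = i then A else UNIV)) =
     (\<Prod>l<N. if l = i then measure (walker_kernel n i \<omega>) A else 1)"
    using measure_walker_UNIV by (intro prod.cong) auto
  then show ?thesis using assms by (simp add: prod.delta)
qed

lemma prod_pair:
  assumes "i < N" "j < N" "i \<noteq> j"
  shows "(\<Prod>l<N. measure (walker_kernel n l \<omega>) (if l = i then A else if l = j then B else UNIV)) =
    measure (walker_kernel n i \<omega>) A * measure (walker_kernel n j \<omega>) B"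
proof -
  have "(\<Prod>l<N. measure (walker_kernel n l \<omega>) (if l = i then A else if l = j then B else UNIV)) =
     (\<Prod>l<N. (if l = i then measure (walker_kernel n i \<omega>) A else 1) *
        (if l = j then measure (walker_kernel n j \<omega>) B else 1))"
    using measure_walker_UNIV assms(3) by (intro prod.cong) auto
  then show ?thesis using assms unfolding prod.distrib by (simp add: prod.delta)
qed

text \<open>A rectangle that restricts a single coordinate isolates a single kernel, which is thus a
  conditional expectation almost everywhere.\<close>

lemma walker_kernel_meas:
  assumes i: "i < N" and A: "A \<in> sets borel"
  shows "(\<lambda>\<omega>. emeasure (walker_kernel n i \<omega>) A) \<in> borel_measurable (completion M)"
proof -
  interpret S: finite_measure_subalgebra M "past n"
    by unfold_locales (rule past_subalgebra)
  let ?A = "\<lambda>l. if l = i then A else UNIV"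
  have "AE \<omega> in M. real_cond_exp M (past n) (indicator {\<omega> \<in> space M. \<forall>l<N. \<xi> (Suc n) l \<omega> \<in> ?A l}) \<omega> =
     (\<Prod>l<N. measure (walker_kernel n l \<omega>) (?A l))"
    using A by (intro cond_exp_rect) auto
  then have "(\<lambda>\<omega>. measure (walker_kernel n i \<omega>) A) \<in> borel_measurable (completion M)"
    unfolding prod_single[OF i] by (intro measurable_completion_cong_AE[where N = borel]) auto
  then have "(\<lambda>\<omega>. ennreal (measure (walker_kernel n i \<omega>) A)) \<in> borel_measurable (completion M)" by simp
  then show ?thesis unfolding ennreal_measure_walker[OF i] .
qed

lemma nn_integral_walker_single:
  assumes i: "i < N" and Z: "Z \<in> borel_measurable (past n)" "\<And>\<omega>. 0 \<le> Z \<omega>" "\<And>\<omega>. Z \<omega> \<le> b"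
    and F: "F \<in> borel_measurable borel"
  shows "(\<lambda>\<omega>. \<integral>\<^sup>+x. F x \<partial>walker_kernel n i \<omega>) \<in> borel_measurable (completion M)"
    "(\<integral>\<^sup>+\<omega>. F (\<xi> (Suc n) i \<omega>) * ennreal (Z \<omega>) \<partial>M) =
      (\<integral>\<^sup>+\<omega>. (\<integral>\<^sup>+x. F x \<partial>walker_kernel n i \<omega>) * ennreal (Z \<omega>) \<partial>M)"
proof -
  have "(\<lambda>\<omega>. \<integral>\<^sup>+x. F x \<partial>walker_kernel n i \<omega>) \<in> borel_measurable (completion M) \<and>
    (\<integral>\<^sup>+\<omega>. F (\<xi> (Suc n) i \<omega>) * ennreal (Z \<omega>) \<partial>completion M) =
      (\<integral>\<^sup>+\<omega>. (\<integral>\<^sup>+x. F x \<partial>walker_kernel n i \<omega>) * ennreal (Z \<omega>) \<partial>completion M)"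
  proof (rule nn_integral_kernel_extend)
    show "\<xi> (Suc n) i \<in> completion M \<rightarrow>\<^sub>M borel" by (intro measurable_completion xi_meas i)
    show "(\<lambda>\<omega>. ennreal (Z \<omega>)) \<in> borel_measurable (completion M)"
      "(\<lambda>\<omega>. ennreal (Z \<omega>)) \<in> borel_measurable (completion M)"
      using measurable_completion[OF past_meas[OF Z(1)]] by simp_all
    fix A :: "'a set" assume A: "A \<in> sets borel"
    show "(\<lambda>\<omega>. emeasure (walker_kernel n i \<omega>) A) \<in> borel_measurable (completion M)"
      by (rule walker_kernel_meas[OF i A])
    let ?A = "\<lambda>l. if l = i then A else UNIV"
    have "(\<integral>\<^sup>+\<omega>. indicator A (\<xi> (Suc n) i \<omega>) * ennreal (Z \<omega>) \<partial>M) =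
      (\<integral>\<^sup>+\<omega>. ennreal (Z \<omega>) * indicator {\<omega> \<in> space M. \<forall>l<N. \<xi> (Suc n) l \<omega> \<in> ?A l} \<omega> \<partial>M)"
      using i by (intro nn_integral_cong) (auto simp: indicator_def)
    also have "\<dots> = (\<integral>\<^sup>+\<omega>. ennreal (Z \<omega>) * ennreal (\<Prod>l<N. measure (walker_kernel n l \<omega>) (?A l)) \<partial>M)"
      using A by (intro nn_integral_rect[OF _ Z]) auto
    also have "\<dots> = (\<integral>\<^sup>+\<omega>. emeasure (walker_kernel n i \<omega>) A * ennreal (Z \<omega>) \<partial>M)"
      unfolding prod_single[OF i] ennreal_measure_walker[OF i] by (simp add: mult.commute)
    finally show "(\<integral>\<^sup>+\<omega>. indicator A (\<xi> (Suc n) i \<omega>) * ennreal (Z \<omega>) \<partial>completion M) =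
      (\<integral>\<^sup>+\<omega>. emeasure (walker_kernel n i \<omega>) A * ennreal (Z \<omega>) \<partial>completion M)"
      unfolding nn_integral_completion .
  qed (use walker_kernel_prob[OF i] F in auto)
  then show "(\<lambda>\<omega>. \<integral>\<^sup>+x. F x \<partial>walker_kernel n i \<omega>) \<in> borel_measurable (completion M)"
    "(\<integral>\<^sup>+\<omega>. F (\<xi> (Suc n) i \<omega>) * ennreal (Z \<omega>) \<partial>M) =
      (\<integral>\<^sup>+\<omega>. (\<integral>\<^sup>+x. F x \<partial>walker_kernel n i \<omega>) * ennreal (Z \<omega>) \<partial>M)"
    unfolding nn_integral_completion by auto
qed

lemma nn_integral_walker_1:
  assumes i: "i < N" and F: "F \<in> borel_measurable borel"
  shows "(\<lambda>\<omega>. \<integral>\<^sup>+x. F x \<partial>walker_kernel n i \<omega>) \<in> borel_measurable (completion M)"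
    "(\<integral>\<^sup>+\<omega>. F (\<xi> (Suc n) i \<omega>) \<partial>M) = (\<integral>\<^sup>+\<omega>. (\<integral>\<^sup>+x. F x \<partial>walker_kernel n i \<omega>) \<partial>M)"
  using nn_integral_walker_single[OF i _ _ _ F, of "\<lambda>_. 1" n 1] by auto

text \<open>Conditional independence of two walkers, extended from rectangles to functions one
  coordinate at a time: \<open>half\<close> has a function at walker \<open>i\<close> and an
  indicator at \<open>j\<close>, and is the hypothesis on sets for the extension at
  \<open>j\<close>.\<close>

lemma nn_integral_walker_pair:
  assumes i: "i < N" and j: "j < N" and ij: "i \<noteq> j"
    and F: "F \<in> borel_measurable borel" and F': "F' \<in> borel_measurable borel"
  shows "(\<integral>\<^sup>+\<omega>. F (\<xi> (Suc n) i \<omega>) * F' (\<xi> (Suc n) j \<omega>) \<partial>M) =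
      (\<integral>\<^sup>+\<omega>. (\<integral>\<^sup>+x. F x \<partial>walker_kernel n i \<omega>) * (\<integral>\<^sup>+x. F' x \<partial>walker_kernel n j \<omega>) \<partial>M)"
proof -
  let ?C = "completion M"
  have x: "\<xi> (Suc n) l \<in> ?C \<rightarrow>\<^sub>M borel" if "l < N" for l by (intro measurable_completion xi_meas that)
  have half: "(\<integral>\<^sup>+\<omega>. F (\<xi> (Suc n) i \<omega>) * indicator B (\<xi> (Suc n) j \<omega>) \<partial>?C) =
      (\<integral>\<^sup>+\<omega>. (\<integral>\<^sup>+x. F x \<partial>walker_kernel n i \<omega>) * emeasure (walker_kernel n j \<omega>) B \<partial>?C)"
    if B: "B \<in> sets borel" for B
  proof (rule nn_integral_kernel_extend[THEN conjunct2])
    show "(\<lambda>\<omega>. indicator B (\<xi> (Suc n) j \<omega>)) \<in> borel_measurable ?C"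
      using x[OF j] B by (intro measurable_compose[OF _ borel_measurable_indicator])
    fix A :: "'a set" assume A: "A \<in> sets borel"
    let ?A = "\<lambda>l. if l = i then A else if l = j then B else UNIV"
    have "(\<integral>\<^sup>+\<omega>. indicator A (\<xi> (Suc n) i \<omega>) * indicator B (\<xi> (Suc n) j \<omega>) \<partial>M) =
      (\<integral>\<^sup>+\<omega>. ennreal 1 * indicator {\<omega> \<in> space M. \<forall>l<N. \<xi> (Suc n) l \<omega> \<in> ?A l} \<omega> \<partial>M)"
      using i j ij by (intro nn_integral_cong) (auto simp: indicator_def)
    also have "\<dots> = (\<integral>\<^sup>+\<omega>. ennreal 1 * ennreal (\<Prod>l<N. measure (walker_kernel n l \<omega>) (?A l)) \<partial>M)"
      using A B by (intro nn_integral_rect[where b = 1]) auto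
    also have "\<dots> = (\<integral>\<^sup>+\<omega>. emeasure (walker_kernel n i \<omega>) A * emeasure (walker_kernel n j \<omega>) B \<partial>M)"
      unfolding prod_pair[OF i j ij] ennreal_measure_walker[OF i, symmetric]
        ennreal_measure_walker[OF j, symmetric] by (simp add: ennreal_mult)
    finally show "(\<integral>\<^sup>+\<omega>. indicator A (\<xi> (Suc n) i \<omega>) * indicator B (\<xi> (Suc n) j \<omega>) \<partial>?C) =
       (\<integral>\<^sup>+\<omega>. emeasure (walker_kernel n i \<omega>) A * emeasure (walker_kernel n j \<omega>) B \<partial>?C)"
      unfolding nn_integral_completion .
  qed (use walker_kernel_prob[OF i] walker_kernel_meas[OF i] walker_kernel_meas[OF j B] x[OF i] F in auto)
  have "(\<integral>\<^sup>+\<omega>. F' (\<xi> (Suc n) j \<omega>) * F (\<xi> (Suc n) i \<omega>) \<partial>?C) =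
      (\<integral>\<^sup>+\<omega>. (\<integral>\<^sup>+x. F' x \<partial>walker_kernel n j \<omega>) * (\<integral>\<^sup>+x. F x \<partial>walker_kernel n i \<omega>) \<partial>?C)"
  proof (rule nn_integral_kernel_extend[THEN conjunct2])
    show "(\<lambda>\<omega>. F (\<xi> (Suc n) i \<omega>)) \<in> borel_measurable ?C"
      by (rule measurable_compose[OF x[OF i] F])
    show "(\<lambda>\<omega>. \<integral>\<^sup>+x. F x \<partial>walker_kernel n i \<omega>) \<in> borel_measurable ?C"
      by (rule nn_integral_walker_1(1)[OF i F])
    show "(\<integral>\<^sup>+\<omega>. indicator B (\<xi> (Suc n) j \<omega>) * F (\<xi> (Suc n) i \<omega>) \<partial>?C) =
      (\<integral>\<^sup>+\<omega>. emeasure (walker_kernel n j \<omega>) B * (\<integral>\<^sup>+x. F x \<partial>walker_kernel n i \<omega>) \<partial>?C)"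
      if "B \<in> sets borel" for B using half[OF that] by (simp add: mult.commute)
  qed (use walker_kernel_prob[OF j] walker_kernel_meas[OF j] x[OF j] F' in auto)
  then show ?thesis unfolding nn_integral_completion by (simp add: mult.commute)
qed

text \<open>Summing over the walkers removes \<epsilon>, so in the mean the occupation measure
  evolves by \<open>step\<close>. The integrals of single kernels are taken over the
  completion.\<close>

lemma nn_integral_emp_Suc:
  assumes F: "F \<in> borel_measurable borel"
  shows "(\<integral>\<^sup>+\<omega>. (\<integral>\<^sup>+x. F x \<partial>emp (Suc n) \<omega>) \<partial>M) = (\<integral>\<^sup>+\<omega>. (\<integral>\<^sup>+x. F x \<partial>step n (emp n \<omega>)) \<partial>M)"
proof -
  have [measurable]: "i < N \<Longrightarrow> (\<lambda>\<omega>. F (\<xi> (Suc n) i \<omega>)) \<in> borel_measurable M" for i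
    by (rule measurable_compose[OF xi_meas F])
  note K = nn_integral_walker_1[OF _ F]
  have "(\<integral>\<^sup>+\<omega>. (\<integral>\<^sup>+x. F x \<partial>emp (Suc n) \<omega>) \<partial>M) = (\<integral>\<^sup>+\<omega>. (\<Sum>i<N. ennreal (1 / N) * F (\<xi> (Suc n) i \<omega>)) \<partial>M)"
    unfolding nn_integral_empirical[OF F] ..
  also have "\<dots> = (\<Sum>i<N. ennreal (1 / N) * (\<integral>\<^sup>+\<omega>. F (\<xi> (Suc n) i \<omega>) \<partial>M))"
    by (subst nn_integral_sum) (auto simp: nn_integral_cmult)
  also have "\<dots> = (\<Sum>i<N. ennreal (1 / N) * (\<integral>\<^sup>+\<omega>. (\<integral>\<^sup>+x. F x \<partial>walker_kernel n i \<omega>) \<partial>completion M))"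
    using K(2) by (intro sum.cong refl) (simp add: nn_integral_completion)
  also have "\<dots> = ennreal (1 / N) * (\<integral>\<^sup>+\<omega>. (\<Sum>i<N. \<integral>\<^sup>+x. F x \<partial>walker_kernel n i \<omega>) \<partial>completion M)"
    using K(1) by (subst nn_integral_sum) (auto simp: sum_distrib_left)
  also have "\<dots> = (\<integral>\<^sup>+\<omega>. ennreal (1 / N) * (\<Sum>i<N. \<integral>\<^sup>+x. F x \<partial>walker_kernel n i \<omega>) \<partial>completion M)"
    using K(1) by (intro nn_integral_cmult[symmetric]) auto
  also have "\<dots> = (\<integral>\<^sup>+\<omega>. (\<integral>\<^sup>+x. F x \<partial>step n (emp n \<omega>)) \<partial>completion M)"
    unfolding sum_walker_kernel[OF F] using N
    by (intro nn_integral_cong)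
      (simp add: mult.assoc[symmetric] ennreal_of_nat_eq_real_of_nat ennreal_mult[symmetric])
  finally show ?thesis unfolding nn_integral_completion .
qed

end

lemma nn_integral_sum_square:
  fixes a :: "nat \<Rightarrow> 'a \<Rightarrow> ennreal"
  assumes a: "\<And>i. i < n \<Longrightarrow> a i \<in> borel_measurable M"
  shows "(\<integral>\<^sup>+\<omega>. (\<Sum>i<n. a i \<omega> * a i \<omega>) + (\<Sum>i<n. \<Sum>j\<in>{..<n} - {i}. a i \<omega> * a j \<omega>) \<partial>M) =
    (\<Sum>i<n. \<integral>\<^sup>+\<omega>. a i \<omega> * a i \<omega> \<partial>M) + (\<Sum>i<n. \<Sum>j\<in>{..<n} - {i}. \<integral>\<^sup>+\<omega>. a i \<omega> * a j \<omega> \<partial>M)"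
proof -
  have m: "(\<lambda>\<omega>. a i \<omega> * a j \<omega>) \<in> borel_measurable M" if "i < n" "j < n" for i j
    using a[OF that(1)] a[OF that(2)] by simp
  have ms: "(\<lambda>\<omega>. \<Sum>j\<in>{..<n} - {i}. a i \<omega> * a j \<omega>) \<in> borel_measurable M" if "i < n" for i
    using that by (intro borel_measurable_sum m) auto
  have "(\<integral>\<^sup>+\<omega>. (\<Sum>i<n. a i \<omega> * a i \<omega>) + (\<Sum>i<n. \<Sum>j\<in>{..<n} - {i}. a i \<omega> * a j \<omega>) \<partial>M) =
      (\<integral>\<^sup>+\<omega>. (\<Sum>i<n. a i \<omega> * a i \<omega>) \<partial>M) + (\<integral>\<^sup>+\<omega>. (\<Sum>i<n. \<Sum>j\<in>{..<n} - {i}. a i \<omega> * a j \<omega>) \<partial>M)"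
    by (intro nn_integral_add borel_measurable_sum m ms) auto
  also have "(\<integral>\<^sup>+\<omega>. (\<Sum>i<n. a i \<omega> * a i \<omega>) \<partial>M) = (\<Sum>i<n. \<integral>\<^sup>+\<omega>. a i \<omega> * a i \<omega> \<partial>M)"
    by (intro nn_integral_sum m) auto
  also have "(\<integral>\<^sup>+\<omega>. (\<Sum>i<n. \<Sum>j\<in>{..<n} - {i}. a i \<omega> * a j \<omega>) \<partial>M) =
      (\<Sum>i<n. \<integral>\<^sup>+\<omega>. (\<Sum>j\<in>{..<n} - {i}. a i \<omega> * a j \<omega>) \<partial>M)"
    by (intro nn_integral_sum ms) auto
  also have "\<dots> = (\<Sum>i<n. \<Sum>j\<in>{..<n} - {i}. \<integral>\<^sup>+\<omega>. a i \<omega> * a j \<omega> \<partial>M)"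
    by (intro sum.cong refl nn_integral_sum m) auto
  finally show ?thesis .
qed

text \<open>
  The hypotheses hold with equality when the \<open>x i\<close> are conditionally independent given a
  \<open>\<sigma>\<close>-algebra and \<open>s\<close> is the average of their conditional means.
\<close>

lemma (in prob_space) mean_deviation_of_pairs:
  fixes x :: "nat \<Rightarrow> 'a \<Rightarrow> real" and s :: "'a \<Rightarrow> real"
  assumes x: "\<And>i. i < n \<Longrightarrow> x i \<in> borel_measurable M" "\<And>i \<omega>. 0 \<le> x i \<omega>" "\<And>i \<omega>. x i \<omega> \<le> b"
    and s: "s \<in> borel_measurable M" "\<And>\<omega>. 0 \<le> s \<omega>" "\<And>\<omega>. s \<omega> \<le> b"
    and n: "1 \<le> n" and q: "0 \<le> q"
    and cross: "(\<Sum>i<n. \<integral>\<^sup>+\<omega>. ennreal (x i \<omega>) * ennreal (s \<omega>) \<partial>M) = (\<integral>\<^sup>+\<omega>. ennreal (n * (s \<omega> * s \<omega>)) \<partial>M)"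
    and diag: "(\<Sum>i<n. \<integral>\<^sup>+\<omega>. ennreal (x i \<omega>) * ennreal (x i \<omega>) \<partial>M) \<le> ennreal (n * q)"
    and off_diag: "(\<Sum>i<n. \<Sum>j\<in>{..<n} - {i}. \<integral>\<^sup>+\<omega>. ennreal (x i \<omega>) * ennreal (x j \<omega>) \<partial>M) \<le>
      (\<integral>\<^sup>+\<omega>. ennreal ((real n)\<^sup>2 * (s \<omega> * s \<omega>)) \<partial>M)"
  shows "(\<integral>\<omega>. \<bar>(\<Sum>i<n. x i \<omega>) / real n - s \<omega>\<bar> \<partial>M) \<le> sqrt (q / real n)"
proof -
  define S where "S \<omega> = (\<Sum>i<n. x i \<omega>)" for \<omega>
  have b: "0 \<le> b" using order_trans[OF s(2,3)] .
  have Sm: "S \<in> borel_measurable M" unfolding S_def using x(1) by (intro borel_measurable_sum) auto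
  have sum_x: "(\<Sum>i<n. ennreal (x i \<omega>)) = ennreal (S \<omega>)" for \<omega>
    unfolding S_def using x(2) by (intro sum_ennreal) auto
  have S0: "0 \<le> S \<omega>" "S \<omega> \<le> n * b" for \<omega>
  proof -
    show "0 \<le> S \<omega>" unfolding S_def using x(2) by (intro sum_nonneg) auto
    have "S \<omega> \<le> (\<Sum>i<n. b)" unfolding S_def using x(3) by (intro sum_mono) auto
    then show "S \<omega> \<le> n * b" by simp
  qed
  have b_le: "b \<le> n * b" using n b by (simp add: mult_le_cancel_right1)
  have snb: "s \<omega> \<le> n * b" for \<omega> using s(3)[of \<omega>] b_le by linarith
  have int: "integrable M (\<lambda>\<omega>. f \<omega> * g \<omega>)"
    if [measurable]: "f \<in> borel_measurable M" "g \<in> borel_measurable M"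
      and "\<And>\<omega>. 0 \<le> f \<omega>" "\<And>\<omega>. f \<omega> \<le> n * b" "\<And>\<omega>. 0 \<le> g \<omega>" "\<And>\<omega>. g \<omega> \<le> n * b" for f g :: "'a \<Rightarrow> real"
  proof (rule integrable_const_bound[where B = "(n * b) * (n * b)"])
    show "AE \<omega> in M. norm (f \<omega> * g \<omega>) \<le> (n * b) * (n * b)"
      using that by (intro AE_I2) (simp add: abs_mult mult_mono')
  qed measurable
  note iSS = int[OF Sm Sm S0 S0] and iSs = int[OF Sm s(1) S0 s(2) snb]
    and iss = int[OF s(1) s(1) s(2) snb s(2) snb]
  have nn: "0 \<le> (\<integral>\<omega>. s \<omega> * s \<omega> \<partial>M)" using s(2) by (intro Bochner_Integration.integral_nonneg) simp
  have "ennreal (\<integral>\<omega>. S \<omega> * s \<omega> \<partial>M) = (\<integral>\<^sup>+\<omega>. ennreal (S \<omega> * s \<omega>) \<partial>M)"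
    using S0 s(2) by (intro nn_integral_eq_integral[symmetric] iSs) auto
  also have "\<dots> = (\<integral>\<^sup>+\<omega>. (\<Sum>i<n. ennreal (x i \<omega>) * ennreal (s \<omega>)) \<partial>M)"
    using S0 s(2) by (intro nn_integral_cong) (simp add: ennreal_mult sum_x[symmetric] sum_distrib_right)
  also have "\<dots> = (\<Sum>i<n. \<integral>\<^sup>+\<omega>. ennreal (x i \<omega>) * ennreal (s \<omega>) \<partial>M)"
    using x(1) s(1) by (intro nn_integral_sum) auto
  also have "\<dots> = ennreal (\<integral>\<omega>. n * (s \<omega> * s \<omega>) \<partial>M)"
    unfolding cross using iss s(2) by (intro nn_integral_eq_integral) auto
  finally have Ss: "(\<integral>\<omega>. S \<omega> * s \<omega> \<partial>M) = n * (\<integral>\<omega>. s \<omega> * s \<omega> \<partial>M)"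
    using nn S0 s(2) by (subst (asm) ennreal_inj) (auto intro!: Bochner_Integration.integral_nonneg)
  have "ennreal (\<integral>\<omega>. S \<omega> * S \<omega> \<partial>M) = (\<integral>\<^sup>+\<omega>. ennreal (S \<omega> * S \<omega>) \<partial>M)"
    using S0 by (intro nn_integral_eq_integral[symmetric] iSS) auto
  also have "\<dots> = (\<integral>\<^sup>+\<omega>. (\<Sum>i<n. ennreal (x i \<omega>) * ennreal (x i \<omega>)) +
      (\<Sum>i<n. \<Sum>j\<in>{..<n} - {i}. ennreal (x i \<omega>) * ennreal (x j \<omega>)) \<partial>M)"
    using S0 by (intro nn_integral_cong) (simp add: ennreal_mult sum_x[symmetric] sum_square_split)
  also have "\<dots> = (\<Sum>i<n. \<integral>\<^sup>+\<omega>. ennreal (x i \<omega>) * ennreal (x i \<omega>) \<partial>M) +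
      (\<Sum>i<n. \<Sum>j\<in>{..<n} - {i}. \<integral>\<^sup>+\<omega>. ennreal (x i \<omega>) * ennreal (x j \<omega>) \<partial>M)"
    using x(1) by (intro nn_integral_sum_square) auto
  also have "\<dots> \<le> ennreal (n * q) + (\<integral>\<^sup>+\<omega>. ennreal ((real n)\<^sup>2 * (s \<omega> * s \<omega>)) \<partial>M)"
    by (rule add_mono[OF diag off_diag])
  also have "(\<integral>\<^sup>+\<omega>. ennreal ((real n)\<^sup>2 * (s \<omega> * s \<omega>)) \<partial>M) = ennreal (\<integral>\<omega>. (real n)\<^sup>2 * (s \<omega> * s \<omega>) \<partial>M)"
    using iss s(2) by (intro nn_integral_eq_integral) auto
  also have "ennreal (n * q) + \<dots> = ennreal (n * q + (real n)\<^sup>2 * (\<integral>\<omega>. s \<omega> * s \<omega> \<partial>M))"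
    using q nn by (simp add: ennreal_plus[symmetric] del: ennreal_plus)
  finally have SS: "(\<integral>\<omega>. S \<omega> * S \<omega> \<partial>M) \<le> n * q + (real n)\<^sup>2 * (\<integral>\<omega>. s \<omega> * s \<omega> \<partial>M)"
    using q nn by (subst (asm) ennreal_le_iff) auto
  show ?thesis
    using SS Ss S0 s(2) snb unfolding S_def[symmetric]
    by (intro mean_deviation_bound[where b = "n * b"] n Sm s(1))
       (auto simp: power2_eq_square abs_of_nonneg)
qed

text \<open>Makes \<open>integral_step\<close> available for bounded functions.\<close>

lemma (in fk_model) tame_weight_1: "tame_weight P G (\<lambda>_. 1)"
proof
  fix n :: nat assume "1 \<le> n"
  then have "integrable (P n x) (\<lambda>_. 1 :: real) \<and> (\<integral>y. 1 \<partial>P n x) \<le> 1 * (1 :: real)" for x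
    using borel_probD(1)[OF kernel_prob[of n x]] prob_space.prob_space[of "P n x"]
    by (auto simp: prob_space_def finite_measure.integrable_const)
  then show "\<exists>b\<ge>0. \<forall>x. integrable (P n x) (\<lambda>_. 1 :: real) \<and> (\<integral>y. 1 \<partial>P n x) \<le> b * (1 :: real)"
    by (intro exI[of _ "1 :: real"]) simp
qed auto

section \<open>One-step errors and moments of the occupation measures\<close>

context dmc
begin

lemma step_emp_past_meas:
  fixes f :: "'a \<Rightarrow> real"
  assumes U: "tame_weight P G U" and f: "dominated U f"
  shows "(\<lambda>\<omega>. \<integral>x. f x \<partial>step n (emp n \<omega>)) \<in> borel_measurable (past n)"
proof -
  interpret U: tame_weight P G U by (rule U)
  have Qm: "Q_op P G (Suc n) f \<in> borel_measurable borel"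
    by (rule dominated_measurable[OF U.dominated_Q_op[OF _ f]]) simp
  have e: "(\<integral>x. f x \<partial>step n (emp n \<omega>)) =
     ((\<Sum>i<N. Q_op P G (Suc n) f (\<xi> n i \<omega>)) / N) / ((\<Sum>i<N. G n (\<xi> n i \<omega>)) / N)" for \<omega>
    unfolding U.integral_step[OF emp_prob integrable_emp[OF U.U_meas] f]
      integral_emp[OF Qm] integral_emp[OF G_meas] ..
  have "i < N \<Longrightarrow> (\<lambda>\<omega>. Q_op P G (Suc n) f (\<xi> n i \<omega>)) \<in> borel_measurable (past n)"
    "i < N \<Longrightarrow> (\<lambda>\<omega>. G n (\<xi> n i \<omega>)) \<in> borel_measurable (past n)" for i
    by (rule measurable_compose[OF xi_past_meas Qm] measurable_compose[OF xi_past_meas G_meas]; assumption)+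
  then show ?thesis unfolding e
    by (intro borel_measurable_divide borel_measurable_sum borel_measurable_const) auto
qed

lemma nn_integral_emp:
  "f \<in> borel_measurable borel \<Longrightarrow> (\<integral>\<^sup>+x. f x \<partial>emp n \<omega>) = (\<Sum>i<N. ennreal (1 / N) * f (\<xi> n i \<omega>))"
  by (rule nn_integral_empirical)

lemma emp_meas:
  fixes f :: "'a \<Rightarrow> real"
  assumes "f \<in> borel_measurable borel"
  shows "(\<lambda>\<omega>. \<integral>x. f x \<partial>emp n \<omega>) \<in> borel_measurable M"
  unfolding integral_emp[OF assms]
  using measurable_compose[OF xi_meas assms]
  by (intro borel_measurable_divide borel_measurable_sum borel_measurable_const) auto

lemma integral_step_bounded:
  fixes F :: "'a \<Rightarrow> real"
  assumes \<mu>: "borel_prob \<mu>" and F: "F \<in> borel_measurable borel" "\<And>x. 0 \<le> F x" "\<And>x. F x \<le> b"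
  shows "(\<integral>\<^sup>+x. ennreal (F x) \<partial>\<mu>) = ennreal (\<integral>x. F x \<partial>\<mu>)" "0 \<le> (\<integral>x. F x \<partial>\<mu>)" "(\<integral>x. F x \<partial>\<mu>) \<le> b"
proof -
  interpret prob_space \<mu> using borel_probD[OF \<mu>] by simp
  have int: "integrable \<mu> F"
    using F(2,3) borel_measurable_sets_eq[OF borel_probD(2)[OF \<mu>] F(1)]
    by (intro integrable_const_bound[where B = b]) auto
  show "(\<integral>\<^sup>+x. ennreal (F x) \<partial>\<mu>) = ennreal (\<integral>x. F x \<partial>\<mu>)"
    using F(2) by (intro nn_integral_eq_integral int) auto
  show "0 \<le> (\<integral>x. F x \<partial>\<mu>)" using F(2) by (intro Bochner_Integration.integral_nonneg)
  have "(\<integral>x. F x \<partial>\<mu>) \<le> (\<integral>x. b \<partial>\<mu>)" using F(3) by (intro integral_mono int) auto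
  then show "(\<integral>x. F x \<partial>\<mu>) \<le> b" by (simp add: prob_space)
qed

text \<open>The bound \<open>b\<close> only makes the integrals finite and is absent from the
  conclusion; the rate comes from the second moment \<open>q\<close>, for which \<open>Vbar\<close>
  is used later.\<close>

lemma local_error:
  fixes F :: "'a \<Rightarrow> real"
  assumes F: "F \<in> borel_measurable borel" "\<And>x. 0 \<le> F x" "\<And>x. F x \<le> b"
    and q: "0 \<le> q" "(\<integral>\<^sup>+\<omega>. (\<integral>\<^sup>+x. ennreal ((F x)\<^sup>2) \<partial>step n (emp n \<omega>)) \<partial>M) \<le> ennreal q"
  shows "(\<integral>\<omega>. \<bar>(\<integral>x. F x \<partial>emp (Suc n) \<omega>) - (\<integral>x. F x \<partial>step n (emp n \<omega>))\<bar> \<partial>M) \<le> sqrt (q / real N)"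
proof -
  let ?C = "completion M"
  define s where "s \<omega> = (\<integral>x. F x \<partial>step n (emp n \<omega>))" for \<omega>
  define k where "k i \<omega> = (\<integral>\<^sup>+x. ennreal (F x) \<partial>walker_kernel n i \<omega>)" for i \<omega>
  define k2 where "k2 i \<omega> = (\<integral>\<^sup>+x. ennreal (F x) * ennreal (F x) \<partial>walker_kernel n i \<omega>)" for i \<omega>
  have eF: "(\<lambda>x. ennreal (F x)) \<in> borel_measurable borel"
    "(\<lambda>x. ennreal (F x) * ennreal (F x)) \<in> borel_measurable borel" using F(1) by simp_all
  have dF: "dominated (\<lambda>_. 1) F" "dominated (\<lambda>_. 1) (\<lambda>x. (F x)\<^sup>2)"
    using F(2,3) dominatedI[of F b "\<lambda>_. 1"] dominatedI[of "\<lambda>x. (F x)\<^sup>2" "b\<^sup>2" "\<lambda>_. 1"]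
      borel_measurable_power[OF F(1)] by (auto simp: F(1) power_mono)
  have s_past: "s \<in> borel_measurable (past n)"
    unfolding s_def by (rule step_emp_past_meas[OF tame_weight_1 dF(1)])
  have sm: "s \<in> borel_measurable M" by (rule past_meas[OF s_past])
  have s: "(\<integral>\<^sup>+x. ennreal (F x) \<partial>step n (emp n \<omega>)) = ennreal (s \<omega>)" "0 \<le> s \<omega>" "s \<omega> \<le> b" for \<omega>
    unfolding s_def by (rule integral_step_bounded[OF step_prob[OF emp_prob] F])+
  have Fx: "(\<lambda>\<omega>. F (\<xi> (Suc n) i \<omega>)) \<in> borel_measurable M" if "i < N" for i
    by (rule measurable_compose[OF xi_meas[OF that] F(1)])
  have km: "k i \<in> borel_measurable ?C" "k2 i \<in> borel_measurable ?C" if "i < N" for i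
    unfolding k_def k2_def by (rule nn_integral_walker_1(1)[OF that eF(1)] nn_integral_walker_1(1)[OF that eF(2)])+
  have sum_k: "(\<Sum>i<N. k i \<omega>) = of_nat N * ennreal (s \<omega>)" for \<omega>
    unfolding k_def sum_walker_kernel[OF eF(1)] s(1) ..
  have N2: "of_nat N * ennreal x = ennreal (N * x)" if "0 \<le> x" for x :: real
    using that by (simp add: ennreal_of_nat_eq_real_of_nat ennreal_mult)
  have "(\<integral>\<omega>. \<bar>(\<Sum>i<N. F (\<xi> (Suc n) i \<omega>)) / real N - s \<omega>\<bar> \<partial>M) \<le> sqrt (q / real N)"
  proof (rule M.mean_deviation_of_pairs[OF Fx F(2,3) sm s(2,3) N q(1)])
    have "(\<Sum>i<N. \<integral>\<^sup>+\<omega>. ennreal (F (\<xi> (Suc n) i \<omega>)) * ennreal (s \<omega>) \<partial>M) =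
        (\<Sum>i<N. \<integral>\<^sup>+\<omega>. k i \<omega> * ennreal (s \<omega>) \<partial>?C)"
      unfolding k_def nn_integral_completion
      by (intro sum.cong refl nn_integral_walker_single(2)[OF _ s_past s(2,3) eF(1)]) auto
    also have "\<dots> = (\<integral>\<^sup>+\<omega>. (\<Sum>i<N. k i \<omega> * ennreal (s \<omega>)) \<partial>?C)"
      using km measurable_completion[OF sm] by (intro nn_integral_sum[symmetric]) auto
    also have "\<dots> = (\<integral>\<^sup>+\<omega>. ennreal (N * (s \<omega> * s \<omega>)) \<partial>M)"
      unfolding nn_integral_completion sum_distrib_right[symmetric] sum_k using s(2)
      by (intro nn_integral_cong) (simp add: ennreal_mult[symmetric] mult.assoc N2)
    finally show "(\<Sum>i<N. \<integral>\<^sup>+\<omega>. ennreal (F (\<xi> (Suc n) i \<omega>)) * ennreal (s \<omega>) \<partial>M) =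
        (\<integral>\<^sup>+\<omega>. ennreal (N * (s \<omega> * s \<omega>)) \<partial>M)" .
    have e: "(\<integral>\<^sup>+x. ennreal ((F x)\<^sup>2) \<partial>step n (emp n \<omega>)) = ennreal (\<integral>x. (F x)\<^sup>2 \<partial>step n (emp n \<omega>))" for \<omega>
      using F by (intro integral_step_bounded(1)[where b = "b\<^sup>2"] step_prob emp_prob) (auto simp: power_mono)
    have m: "(\<lambda>\<omega>. \<integral>\<^sup>+x. ennreal ((F x)\<^sup>2) \<partial>step n (emp n \<omega>)) \<in> borel_measurable M"
      unfolding e using past_meas[OF step_emp_past_meas[OF tame_weight_1 dF(2), of n]] by simp
    have "(\<Sum>i<N. \<integral>\<^sup>+\<omega>. ennreal (F (\<xi> (Suc n) i \<omega>)) * ennreal (F (\<xi> (Suc n) i \<omega>)) \<partial>M) =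
        (\<Sum>i<N. \<integral>\<^sup>+\<omega>. k2 i \<omega> \<partial>?C)"
      unfolding k2_def nn_integral_completion
      by (intro sum.cong refl nn_integral_walker_1(2)[OF _ eF(2)]) auto
    also have "\<dots> = (\<integral>\<^sup>+\<omega>. (\<Sum>i<N. k2 i \<omega>) \<partial>?C)"
      using km by (intro nn_integral_sum[symmetric]) auto
    also have "\<dots> = (\<integral>\<^sup>+\<omega>. of_nat N * (\<integral>\<^sup>+x. ennreal ((F x)\<^sup>2) \<partial>step n (emp n \<omega>)) \<partial>M)"
      unfolding k2_def sum_walker_kernel[OF eF(2)] nn_integral_completion
      using F(2) by (simp add: power2_eq_square ennreal_mult)
    also have "\<dots> \<le> of_nat N * ennreal q"
      unfolding nn_integral_cmult[OF m] by (rule mult_left_mono[OF q(2)]) simp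
    finally show "(\<Sum>i<N. \<integral>\<^sup>+\<omega>. ennreal (F (\<xi> (Suc n) i \<omega>)) * ennreal (F (\<xi> (Suc n) i \<omega>)) \<partial>M) \<le> ennreal (N * q)"
      unfolding N2[OF q(1)] .
    have "(\<Sum>i<N. \<Sum>j\<in>{..<N} - {i}. \<integral>\<^sup>+\<omega>. ennreal (F (\<xi> (Suc n) i \<omega>)) * ennreal (F (\<xi> (Suc n) j \<omega>)) \<partial>M) =
        (\<Sum>i<N. \<Sum>j\<in>{..<N} - {i}. \<integral>\<^sup>+\<omega>. k i \<omega> * k j \<omega> \<partial>?C)"
      unfolding k_def nn_integral_completion
      by (intro sum.cong refl nn_integral_walker_pair[OF _ _ _ eF(1) eF(1)]) auto
    \<comment> \<open>The conditional means differ between walkers. Adding the nonnegative diagonal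
      completes the square of their sum, which is \<open>N * s\<close> and free of
      \<epsilon>.\<close>
    also have "\<dots> \<le> (\<Sum>i<N. \<integral>\<^sup>+\<omega>. k i \<omega> * k i \<omega> \<partial>?C) + \<dots>" by simp
    also have "\<dots> = (\<integral>\<^sup>+\<omega>. (\<Sum>i<N. k i \<omega>) * (\<Sum>i<N. k i \<omega>) \<partial>?C)"
      unfolding sum_square_split by (rule nn_integral_sum_square[OF km(1), symmetric])
    also have "\<dots> = (\<integral>\<^sup>+\<omega>. ennreal ((real N)\<^sup>2 * (s \<omega> * s \<omega>)) \<partial>M)"
      unfolding nn_integral_completion sum_k using s(2)
      by (intro nn_integral_cong) (simp add: N2 ennreal_mult[symmetric] power2_eq_square mult_ac)
    finally show "(\<Sum>i<N. \<Sum>j\<in>{..<N} - {i}. \<integral>\<^sup>+\<omega>. ennreal (F (\<xi> (Suc n) i \<omega>)) * ennreal (F (\<xi> (Suc n) j \<omega>)) \<partial>M) \<le>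
        (\<integral>\<^sup>+\<omega>. ennreal ((real N)\<^sup>2 * (s \<omega> * s \<omega>)) \<partial>M)" .
  qed
  then show ?thesis unfolding integral_emp[OF F(1)] s_def .
qed

lemma distr_initial: "i < N \<Longrightarrow> distr M borel (\<xi> 0 i) = \<eta>0"
  using walkers by (simp add: dmc_walkers_def)

lemma nn_integral_initial:
  assumes "i < N" "f \<in> borel_measurable borel"
  shows "(\<integral>\<^sup>+\<omega>. f (\<xi> 0 i \<omega>) \<partial>M) = (\<integral>\<^sup>+x. f x \<partial>\<eta>0)"
proof -
  have "(\<integral>\<^sup>+x. f x \<partial>distr M borel (\<xi> 0 i)) = (\<integral>\<^sup>+\<omega>. f (\<xi> 0 i \<omega>) \<partial>M)"
    by (rule nn_integral_distr[OF xi_meas[OF assms(1)]]) (simp add: assms(2))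
  then show ?thesis unfolding distr_initial[OF assms(1)] ..
qed

text \<open>The conditional mean is now the constant \<open>m\<close>, and independence of the
  initial walkers takes the place of the conditional law.\<close>

lemma initial_error:
  fixes F :: "'a \<Rightarrow> real"
  assumes \<eta>0: "borel_prob \<eta>0"
    and F: "F \<in> borel_measurable borel" "\<And>x. 0 \<le> F x" "\<And>x. F x \<le> b"
    and q: "0 \<le> q" "(\<integral>\<^sup>+x. ennreal ((F x)\<^sup>2) \<partial>\<eta>0) \<le> ennreal q"
  shows "(\<integral>\<omega>. \<bar>(\<integral>x. F x \<partial>emp 0 \<omega>) - (\<integral>x. F x \<partial>\<eta>0)\<bar> \<partial>M) \<le> sqrt (q / real N)"
proof -
  define m where "m = (\<integral>x. F x \<partial>\<eta>0)"
  have m: "(\<integral>\<^sup>+x. ennreal (F x) \<partial>\<eta>0) = ennreal m" "0 \<le> m" "m \<le> b"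
    unfolding m_def by (rule integral_step_bounded[OF \<eta>0 F])+
  have eF: "(\<lambda>x. ennreal (F x)) \<in> borel_measurable borel"
    "(\<lambda>x. ennreal (F x) * ennreal (F x)) \<in> borel_measurable borel" using F(1) by simp_all
  have Fx: "(\<lambda>\<omega>. F (\<xi> 0 i \<omega>)) \<in> borel_measurable M" if "i < N" for i
    by (rule measurable_compose[OF xi_meas[OF that] F(1)])
  have N2: "of_nat N * ennreal x = ennreal (N * x)" if "0 \<le> x" for x :: real
    using that by (simp add: ennreal_of_nat_eq_real_of_nat ennreal_mult)
  have mean: "(\<integral>\<^sup>+\<omega>. ennreal (F (\<xi> 0 i \<omega>)) \<partial>M) = ennreal m" if "i < N" for i
    unfolding nn_integral_initial[OF that eF(1)] m(1) ..
  have pair: "(\<integral>\<^sup>+\<omega>. ennreal (F (\<xi> 0 i \<omega>)) * ennreal (F (\<xi> 0 j \<omega>)) \<partial>M) = ennreal m * ennreal m"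
    if ij: "i < N" "j < N" "i \<noteq> j" for i j
  proof -
    have "M.indep_vars (\<lambda>_. borel) (\<xi> 0) {..<N}" using walkers by (simp add: dmc_walkers_def)
    then have "M.indep_vars (\<lambda>_. borel) (\<lambda>i \<omega>. ennreal (F (\<xi> 0 i \<omega>))) {..<N}"
      by (rule M.indep_vars_compose2[where Y = "\<lambda>_ x. ennreal (F x)"]) (use eF in simp)
    then have "M.indep_vars (\<lambda>_. borel) (\<lambda>i \<omega>. ennreal (F (\<xi> 0 i \<omega>))) {i, j}"
      by (rule M.indep_vars_subset) (use ij in auto)
    from M.indep_vars_nn_integral[OF _ this] show ?thesis using ij mean by simp
  qed
  have "(\<integral>\<omega>. \<bar>(\<Sum>i<N. F (\<xi> 0 i \<omega>)) / real N - m\<bar> \<partial>M) \<le> sqrt (q / real N)"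
  proof (rule M.mean_deviation_of_pairs[OF Fx F(2,3) _ m(2,3) N q(1)])
    have "(\<Sum>i<N. \<integral>\<^sup>+\<omega>. ennreal (F (\<xi> 0 i \<omega>)) * ennreal m \<partial>M) = (\<Sum>i<N. ennreal m * ennreal m)"
      using mean Fx by (intro sum.cong refl) (simp add: nn_integral_multc)
    then show "(\<Sum>i<N. \<integral>\<^sup>+\<omega>. ennreal (F (\<xi> 0 i \<omega>)) * ennreal m \<partial>M) = (\<integral>\<^sup>+\<omega>. ennreal (N * (m * m)) \<partial>M)"
      using m(2) by (simp add: N2 ennreal_mult[symmetric] M.emeasure_space_1)
    have "(\<Sum>i<N. \<integral>\<^sup>+\<omega>. ennreal (F (\<xi> 0 i \<omega>)) * ennreal (F (\<xi> 0 i \<omega>)) \<partial>M) =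
        of_nat N * (\<integral>\<^sup>+x. ennreal (F x) * ennreal (F x) \<partial>\<eta>0)"
      using nn_integral_initial[OF _ eF(2)] by simp
    also have "\<dots> \<le> of_nat N * ennreal q"
      using q(2) F(2) by (intro mult_left_mono) (auto simp: power2_eq_square ennreal_mult)
    finally show "(\<Sum>i<N. \<integral>\<^sup>+\<omega>. ennreal (F (\<xi> 0 i \<omega>)) * ennreal (F (\<xi> 0 i \<omega>)) \<partial>M) \<le> ennreal (N * q)"
      unfolding N2[OF q(1)] .
    have "(\<Sum>i<N. \<Sum>j\<in>{..<N} - {i}. \<integral>\<^sup>+\<omega>. ennreal (F (\<xi> 0 i \<omega>)) * ennreal (F (\<xi> 0 j \<omega>)) \<partial>M) =
        (\<Sum>i<N. \<Sum>j\<in>{..<N} - {i}. ennreal m * ennreal m)"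
      using pair by (intro sum.cong refl) auto
    also have "\<dots> \<le> (\<Sum>i<N. \<Sum>j<N. ennreal m * ennreal m)" by (intro sum_mono sum_mono2) auto
    also have "\<dots> = (\<integral>\<^sup>+\<omega>. ennreal ((real N)\<^sup>2 * (m * m)) \<partial>M)"
      using m(2) by (simp add: ennreal_mult[symmetric] N2 power2_eq_square mult_ac M.emeasure_space_1)
    finally show "(\<Sum>i<N. \<Sum>j\<in>{..<N} - {i}. \<integral>\<^sup>+\<omega>. ennreal (F (\<xi> 0 i \<omega>)) * ennreal (F (\<xi> 0 j \<omega>)) \<partial>M) \<le>
        (\<integral>\<^sup>+\<omega>. ennreal ((real N)\<^sup>2 * (m * m)) \<partial>M)" .
  qed simp_all
  then show ?thesis unfolding integral_emp[OF F(1)] m_def .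
qed

text \<open>The level \<open>B\<close> is not exceeded under \<open>t \<mapsto> e * t + c\<close>.
  With nonnegative integrals, finiteness of the moments results from the induction instead of being
  a prerequisite.\<close>

lemma moment_bound:
  assumes U: "tame_weight P G U" and \<eta>0: "integrable \<eta>0 U" "(\<integral>x. U x \<partial>\<eta>0) \<le> B"
    and drift: "\<And>n \<mu>. borel_prob \<mu> \<Longrightarrow> integrable \<mu> U \<Longrightarrow> (\<integral>x. U x \<partial>step n \<mu>) \<le> e * (\<integral>x. U x \<partial>\<mu>) + c"
    and e: "0 \<le> e" "0 \<le> c" "e * B + c \<le> B"
  shows "(\<integral>\<^sup>+\<omega>. ennreal (\<integral>x. U x \<partial>emp n \<omega>) \<partial>M) \<le> ennreal B"
    "(\<integral>\<^sup>+\<omega>. ennreal (\<integral>x. U x \<partial>step n (emp n \<omega>)) \<partial>M) \<le> ennreal B"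
proof -
  interpret U: tame_weight P G U by (rule U)
  note Um = U.U_meas
  have Ue: "(\<lambda>x. ennreal (U x)) \<in> borel_measurable borel" using Um by simp
  have nn: "(\<integral>\<^sup>+x. ennreal (U x) \<partial>\<mu>) = ennreal (\<integral>x. U x \<partial>\<mu>)" if "integrable \<mu> U" for \<mu>
    using U.U_nonneg(1) by (intro nn_integral_eq_integral that) auto
  have pos: "0 \<le> (\<integral>x. U x \<partial>\<mu>)" for \<mu>
    using U.U_nonneg(1) by (intro Bochner_Integration.integral_nonneg)
  have B: "0 \<le> B" using pos[of \<eta>0] \<eta>0(2) by linarith
  have step: "(\<integral>\<^sup>+\<omega>. ennreal (\<integral>x. U x \<partial>step n (emp n \<omega>)) \<partial>M) \<le> ennreal B"
    if IH: "(\<integral>\<^sup>+\<omega>. ennreal (\<integral>x. U x \<partial>emp n \<omega>) \<partial>M) \<le> ennreal B" for n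
  proof -
    have "(\<integral>\<^sup>+\<omega>. ennreal (\<integral>x. U x \<partial>step n (emp n \<omega>)) \<partial>M) \<le>
      (\<integral>\<^sup>+\<omega>. ennreal e * ennreal (\<integral>x. U x \<partial>emp n \<omega>) + ennreal c \<partial>M)"
    proof (rule nn_integral_mono)
      fix \<omega>
      have "ennreal (\<integral>x. U x \<partial>step n (emp n \<omega>)) \<le> ennreal (e * (\<integral>x. U x \<partial>emp n \<omega>) + c)"
        by (intro ennreal_leI drift emp_prob integrable_emp Um)
      then show "ennreal (\<integral>x. U x \<partial>step n (emp n \<omega>)) \<le> ennreal e * ennreal (\<integral>x. U x \<partial>emp n \<omega>) + ennreal c"
        using e pos by (simp add: ennreal_mult)
    qed
    also have "\<dots> = ennreal e * (\<integral>\<^sup>+\<omega>. ennreal (\<integral>x. U x \<partial>emp n \<omega>) \<partial>M) + ennreal c"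
      using emp_meas[OF Um, of n] by (simp add: nn_integral_add nn_integral_cmult M.emeasure_space_1)
    also have "\<dots> \<le> ennreal e * ennreal B + ennreal c"
      by (intro add_right_mono mult_left_mono IH) simp
    also have "\<dots> = ennreal (e * B + c)" using e B by (simp add: ennreal_mult)
    also have "\<dots> \<le> ennreal B" by (intro ennreal_leI e(3))
    finally show ?thesis .
  qed
  have main: "(\<integral>\<^sup>+\<omega>. ennreal (\<integral>x. U x \<partial>emp n \<omega>) \<partial>M) \<le> ennreal B" for n
  proof (induction n)
    case 0
    have "(\<integral>\<^sup>+\<omega>. ennreal (\<integral>x. U x \<partial>emp 0 \<omega>) \<partial>M) = (\<integral>\<^sup>+\<omega>. (\<Sum>i<N. ennreal (1 / N) * ennreal (U (\<xi> 0 i \<omega>))) \<partial>M)"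
      unfolding nn[OF integrable_emp[OF Um], symmetric] nn_integral_emp[OF Ue] ..
    also have "\<dots> = (\<Sum>i<N. ennreal (1 / N) * (\<integral>\<^sup>+\<omega>. ennreal (U (\<xi> 0 i \<omega>)) \<partial>M))"
      using measurable_compose[OF xi_meas Ue] by (subst nn_integral_sum) (auto simp: nn_integral_cmult)
    also have "\<dots> = (\<Sum>i<N. ennreal (1 / N) * ennreal (\<integral>x. U x \<partial>\<eta>0))"
      using nn_integral_initial[OF _ Ue] nn[OF \<eta>0(1)] by (intro sum.cong refl) simp
    also have "\<dots> = ennreal (\<integral>x. U x \<partial>\<eta>0)"
      using N pos by (simp add: ennreal_of_nat_eq_real_of_nat ennreal_mult[symmetric])
    also have "\<dots> \<le> ennreal B" by (intro ennreal_leI \<eta>0(2))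
    finally show ?case .
  next
    case (Suc n)
    have "(\<integral>\<^sup>+\<omega>. ennreal (\<integral>x. U x \<partial>emp (Suc n) \<omega>) \<partial>M) = (\<integral>\<^sup>+\<omega>. ennreal (\<integral>x. U x \<partial>step n (emp n \<omega>)) \<partial>M)"
      using nn_integral_emp_Suc[OF Ue, of n]
      unfolding nn[OF integrable_emp[OF Um]] nn[OF U.integrable_step[OF emp_prob integrable_emp[OF Um]]] .
    then show ?case using step[OF Suc] by simp
  qed
  show "(\<integral>\<^sup>+\<omega>. ennreal (\<integral>x. U x \<partial>emp n \<omega>) \<partial>M) \<le> ennreal B" by (rule main)
  show "(\<integral>\<^sup>+\<omega>. ennreal (\<integral>x. U x \<partial>step n (emp n \<omega>)) \<partial>M) \<le> ennreal B" by (rule step[OF main])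
qed

end

section \<open>Time-uniform error bounds\<close>

text \<open>With \<open>a = x^(s+1)\<close>, the product is at most \<open>(m * x^m)^s\<close>, and
  \<open>m * x^m\<close> is bounded since it tends to 0. The exponent \<open>s + 1\<close> avoids a
  separate case \<open>s = 0\<close>, and the summand 1 in the bound covers \<open>a = 0\<close>,
  where \<open>0^0 = 1\<close> occurs.\<close>

lemma geometric_times_power_bounded:
  fixes a :: real
  assumes "0 \<le> a" "a < 1"
  obtains K where "0 < K" "\<And>m. real m ^ s * a ^ m \<le> K"
proof -
  define x where "x = a powr (1 / Suc s)"
  have x: "0 \<le> x" "x < 1"
    using assms powr_less_mono2[of "1 / Suc s" a 1] by (simp_all add: x_def)
  have ax: "a \<le> x ^ s" if "0 < a"
  proof -
    have "x ^ Suc s = a" using that unfolding x_def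
      by (simp add: powr_power del: power_Suc of_nat_Suc)
    then show ?thesis using mult_left_le_one_le[of "x ^ s" x] x by simp
  qed
  have "Bseq (\<lambda>m. real m * x ^ m)"
    using powser_times_n_limit_0[of x] x by (intro convergent_imp_Bseq) (auto simp: convergent_def)
  then obtain K where K: "0 < K" "\<And>m. norm (real m * x ^ m) \<le> K" unfolding Bseq_def by blast
  have "real m ^ s * a ^ m \<le> K ^ s + 1" for m
  proof (cases "a = 0")
    case True
    have "0 \<le> K ^ s" using K(1) by simp
    then show ?thesis using True by (cases "m = 0"; cases "s = 0") (auto simp: power_0_left)
  next
    case False
    then have "a ^ m \<le> (x ^ s) ^ m" using ax assms(1) by (intro power_mono) auto
    then have "real m ^ s * a ^ m \<le> real m ^ s * (x ^ m) ^ s"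
      by (intro mult_left_mono) (auto simp: power_mult[symmetric] mult.commute)
    also have "\<dots> = (real m * x ^ m) ^ s" by (simp add: power_mult_distrib)
    also have "\<dots> \<le> K ^ s" using K(2)[of m] x by (intro power_mono) auto
    finally show ?thesis by simp
  qed
  then show ?thesis using K(1) by (intro that[of "K ^ s + 1"]) (auto intro: add_nonneg_pos)
qed

text \<open>Jensen's inequality, by integrating the tangent at the mean \<open>a\<close>: \<open>(t
  / a) powr (- \<alpha>) \<ge> 1 + \<alpha> - \<alpha> * t / a\<close>, from
  \<open>ln u \<le> u - 1\<close> and \<open>exp v \<ge> 1 + v\<close>. It turns a moment of
  \<open>Wbar\<close> into a lower bound for the mean of \<open>W\<close>.\<close>

lemma (in prob_space) powr_neg_integral_le:
  fixes X :: "'a \<Rightarrow> real"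
  assumes X: "integrable M X" "\<And>x. 0 < X x" and Y: "integrable M Y" "\<And>x. X x powr (- \<alpha>) \<le> Y x"
    and \<alpha>: "0 < \<alpha>"
  shows "(\<integral>x. X x \<partial>M) powr (- \<alpha>) \<le> (\<integral>x. Y x \<partial>M)"
proof -
  define a where "a = (\<integral>x. X x \<partial>M)"
  have a: "0 < a" unfolding a_def by (rule integral_pos[OF X])
  have "a powr (- \<alpha>) * (1 + \<alpha> - \<alpha> / a * X x) \<le> Y x" for x
  proof -
    have "ln (X x / a) \<le> X x / a - 1" using X(2)[of x] a by (intro ln_le_minus_one) simp
    then have "1 + \<alpha> - \<alpha> / a * X x \<le> 1 + (- \<alpha> * ln (X x / a))"
      using mult_left_mono[of "ln (X x / a)" "X x / a - 1" \<alpha>] \<alpha> by (simp add: algebra_simps)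
    also have "\<dots> \<le> exp (- \<alpha> * ln (X x / a))" by (rule exp_ge_add_one_self)
    also have "\<dots> = (X x / a) powr (- \<alpha>)" using X(2)[of x] a by (simp add: powr_def)
    finally have "a powr (- \<alpha>) * (1 + \<alpha> - \<alpha> / a * X x) \<le> a powr (- \<alpha>) * (X x / a) powr (- \<alpha>)"
      by (intro mult_left_mono) auto
    also have "\<dots> = X x powr (- \<alpha>)"
      using X(2)[of x] a by (subst powr_mult[symmetric]) (auto simp: less_imp_le)
    finally show ?thesis using Y(2)[of x] by simp
  qed
  then have "(\<integral>x. a powr (- \<alpha>) * (1 + \<alpha> - \<alpha> / a * X x) \<partial>M) \<le> (\<integral>x. Y x \<partial>M)"
    using X(1) Y(1) by (intro integral_mono) auto
  also have "(\<integral>x. a powr (- \<alpha>) * (1 + \<alpha> - \<alpha> / a * X x) \<partial>M) = a powr (- \<alpha>) * (1 + \<alpha> - \<alpha> / a * a)"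
    using X(1) by (simp add: prob_space a_def)
  also have "\<dots> = a powr (- \<alpha>)" using a by simp
  finally show ?thesis by (simp add: a_def)
qed

text \<open>Jensen's inequality for powers, with Bernoulli's inequality as the tangent at the
  mean.\<close>

lemma (in prob_space) power_integral_le:
  fixes X :: "'a \<Rightarrow> real"
  assumes X: "integrable M X" "integrable M (\<lambda>x. X x ^ p)" "\<And>x. 0 \<le> X x" and p: "1 \<le> p"
  shows "(\<integral>x. X x \<partial>M) ^ p \<le> (\<integral>x. X x ^ p \<partial>M)"
proof (cases "(\<integral>x. X x \<partial>M) = 0")
  case True
  have "0 \<le> (\<integral>x. X x ^ p \<partial>M)" using X(3) by (intro Bochner_Integration.integral_nonneg) simp
  then show ?thesis using True p by (simp add: power_0_left)
next
  case False
  define a where "a = (\<integral>x. X x \<partial>M)"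
  have "0 \<le> a" using X(3) unfolding a_def by (intro Bochner_Integration.integral_nonneg) simp
  then have a: "0 < a" using False by (simp add: a_def)
  have "a ^ p * (1 + real p * (X x / a - 1)) \<le> X x ^ p" for x
  proof -
    have "1 + real p * (X x / a - 1) \<le> (1 + (X x / a - 1)) ^ p"
      using X(3)[of x] a by (intro Bernoulli_inequality) simp
    then have "a ^ p * (1 + real p * (X x / a - 1)) \<le> a ^ p * (X x / a) ^ p"
      using a by (intro mult_left_mono) auto
    then show ?thesis using a by (simp add: power_mult_distrib[symmetric] del: power_divide)
  qed
  then have "(\<integral>x. a ^ p * (1 + real p * (X x / a - 1)) \<partial>M) \<le> (\<integral>x. X x ^ p \<partial>M)"
    using X by (intro integral_mono) auto
  also have "(\<integral>x. a ^ p * (1 + real p * (X x / a - 1)) \<partial>M) = a ^ p * (1 + real p * (a / a - 1))"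
    using X(1) by (simp add: prob_space a_def)
  finally show ?thesis using a by (simp add: a_def)
qed

section \<open>Uniform moments and truncation\<close>

locale dmc_stable = fk_stable P G V W \<kappa> pd \<nu>
  for P :: "nat \<Rightarrow> 'a::polish_space \<Rightarrow> 'a measure" and G V W \<kappa> pd \<nu> +
  fixes \<eta>0 :: "'a measure" and Vbar Wbar :: "'a \<Rightarrow> real" and \<alpha> :: real
    and \<epsilon> :: "nat \<Rightarrow> 'a measure \<Rightarrow> real"
    and M :: "nat \<Rightarrow> 'w measure" and \<xi> :: "nat \<Rightarrow> nat \<Rightarrow> nat \<Rightarrow> 'w \<Rightarrow> 'a"
  assumes init: "borel_prob \<eta>0"
    and lyap_Vbar: "Q_lyapunov P G Vbar" and Vbar: "\<And>x. (V x)\<^sup>2 \<le> Vbar x"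
    and lyap_Wbar: "Q_lyapunov P G Wbar" and Wbar: "\<And>x. W x powr (- \<alpha>) \<le> Wbar x"
    and alpha: "0 < \<alpha>" "\<alpha> \<le> 1"
    and init_V: "integrable \<eta>0 V" and init_Vbar: "integrable \<eta>0 Vbar" and init_Wbar: "integrable \<eta>0 Wbar"
    and dmc: "\<And>N. 1 \<le> N \<Longrightarrow> dmc P G \<epsilon> \<eta>0 N (M N) (\<xi> N)"
begin

abbreviation "emp N n \<omega> \<equiv> empirical N (\<lambda>i. \<xi> N n i \<omega>)"
abbreviation "flow n \<equiv> FK_flow P G \<eta>0 n"

text \<open>The last clause, one step after an occupation measure, is what the conditional variance
  at the next time requires, and it has the form of the hypothesis on \<open>q\<close> in
  \<open>local_error\<close>.\<close>

definition moments_le :: "('a \<Rightarrow> real) \<Rightarrow> real \<Rightarrow> bool" where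
  "moments_le U B \<longleftrightarrow> (\<forall>n. integrable (flow n) U \<and> (\<integral>x. U x \<partial>flow n) \<le> B) \<and>
     (\<forall>N\<ge>1. \<forall>n. integrable (M N) (\<lambda>\<omega>. \<integral>x. U x \<partial>emp N n \<omega>) \<and>
       (\<integral>\<omega>. (\<integral>x. U x \<partial>emp N n \<omega>) \<partial>M N) \<le> B \<and>
       (\<integral>\<^sup>+\<omega>. ennreal (\<integral>x. U x \<partial>step n (emp N n \<omega>)) \<partial>M N) \<le> ennreal B)"

lemma moments_leD:
  assumes "moments_le U B"
  shows "integrable (flow n) U" "(\<integral>x. U x \<partial>flow n) \<le> B"
    "1 \<le> N \<Longrightarrow> integrable (M N) (\<lambda>\<omega>. \<integral>x. U x \<partial>emp N n \<omega>)"
    "1 \<le> N \<Longrightarrow> (\<integral>\<omega>. (\<integral>x. U x \<partial>emp N n \<omega>) \<partial>M N) \<le> B"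
    "1 \<le> N \<Longrightarrow> (\<integral>\<^sup>+\<omega>. ennreal (\<integral>x. U x \<partial>step n (emp N n \<omega>)) \<partial>M N) \<le> ennreal B"
  using assms unfolding moments_le_def by auto

text \<open>Every larger bound works as well, so that one constant can serve several Lyapunov
  functions. The number \<open>c / (1 - e)\<close> in \<open>B0\<close> is the fixed point of the
  drift; any level above it is kept.\<close>

lemma moments_uniform:
  assumes U: "Q_lyapunov P G U" and int: "integrable \<eta>0 U"
  shows "\<exists>B. \<forall>B'\<ge>B. moments_le U B'"
proof -
  obtain e c where ec: "0 \<le> e" "e < 1" "0 \<le> c"
    and drift: "\<And>n \<mu>. borel_prob \<mu> \<Longrightarrow> integrable \<mu> U \<Longrightarrow>
        (\<integral>x. U x \<partial>step n \<mu>) \<le> e * (\<integral>x. U x \<partial>\<mu>) + c"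
    by (fact lyapunov_drift[OF U])
  have tw: "tame_weight P G U" by (rule tame_weight_lyapunov[OF U])
  interpret U: tame_weight P G U by (rule tw)
  define B0 where "B0 = max 1 (max (\<integral>x. U x \<partial>\<eta>0) (c / (1 - e)))"
  have "moments_le U B" if "B0 \<le> B" for B
  proof -
    have B: "1 \<le> B" "(\<integral>x. U x \<partial>\<eta>0) \<le> B" "c / (1 - e) \<le> B" using that by (auto simp: B0_def)
    have "c \<le> B * (1 - e)" using B(3) ec by (simp add: divide_le_eq)
    then have keep: "e * B + c \<le> B" by (simp add: algebra_simps)
    note iF = U.integrable_FK_flow[OF init int]
    have FK: "(\<integral>x. U x \<partial>flow n) \<le> B" for n
    proof (induction n)
      case 0 then show ?case using B(2) by simp
    next
      case (Suc n)
      show ?case unfolding FK_flow_Suc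
        using drift[OF FK_flow_prob[OF init] iF, of n n] mult_left_mono[OF Suc ec(1)] keep by linarith
    qed
    have pos: "0 \<le> (\<integral>x. U x \<partial>\<mu>)" for \<mu>
      using U.U_nonneg(1) by (intro Bochner_Integration.integral_nonneg)
    have "integrable (M N) (\<lambda>\<omega>. \<integral>x. U x \<partial>emp N n \<omega>) \<and> (\<integral>\<omega>. (\<integral>x. U x \<partial>emp N n \<omega>) \<partial>M N) \<le> B \<and>
       (\<integral>\<^sup>+\<omega>. ennreal (\<integral>x. U x \<partial>step n (emp N n \<omega>)) \<partial>M N) \<le> ennreal B" if N: "1 \<le> N" for N n
    proof -
      interpret D: dmc P G \<epsilon> \<eta>0 N "M N" "\<xi> N" by (rule dmc[OF N])
      note mb = D.moment_bound[OF tw int B(2) drift ec(1,3) keep, of n]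
      have i: "integrable (M N) (\<lambda>\<omega>. \<integral>x. U x \<partial>emp N n \<omega>)"
        using mb(1) pos D.emp_meas[OF U.U_meas, of n]
        by (intro integrableI_nonneg) (auto intro: order_le_less_trans)
      have "ennreal (\<integral>\<omega>. (\<integral>x. U x \<partial>emp N n \<omega>) \<partial>M N) \<le> ennreal B"
        using mb(1) pos by (subst nn_integral_eq_integral[OF i, symmetric]) auto
      then show ?thesis using B(1) mb(2) i by (subst (asm) ennreal_le_iff) auto
    qed
    with iF FK show ?thesis unfolding moments_le_def by blast
  qed
  then show ?thesis by blast
qed

lemma moments: "\<exists>B\<ge>1. moments_le V B \<and> moments_le Wbar B \<and> moments_le Vbar B"
proof -
  obtain B1 B2 B3 where "\<forall>B\<ge>B1. moments_le V B" "\<forall>B\<ge>B2. moments_le Wbar B" "\<forall>B\<ge>B3. moments_le Vbar B"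
    using moments_uniform[OF lyap init_V] moments_uniform[OF lyap_Wbar init_Wbar]
      moments_uniform[OF lyap_Vbar init_Vbar] by blast
  then show ?thesis by (intro exI[of _ "max (max 1 B1) (max B2 B3)"]) auto
qed

text \<open>
  Trading moments for a polynomial factor in \<open>r\<close>: either both \<open>\<mu>(V)\<close> and \<open>1/\<mu>(W)\<close> are at
  most \<open>r\<close>, or one of the last two terms exceeds 1.
\<close>

lemma truncation:
  assumes \<mu>: "borel_prob \<mu>" "integrable \<mu> V" "integrable \<mu> Wbar" and r: "1 \<le> r"
    and T: "T \<le> 1" and good: "(\<integral>x. V x \<partial>\<mu>) \<le> r \<Longrightarrow> mass_ratio \<mu> \<le> r\<^sup>2 \<Longrightarrow> T \<le> A" and A: "0 \<le> A"
  shows "T \<le> A + (\<integral>x. V x \<partial>\<mu>) / r + (\<integral>x. Wbar x \<partial>\<mu>) * r powr (- \<alpha>)"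
proof -
  interpret prob_space \<mu> using borel_probD[OF \<mu>(1)] by simp
  let ?v = "\<integral>x. V x \<partial>\<mu>" and ?w = "\<integral>x. W x \<partial>\<mu>" and ?u = "\<integral>x. Wbar x \<partial>\<mu>"
  have v: "1 \<le> ?v" by (rule integral_V_ge_1[OF \<mu>(1,2)])
  have w: "0 < ?w" by (rule integral_W_pos[OF \<mu>(1,2)])
  have u: "?w powr (- \<alpha>) \<le> ?u"
    using \<mu>(3) Wbar alpha(1)
    by (intro powr_neg_integral_le W_pos integrable_dominated[OF borel_probD(2)[OF \<mu>(1)] \<mu>(2) dominated_W])
  then have u0: "0 \<le> ?u" using order_trans[OF powr_ge_zero] by blast
  have t1: "0 \<le> ?v / r" using v r by simp
  have t2: "0 \<le> ?u * r powr (- \<alpha>)" using u0 by simp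
  \<comment> \<open>In the middle case the ratio is at most \<open>r * r\<close>, which is where the
    square comes from. In the last case Jensen's inequality makes the mean of \<open>Wbar\<close> at
    least \<open>r powr \<alpha>\<close>.\<close>
  consider "r < ?v" | "1 < ?w * r" "?v \<le> r" | "?w * r \<le> 1" by linarith
  then show ?thesis
  proof cases
    case 1
    then have "1 \<le> ?v / r" using r by simp
    then show ?thesis using T A t2 by linarith
  next
    case 2
    have "?v * 1 \<le> r * (?w * r)" using 2 r by (intro mult_mono) auto
    then have "mass_ratio \<mu> \<le> r\<^sup>2"
      unfolding mass_ratio_def using w by (simp add: divide_le_eq power2_eq_square mult_ac)
    then show ?thesis using good[OF 2(2)] t1 t2 by linarith
  next
    case 3
    have "1 = 1 powr (- \<alpha>)" by simp
    also have "\<dots> \<le> (?w * r) powr (- \<alpha>)" using 3 w r alpha by (intro powr_mono2') auto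
    also have "\<dots> = ?w powr (- \<alpha>) * r powr (- \<alpha>)" using w r by (simp add: powr_mult)
    also have "\<dots> \<le> ?u * r powr (- \<alpha>)" using u by (intro mult_right_mono) auto
    finally show ?thesis using T A t1 by linarith
  qed
qed

lemma Vbar_meas: "Vbar \<in> borel_measurable borel" and Wbar_meas: "Wbar \<in> borel_measurable borel"
  using Q_lyapunovD(3)[OF lyap_Vbar] Q_lyapunovD(3)[OF lyap_Wbar] .

lemma emp_props:
  assumes N: "1 \<le> N"
  shows "borel_prob (emp N k \<omega>)" "integrable (emp N k \<omega>) V" "integrable (emp N k \<omega>) Wbar"
    "integrable (emp N k \<omega>) Vbar"
  by (intro empirical_prob N integrable_empirical U_meas Wbar_meas Vbar_meas)+

lemma nphi_emp_meas:
  assumes N: "1 \<le> N" and g: "dominated V g"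
  shows "(\<lambda>\<omega>. nphi m k (emp N l \<omega>) g) \<in> borel_measurable (M N)"
proof -
  interpret D: dmc P G \<epsilon> \<eta>0 N "M N" "\<xi> N" by (rule dmc[OF N])
  show ?thesis
    unfolding nphi_def
    by (intro borel_measurable_divide D.emp_meas dominated_measurable[OF dominated_qit] g dominated_1)
qed

text \<open>The expectation of the preceding alternative. The cost of the exceptional event is the
  same for all \<open>N\<close> and all times, by the uniform moments.\<close>

lemma expectation_truncation:
  obtains B where "1 \<le> B" "\<And>N k T A r. 1 \<le> N \<Longrightarrow> T \<in> borel_measurable (M N) \<Longrightarrow>
     (\<And>\<omega>. 0 \<le> T \<omega> \<and> T \<omega> \<le> 1) \<Longrightarrow> integrable (M N) A \<Longrightarrow> (\<And>\<omega>. 0 \<le> A \<omega>) \<Longrightarrow> 1 \<le> r \<Longrightarrow>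
     (\<And>\<omega>. (\<integral>x. V x \<partial>emp N k \<omega>) \<le> r \<Longrightarrow> mass_ratio (emp N k \<omega>) \<le> r\<^sup>2 \<Longrightarrow> T \<omega> \<le> A \<omega>) \<Longrightarrow>
     (\<integral>\<omega>. T \<omega> \<partial>M N) \<le> (\<integral>\<omega>. A \<omega> \<partial>M N) + B * (1 / r + r powr (- \<alpha>))"
proof -
  obtain B where B: "1 \<le> B" and V: "moments_le V B" and Wb: "moments_le Wbar B" using moments by blast
  show ?thesis
  proof (rule that[OF B])
    fix N k and T A :: "'w \<Rightarrow> real" and r :: real
    assume N: "1 \<le> N" and T: "T \<in> borel_measurable (M N)" "\<And>\<omega>. 0 \<le> T \<omega> \<and> T \<omega> \<le> 1"
      and A: "integrable (M N) A" "\<And>\<omega>. 0 \<le> A \<omega>" and r: "1 \<le> r"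
      and good: "\<And>\<omega>. (\<integral>x. V x \<partial>emp N k \<omega>) \<le> r \<Longrightarrow> mass_ratio (emp N k \<omega>) \<le> r\<^sup>2 \<Longrightarrow> T \<omega> \<le> A \<omega>"
    interpret D: dmc P G \<epsilon> \<eta>0 N "M N" "\<xi> N" by (rule dmc[OF N])
    let ?v = "\<lambda>\<omega>. \<integral>x. V x \<partial>emp N k \<omega>" and ?u = "\<lambda>\<omega>. \<integral>x. Wbar x \<partial>emp N k \<omega>"
    note int = moments_leD(3)[OF V N, of k] moments_leD(3)[OF Wb N, of k]
    have Ti: "integrable (M N) T"
      using T by (intro D.M.integrable_const_bound[where B = 1]) (auto simp: abs_of_nonneg)
    have "(\<integral>\<omega>. T \<omega> \<partial>M N) \<le> (\<integral>\<omega>. A \<omega> + ?v \<omega> / r + ?u \<omega> * r powr (- \<alpha>) \<partial>M N)"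
    proof (rule integral_mono[OF Ti])
      show "T \<omega> \<le> A \<omega> + ?v \<omega> / r + ?u \<omega> * r powr (- \<alpha>)" for \<omega>
        using T(2)[of \<omega>] A(2)[of \<omega>] good[of \<omega>] by (intro truncation[OF emp_props(1-3)[OF N] r]) auto
    qed (use A int in simp)
    also have "\<dots> = (\<integral>\<omega>. A \<omega> \<partial>M N) + (\<integral>\<omega>. ?v \<omega> \<partial>M N) / r + (\<integral>\<omega>. ?u \<omega> \<partial>M N) * r powr (- \<alpha>)"
      using A(1) int by simp
    also have "\<dots> \<le> (\<integral>\<omega>. A \<omega> \<partial>M N) + B / r + B * r powr (- \<alpha>)"
      using moments_leD(4)[OF V N, of k] moments_leD(4)[OF Wb N, of k] r
      by (intro add_mono order_refl divide_right_mono mult_right_mono) auto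
    finally show "(\<integral>\<omega>. T \<omega> \<partial>M N) \<le> (\<integral>\<omega>. A \<omega> \<partial>M N) + B * (1 / r + r powr (- \<alpha>))"
      by (simp add: distrib_left)
  qed
qed

text \<open>The reference \<open>m'\<close> is \<eta>0 at time 0 and \<open>step l\<close> of the
  previous occupation measure at time \<open>l + 1\<close>; leaving it abstract treats both at once.
  \<open>C1\<close> is exposed because the error hypothesis concerns only test functions below
  \<open>C1 * V\<close>, whose squares \<open>Vbar\<close> controls.\<close>

lemma sampling_error:
  obtains c C1 where "0 < c" "0 < C1" "\<And>N k m' \<delta> g i r. 1 \<le> N \<Longrightarrow> (\<And>\<omega>. borel_prob (m' \<omega>) \<and> integrable (m' \<omega>) V) \<Longrightarrow>
     (\<And>f. dominated V f \<Longrightarrow> (\<lambda>\<omega>. \<integral>x. f x \<partial>m' \<omega>) \<in> borel_measurable (M N)) \<Longrightarrow>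
     (\<And>F b. F \<in> borel_measurable borel \<Longrightarrow> \<forall>x. 0 \<le> F x \<and> F x \<le> C1 * V x \<and> F x \<le> b \<Longrightarrow>
       (\<integral>\<omega>. \<bar>(\<integral>x. F x \<partial>emp N k \<omega>) - (\<integral>x. F x \<partial>m' \<omega>)\<bar> \<partial>M N) \<le> \<delta>) \<Longrightarrow>
     unit_fun g \<Longrightarrow> 1 \<le> r \<Longrightarrow>
     (\<integral>\<omega>. \<bar>nphi i k (emp N k \<omega>) g - nphi i k (m' \<omega>) g\<bar> \<partial>M N) \<le> c * (r\<^sup>2 * \<delta> + 1 / r + r powr (- \<alpha>))"
proof -
  obtain c where c: "0 < c" "\<And>g m k \<mu> \<eta>. unit_fun g \<Longrightarrow>
     borel_prob \<mu> \<Longrightarrow> integrable \<mu> V \<Longrightarrow> borel_prob \<eta> \<Longrightarrow> integrable \<eta> V \<Longrightarrow>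
     \<bar>nphi m k \<mu> g - nphi m k \<eta> g\<bar> \<le> c * mass_ratio \<mu> *
       (\<bar>(\<integral>x. nqit m k g x \<partial>\<mu>) - (\<integral>x. nqit m k g x \<partial>\<eta>)\<bar> + \<bar>(\<integral>x. H m k x \<partial>\<mu>) - (\<integral>x. H m k x \<partial>\<eta>)\<bar>)"
    using nphi_local_error by meson
  obtain C1 where C1: "0 < C1" "\<And>m k g x. unit_fun g \<Longrightarrow> 0 \<le> nqit m k g x \<and> nqit m k g x \<le> C1 * V x"
    using nqit_le by meson
  obtain B where B: "1 \<le> B" and trunc: "\<And>N k T A r. 1 \<le> N \<Longrightarrow> T \<in> borel_measurable (M N) \<Longrightarrow>
     (\<And>\<omega>. 0 \<le> T \<omega> \<and> T \<omega> \<le> 1) \<Longrightarrow> integrable (M N) A \<Longrightarrow> (\<And>\<omega>. 0 \<le> A \<omega>) \<Longrightarrow> 1 \<le> r \<Longrightarrow>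
     (\<And>\<omega>. (\<integral>x. V x \<partial>emp N k \<omega>) \<le> r \<Longrightarrow> mass_ratio (emp N k \<omega>) \<le> r\<^sup>2 \<Longrightarrow> T \<omega> \<le> A \<omega>) \<Longrightarrow>
     (\<integral>\<omega>. T \<omega> \<partial>M N) \<le> (\<integral>\<omega>. A \<omega> \<partial>M N) + B * (1 / r + r powr (- \<alpha>))"
    by (fact expectation_truncation)
  show ?thesis
  proof (rule that[of "2 * c + B" C1])
    fix N k m' \<delta> i and g :: "'a \<Rightarrow> real" and r :: real
    assume N: "1 \<le> N" and m': "\<And>\<omega>. borel_prob (m' \<omega>) \<and> integrable (m' \<omega>) V"
      and m'_meas: "\<And>f. dominated V f \<Longrightarrow> (\<lambda>\<omega>. \<integral>x. f x \<partial>m' \<omega>) \<in> borel_measurable (M N)"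
      and err: "\<And>F b. F \<in> borel_measurable borel \<Longrightarrow> \<forall>x. 0 \<le> F x \<and> F x \<le> C1 * V x \<and> F x \<le> b \<Longrightarrow>
        (\<integral>\<omega>. \<bar>(\<integral>x. F x \<partial>emp N k \<omega>) - (\<integral>x. F x \<partial>m' \<omega>)\<bar> \<partial>M N) \<le> \<delta>"
      and g: "unit_fun g" and r: "1 \<le> r"
    interpret D: dmc P G \<epsilon> \<eta>0 N "M N" "\<xi> N" by (rule dmc[OF N])
    let ?e = "emp N k"
    define D1 where "D1 F \<omega> = \<bar>(\<integral>x. F x \<partial>?e \<omega>) - (\<integral>x. F x \<partial>m' \<omega>)\<bar>" for F :: "'a \<Rightarrow> real" and \<omega>
    define T where "T \<omega> = \<bar>nphi i k (?e \<omega>) g - nphi i k (m' \<omega>) g\<bar>" for \<omega>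
    note e = emp_props[OF N, of k]
    have m'p: "borel_prob (m' \<omega>)" "integrable (m' \<omega>) V" for \<omega> using m' by auto
    have one: "unit_fun (\<lambda>_. 1 :: real)" by (simp add: unit_fun_def)
    have D1: "integrable (M N) (D1 (nqit i k h))" "(\<integral>\<omega>. D1 (nqit i k h) \<omega> \<partial>M N) \<le> \<delta>"
      if h: "unit_fun h" for h
    proof -
      obtain b where b: "\<And>x. nqit i k h x \<le> b" using nqit_bounded[OF h] by blast
      have dF: "dominated V (nqit i k h)" by (intro dominated_nqit dominated_unit h)
      note Fm = dominated_measurable[OF dF]
      have F0: "0 \<le> nqit i k h x" for x using C1(2)[OF h] by auto
      have Dm: "D1 (nqit i k h) \<in> borel_measurable (M N)"
        unfolding D1_def using D.emp_meas[OF Fm, of k] m'_meas dF by simp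
      have "\<bar>D1 (nqit i k h) \<omega>\<bar> \<le> b" for \<omega>
        unfolding D1_def
        using D.integral_step_bounded(2,3)[OF e(1)[of \<omega>] Fm F0 b]
          D.integral_step_bounded(2,3)[OF m'p(1)[of \<omega>] Fm F0 b] by linarith
      then show "integrable (M N) (D1 (nqit i k h))"
        by (intro D.M.integrable_const_bound[where B = b] Dm) auto
      show "(\<integral>\<omega>. D1 (nqit i k h) \<omega> \<partial>M N) \<le> \<delta>"
        unfolding D1_def using C1(2)[OF h] b by (intro err[OF Fm, of b]) auto
    qed
    \<comment> \<open>Numerator and denominator each contribute one sampling error; the denominator
      is the test function 1.\<close>
    let ?S = "\<lambda>\<omega>. D1 (nqit i k g) \<omega> + D1 (H i k) \<omega>"
    note DH = D1[OF one, folded H_eq_nqit] and Dg = D1[OF g]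
    have S0: "0 \<le> ?S \<omega>" for \<omega> by (simp add: D1_def)
    have \<delta>: "0 \<le> \<delta>"
      using Dg(2) by (rule order_trans[rotated]) (intro Bochner_Integration.integral_nonneg, simp add: D1_def)
    have "(\<integral>\<omega>. T \<omega> \<partial>M N) \<le> (\<integral>\<omega>. c * r\<^sup>2 * ?S \<omega> \<partial>M N) + B * (1 / r + r powr (- \<alpha>))"
    proof (rule trunc[where k = k, OF N _ _ _ _ r])
      have "(\<lambda>\<omega>. nphi i k (m' \<omega>) g) \<in> borel_measurable (M N)"
        unfolding nphi_def using m'_meas dominated_qit[OF dominated_unit[OF g]] dominated_qit[OF dominated_1]
        by (intro borel_measurable_divide) auto
      then show "T \<in> borel_measurable (M N)"
        unfolding T_def using nphi_emp_meas[OF N dominated_unit[OF g], of i k k] by simp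
      show "0 \<le> T \<omega> \<and> T \<omega> \<le> 1" for \<omega>
        unfolding T_def using nphi_bounds[OF e(1,2)[of \<omega>] g, of i k] nphi_bounds[OF m'p[of \<omega>] g, of i k] by linarith
      show "0 \<le> c * r\<^sup>2 * ?S \<omega>" for \<omega> using S0[of \<omega>] c(1) by simp
      fix \<omega> assume mr: "mass_ratio (?e \<omega>) \<le> r\<^sup>2"
      have "T \<omega> \<le> c * mass_ratio (?e \<omega>) * ?S \<omega>"
        unfolding T_def D1_def by (rule c(2)[OF g e(1,2) m'p])
      also have "\<dots> \<le> c * r\<^sup>2 * ?S \<omega>"
        using mr c(1) S0[of \<omega>] by (intro mult_right_mono mult_left_mono) auto
      finally show "T \<omega> \<le> c * r\<^sup>2 * ?S \<omega>" .
    qed (use Dg(1) DH(1) in simp)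
    also have "(\<integral>\<omega>. c * r\<^sup>2 * ?S \<omega> \<partial>M N) \<le> c * r\<^sup>2 * (\<delta> + \<delta>)"
      using Dg DH c(1) by (simp add: mult_left_mono add_mono)
    also have "c * r\<^sup>2 * (\<delta> + \<delta>) + B * (1 / r + r powr (- \<alpha>)) \<le> (2 * c + B) * (r\<^sup>2 * \<delta> + 1 / r + r powr (- \<alpha>))"
    proof -
      have "0 \<le> B * (r\<^sup>2 * \<delta>)" "0 \<le> 2 * c * (1 / r + r powr (- \<alpha>))" using B c(1) \<delta> r by auto
      then show ?thesis by (simp add: algebra_simps)
    qed
    finally show "(\<integral>\<omega>. \<bar>nphi i k (emp N k \<omega>) g - nphi i k (m' \<omega>) g\<bar> \<partial>M N) \<le>
        (2 * c + B) * (r\<^sup>2 * \<delta> + 1 / r + r powr (- \<alpha>))"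
      unfolding T_def by (simp add: add_mono)
  qed (use c(1) B C1(1) in simp_all)
qed

text \<open>\<open>F^2 \<le> C1^2 * V^2 \<le> C1^2 * Vbar\<close>, so \<open>q = C1^2 * B\<close>
  bounds the second moments for all times and all \<open>N\<close>.\<close>

lemma sampling_errors:
  "\<exists>C>0. \<forall>N g r i l. 1 \<le> N \<longrightarrow> unit_fun g \<longrightarrow> 1 \<le> r \<longrightarrow>
     (\<integral>\<omega>. \<bar>nphi i (Suc l) (emp N (Suc l) \<omega>) g - nphi i (Suc l) (step l (emp N l \<omega>)) g\<bar> \<partial>M N) \<le>
       C * (r\<^sup>2 / sqrt N + 1 / r + r powr (- \<alpha>)) \<and>
     (\<integral>\<omega>. \<bar>nphi i 0 (emp N 0 \<omega>) g - nphi i 0 \<eta>0 g\<bar> \<partial>M N) \<le> C * (r\<^sup>2 / sqrt N + 1 / r + r powr (- \<alpha>))"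
proof -
  obtain c C1 where c: "0 < c" and C1: "0 < C1" and samp: "\<And>N k m' \<delta> g i r. 1 \<le> N \<Longrightarrow> (\<And>\<omega>. borel_prob (m' \<omega>) \<and> integrable (m' \<omega>) V) \<Longrightarrow>
     (\<And>f. dominated V f \<Longrightarrow> (\<lambda>\<omega>. \<integral>x. f x \<partial>m' \<omega>) \<in> borel_measurable (M N)) \<Longrightarrow>
     (\<And>F b. F \<in> borel_measurable borel \<Longrightarrow> \<forall>x. 0 \<le> F x \<and> F x \<le> C1 * V x \<and> F x \<le> b \<Longrightarrow>
       (\<integral>\<omega>. \<bar>(\<integral>x. F x \<partial>emp N k \<omega>) - (\<integral>x. F x \<partial>m' \<omega>)\<bar> \<partial>M N) \<le> \<delta>) \<Longrightarrow>
     unit_fun g \<Longrightarrow> 1 \<le> r \<Longrightarrow>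
     (\<integral>\<omega>. \<bar>nphi i k (emp N k \<omega>) g - nphi i k (m' \<omega>) g\<bar> \<partial>M N) \<le> c * (r\<^sup>2 * \<delta> + 1 / r + r powr (- \<alpha>))"
    by (fact sampling_error)
  obtain B where B: "1 \<le> B" and mVb: "moments_le Vbar B" using moments by blast
  interpret Vb: tame_weight P G Vbar by (rule tame_weight_lyapunov[OF lyap_Vbar])
  define q where "q = C1\<^sup>2 * B"
  have q: "0 \<le> q" "ennreal (C1\<^sup>2) * ennreal B = ennreal q" using B by (simp_all add: q_def ennreal_mult)
  define C where "C = c * (sqrt q + 1)"
  have C: "0 < C" using c q by (simp add: C_def add_nonneg_pos)
  have fin: "c * (r\<^sup>2 * sqrt (q / real N) + 1 / r + r powr (- \<alpha>)) \<le> C * (r\<^sup>2 / sqrt N + 1 / r + r powr (- \<alpha>))"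
    if "1 \<le> r" for r :: real and N
  proof -
    have "u * v + a + p \<le> (u + 1) * (v + a + p)" if "0 \<le> v" "0 \<le> u * (a + p)" for u v a p :: real
      using that by (simp add: algebra_simps)
    from this[of "r\<^sup>2 / sqrt N" "sqrt q" "1 / r" "r powr (- \<alpha>)"]
    have "r\<^sup>2 * sqrt (q / real N) + 1 / r + r powr (- \<alpha>) \<le> (sqrt q + 1) * (r\<^sup>2 / sqrt N + 1 / r + r powr (- \<alpha>))"
      using that q by (simp add: real_sqrt_divide mult.commute)
    then show ?thesis unfolding C_def mult.assoc using c by (intro mult_left_mono) auto
  qed
  have mean_sq: "(\<integral>\<^sup>+x. ennreal ((F x)\<^sup>2) \<partial>\<mu>) \<le> ennreal (C1\<^sup>2) * ennreal (\<integral>x. Vbar x \<partial>\<mu>)"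
    if int: "integrable \<mu> Vbar" and F: "\<forall>x. 0 \<le> F x \<and> F x \<le> C1 * V x \<and> F x \<le> b" for F :: "'a \<Rightarrow> real" and b \<mu>
  proof -
    have F2: "(F x)\<^sup>2 \<le> C1\<^sup>2 * Vbar x" for x
    proof -
      have "(F x)\<^sup>2 \<le> (C1 * V x)\<^sup>2" using F by (intro power_mono) auto
      also have "\<dots> \<le> C1\<^sup>2 * Vbar x" using Vbar[of x] by (simp add: power_mult_distrib mult_left_mono)
      finally show ?thesis .
    qed
    have "(\<integral>\<^sup>+x. ennreal ((F x)\<^sup>2) \<partial>\<mu>) \<le> (\<integral>\<^sup>+x. ennreal (C1\<^sup>2 * Vbar x) \<partial>\<mu>)"
      by (intro nn_integral_mono ennreal_leI F2)
    also have "\<dots> = ennreal (\<integral>x. C1\<^sup>2 * Vbar x \<partial>\<mu>)"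
      using int Vb.U_nonneg(1) by (intro nn_integral_eq_integral) auto
    also have "\<dots> = ennreal (C1\<^sup>2) * ennreal (\<integral>x. Vbar x \<partial>\<mu>)"
      using Vb.U_nonneg(1) by (simp add: ennreal_mult Bochner_Integration.integral_nonneg)
    finally show ?thesis .
  qed
  have "(\<integral>\<omega>. \<bar>nphi i (Suc l) (emp N (Suc l) \<omega>) g - nphi i (Suc l) (step l (emp N l \<omega>)) g\<bar> \<partial>M N) \<le>
       C * (r\<^sup>2 / sqrt N + 1 / r + r powr (- \<alpha>)) \<and>
     (\<integral>\<omega>. \<bar>nphi i 0 (emp N 0 \<omega>) g - nphi i 0 \<eta>0 g\<bar> \<partial>M N) \<le> C * (r\<^sup>2 / sqrt N + 1 / r + r powr (- \<alpha>))"
    if N: "1 \<le> N" and g: "unit_fun g" and r: "1 \<le> r" for N g r i l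
  proof
    interpret D: dmc P G \<epsilon> \<eta>0 N "M N" "\<xi> N" by (rule dmc[OF N])
    note e = emp_props[OF N, of l]
    have "(\<integral>\<omega>. \<bar>nphi i (Suc l) (emp N (Suc l) \<omega>) g - nphi i (Suc l) (step l (emp N l \<omega>)) g\<bar> \<partial>M N) \<le>
        c * (r\<^sup>2 * sqrt (q / real N) + 1 / r + r powr (- \<alpha>))"
    proof (rule samp[OF N _ _ _ g r])
      show "borel_prob (step l (emp N l \<omega>)) \<and> integrable (step l (emp N l \<omega>)) V" for \<omega>
        by (intro conjI step_prob integrable_step e)
      show "(\<lambda>\<omega>. \<integral>x. f x \<partial>step l (emp N l \<omega>)) \<in> borel_measurable (M N)" if "dominated V f" for f
        by (rule D.past_meas[OF D.step_emp_past_meas[OF tame_weight_axioms that]])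
      fix F :: "'a \<Rightarrow> real" and b
      assume Fm: "F \<in> borel_measurable borel" and F: "\<forall>x. 0 \<le> F x \<and> F x \<le> C1 * V x \<and> F x \<le> b"
      have vm: "(\<lambda>\<omega>. \<integral>x. Vbar x \<partial>step l (emp N l \<omega>)) \<in> borel_measurable (M N)"
        by (rule D.past_meas[OF D.step_emp_past_meas[OF Vb.tame_weight_axioms Vb.dominated_U]])
      have "(\<integral>\<^sup>+\<omega>. (\<integral>\<^sup>+x. ennreal ((F x)\<^sup>2) \<partial>step l (emp N l \<omega>)) \<partial>M N) \<le>
          (\<integral>\<^sup>+\<omega>. ennreal (C1\<^sup>2) * ennreal (\<integral>x. Vbar x \<partial>step l (emp N l \<omega>)) \<partial>M N)"
        by (intro nn_integral_mono mean_sq[OF _ F] Vb.integrable_step e)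
      also have "\<dots> = ennreal (C1\<^sup>2) * (\<integral>\<^sup>+\<omega>. ennreal (\<integral>x. Vbar x \<partial>step l (emp N l \<omega>)) \<partial>M N)"
        using vm by (intro nn_integral_cmult) simp
      also have "\<dots> \<le> ennreal q"
        unfolding q(2)[symmetric] using moments_leD(5)[OF mVb N, of l] by (intro mult_left_mono) auto
      finally show "(\<integral>\<omega>. \<bar>(\<integral>x. F x \<partial>emp N (Suc l) \<omega>) - (\<integral>x. F x \<partial>step l (emp N l \<omega>))\<bar> \<partial>M N) \<le> sqrt (q / real N)"
        using F by (intro D.local_error[OF Fm _ _ q(1), where b = b]) auto
    qed
    then show "(\<integral>\<omega>. \<bar>nphi i (Suc l) (emp N (Suc l) \<omega>) g - nphi i (Suc l) (step l (emp N l \<omega>)) g\<bar> \<partial>M N) \<le>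
        C * (r\<^sup>2 / sqrt N + 1 / r + r powr (- \<alpha>))" using fin[OF r] by (rule order_trans)
    have "(\<integral>\<omega>. \<bar>nphi i 0 (emp N 0 \<omega>) g - nphi i 0 \<eta>0 g\<bar> \<partial>M N) \<le>
        c * (r\<^sup>2 * sqrt (q / real N) + 1 / r + r powr (- \<alpha>))"
    proof (rule samp[OF N _ _ _ g r])
      fix F :: "'a \<Rightarrow> real" and b
      assume Fm: "F \<in> borel_measurable borel" and F: "\<forall>x. 0 \<le> F x \<and> F x \<le> C1 * V x \<and> F x \<le> b"
      have "(\<integral>\<^sup>+x. ennreal ((F x)\<^sup>2) \<partial>\<eta>0) \<le> ennreal (C1\<^sup>2) * ennreal (\<integral>x. Vbar x \<partial>\<eta>0)"
        by (rule mean_sq[OF init_Vbar F])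
      also have "\<dots> \<le> ennreal q"
        unfolding q(2)[symmetric] using moments_leD(2)[OF mVb, of 0] by (intro mult_left_mono ennreal_leI) auto
      finally show "(\<integral>\<omega>. \<bar>(\<integral>x. F x \<partial>emp N 0 \<omega>) - (\<integral>x. F x \<partial>\<eta>0)\<bar> \<partial>M N) \<le> sqrt (q / real N)"
        using F by (intro D.initial_error[OF init Fm _ _ q(1), where b = b]) auto
    qed (use init init_V in auto)
    then show "(\<integral>\<omega>. \<bar>nphi i 0 (emp N 0 \<omega>) g - nphi i 0 \<eta>0 g\<bar> \<partial>M N) \<le> C * (r\<^sup>2 / sqrt N + 1 / r + r powr (- \<alpha>))"
      using fin[OF r] by (rule order_trans)
  qed
  then show ?thesis using C by blast
qed

text \<open>On the good event the mean of \<open>V\<close> times the mass ratio is at most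
  \<open>r * r^2\<close>, whence the cube. Along the deterministic flow that product is bounded by
  the constant \<open>A\<close>: Jensen's inequality and the moment of \<open>Wbar\<close> keep the
  mean of \<open>W\<close> above \<open>B0 powr (- 1 / \<alpha>)\<close>.\<close>

lemma forgetting:
  "\<exists>a\<ge>0. a < 1 \<and> (\<exists>C>0. \<forall>N g r m k. 1 \<le> N \<longrightarrow> unit_fun g \<longrightarrow> 1 \<le> r \<longrightarrow>
     (\<integral>\<omega>. \<bar>nphi m k (emp N k \<omega>) g - nphi m k (flow k) g\<bar> \<partial>M N) \<le> C * (a ^ m * r ^ 3 + 1 / r + r powr (- \<alpha>)))"
proof -
  obtain a c where a: "0 \<le> a" "a < 1" and c: "0 < c"
    and st: "\<And>g m k \<mu> \<eta>. unit_fun g \<Longrightarrow>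
     borel_prob \<mu> \<Longrightarrow> integrable \<mu> V \<Longrightarrow> borel_prob \<eta> \<Longrightarrow> integrable \<eta> V \<Longrightarrow>
     \<bar>nphi m k \<mu> g - nphi m k \<eta> g\<bar> \<le>
       c * a ^ m * (1 + (\<integral>x. V x \<partial>\<mu>) * mass_ratio \<mu> + (\<integral>x. V x \<partial>\<eta>) * mass_ratio \<eta>)"
    using nphi_stability by meson
  obtain B0 where B0: "1 \<le> B0" and V: "moments_le V B0" and Wb: "moments_le Wbar B0" using moments by blast
  obtain B where B: "1 \<le> B" and trunc: "\<And>N k T A r. 1 \<le> N \<Longrightarrow> T \<in> borel_measurable (M N) \<Longrightarrow>
     (\<And>\<omega>. 0 \<le> T \<omega> \<and> T \<omega> \<le> 1) \<Longrightarrow> integrable (M N) A \<Longrightarrow> (\<And>\<omega>. 0 \<le> A \<omega>) \<Longrightarrow> 1 \<le> r \<Longrightarrow>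
     (\<And>\<omega>. (\<integral>x. V x \<partial>emp N k \<omega>) \<le> r \<Longrightarrow> mass_ratio (emp N k \<omega>) \<le> r\<^sup>2 \<Longrightarrow> T \<omega> \<le> A \<omega>) \<Longrightarrow>
     (\<integral>\<omega>. T \<omega> \<partial>M N) \<le> (\<integral>\<omega>. A \<omega> \<partial>M N) + B * (1 / r + r powr (- \<alpha>))"
    by (fact expectation_truncation)
  define A where "A = B0 * (B0 * B0 powr (1 / \<alpha>))"
  have A: "0 \<le> A" using B0 by (simp add: A_def)
  have flow: "(\<integral>x. V x \<partial>flow n) * mass_ratio (flow n) \<le> A" for n
  proof -
    note p = FK_flow_prob[OF init, of n] and i = moments_leD(1)[OF V, of n]
    interpret prob_space "flow n" using borel_probD[OF p] by simp
    have w: "0 < (\<integral>x. W x \<partial>flow n)" by (rule integral_W_pos[OF p i])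
    have "(\<integral>x. W x \<partial>flow n) powr (- \<alpha>) \<le> (\<integral>x. Wbar x \<partial>flow n)"
      using Wbar alpha(1) by (intro powr_neg_integral_le W_pos moments_leD(1)[OF Wb]
        integrable_dominated[OF borel_probD(2)[OF p] i dominated_W])
    also have "\<dots> \<le> B0" by (rule moments_leD(2)[OF Wb])
    finally have "((\<integral>x. W x \<partial>flow n) powr (- \<alpha>)) powr (1 / \<alpha>) \<le> B0 powr (1 / \<alpha>)"
      using alpha(1) by (intro powr_mono2) auto
    moreover have "((\<integral>x. W x \<partial>flow n) powr (- \<alpha>)) powr (1 / \<alpha>) = (\<integral>x. W x \<partial>flow n) powr (- 1)"
      unfolding powr_powr using alpha(1) by simp
    moreover have "(\<integral>x. W x \<partial>flow n) powr (- 1) = 1 / (\<integral>x. W x \<partial>flow n)"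
      using w by (simp add: powr_minus_divide)
    ultimately have inv: "1 / (\<integral>x. W x \<partial>flow n) \<le> B0 powr (1 / \<alpha>)" by simp
    have v: "1 \<le> (\<integral>x. V x \<partial>flow n)" by (rule integral_V_ge_1[OF p i])
    have "mass_ratio (flow n) = (\<integral>x. V x \<partial>flow n) * (1 / (\<integral>x. W x \<partial>flow n))" by (simp add: mass_ratio_def)
    also have "\<dots> \<le> B0 * B0 powr (1 / \<alpha>)"
      using moments_leD(2)[OF V, of n] B0 inv w by (intro mult_mono) auto
    finally show ?thesis
      unfolding A_def using moments_leD(2)[OF V, of n] B0 v mass_ratio_pos[OF p i] by (intro mult_mono) auto
  qed
  define C where "C = c * (2 + A) + B"
  have C: "0 < C" using c A B by (simp add: C_def add_nonneg_pos)
  have "(\<integral>\<omega>. \<bar>nphi m k (emp N k \<omega>) g - nphi m k (flow k) g\<bar> \<partial>M N) \<le> C * (a ^ m * r ^ 3 + 1 / r + r powr (- \<alpha>))"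
    if N: "1 \<le> N" and g: "unit_fun g" and r: "1 \<le> r" for N g r m k
  proof -
    interpret D: dmc P G \<epsilon> \<eta>0 N "M N" "\<xi> N" by (rule dmc[OF N])
    let ?e = "emp N k"
    note \<eta> = FK_flow_prob[OF init, of k] moments_leD(1)[OF V, of k] and e = emp_props[OF N, of k]
    define T where "T \<omega> = \<bar>nphi m k (?e \<omega>) g - nphi m k (flow k) g\<bar>" for \<omega>
    have am: "0 \<le> a ^ m" using a by simp
    have p0: "0 \<le> a ^ m * r ^ 3" using am r by simp
    have "(\<integral>\<omega>. T \<omega> \<partial>M N) \<le> (\<integral>\<omega>. c * (2 + A) * (a ^ m * r ^ 3) \<partial>M N) + B * (1 / r + r powr (- \<alpha>))"
    proof (rule trunc[where k = k, OF N _ _ _ _ r])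
      show "T \<in> borel_measurable (M N)"
        unfolding T_def using nphi_emp_meas[OF N dominated_unit[OF g], of m k k] by simp
      show "0 \<le> T \<omega> \<and> T \<omega> \<le> 1" for \<omega>
        unfolding T_def using nphi_bounds[OF e(1,2)[of \<omega>] g, of m k] nphi_bounds[OF \<eta> g, of m k] by linarith
      show "0 \<le> c * (2 + A) * (a ^ m * r ^ 3)" using c A p0 by simp
      fix \<omega> assume v: "(\<integral>x. V x \<partial>?e \<omega>) \<le> r" and mr: "mass_ratio (?e \<omega>) \<le> r\<^sup>2"
      have "T \<omega> \<le> c * a ^ m * (1 + (\<integral>x. V x \<partial>?e \<omega>) * mass_ratio (?e \<omega>) + (\<integral>x. V x \<partial>flow k) * mass_ratio (flow k))"
        unfolding T_def by (rule st[OF g e(1,2) \<eta>])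
      also have "\<dots> \<le> c * a ^ m * ((2 + A) * r ^ 3)"
      proof (rule mult_left_mono)
        have "(\<integral>x. V x \<partial>?e \<omega>) * mass_ratio (?e \<omega>) \<le> r * r\<^sup>2"
          using v mr r mass_ratio_pos[OF e(1,2), of \<omega>] by (intro mult_mono) auto
        then have 1: "(\<integral>x. V x \<partial>?e \<omega>) * mass_ratio (?e \<omega>) \<le> r ^ 3"
          by (simp add: power3_eq_cube power2_eq_square)
        have r3: "1 \<le> r ^ 3" using r by simp
        have "A * 1 \<le> A * r ^ 3" using A r3 by (intro mult_left_mono) auto
        then show "1 + (\<integral>x. V x \<partial>?e \<omega>) * mass_ratio (?e \<omega>) + (\<integral>x. V x \<partial>flow k) * mass_ratio (flow k) \<le> (2 + A) * r ^ 3"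
          using 1 r3 flow[of k] by (simp add: distrib_right)
      qed (use c am in simp)
      finally show "T \<omega> \<le> c * (2 + A) * (a ^ m * r ^ 3)" by (simp add: mult_ac)
    qed simp
    also have "\<dots> = c * (2 + A) * (a ^ m * r ^ 3) + B * (1 / r + r powr (- \<alpha>))"
      by (simp add: D.M.prob_space)
    also have "\<dots> \<le> C * (a ^ m * r ^ 3) + C * (1 / r + r powr (- \<alpha>))"
      using B c A p0 r by (intro add_mono mult_right_mono) (auto simp: C_def)
    finally show ?thesis unfolding T_def by (simp add: distrib_left add.assoc)
  qed
  then show ?thesis using a C by blast
qed

end

lemma add3_power_le:
  fixes a b c :: real
  assumes "0 \<le> a" "0 \<le> b" "0 \<le> c"
  shows "(a + b + c) ^ p \<le> 3 ^ p * (a ^ p + b ^ p + c ^ p)"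
proof -
  define m where "m = max a (max b c)"
  have m: "m ^ p \<le> a ^ p + b ^ p + c ^ p"
    using assms by (auto simp: m_def max_def)
  have "(a + b + c) ^ p \<le> (3 * m) ^ p"
    using assms by (intro power_mono) (auto simp: m_def)
  also have "\<dots> = 3 ^ p * m ^ p" by (rule power_mult_distrib)
  also have "\<dots> \<le> 3 ^ p * (a ^ p + b ^ p + c ^ p)" using m by simp
  finally show ?thesis .
qed

lemma C_wt_bound:
  assumes f: "f \<in> C_wt w" and w: "\<And>x. 0 < w x"
  shows "\<bar>f x\<bar> \<le> wnorm w f * w x" "0 \<le> wnorm w f"
proof -
  have bdd: "bdd_above (range (\<lambda>x. \<bar>f x\<bar> / w x))" using f by (simp add: C_wt_def)
  have le: "\<bar>f x\<bar> / w x \<le> wnorm w f" for x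
    unfolding wnorm_def by (rule cSUP_upper[OF _ bdd]) simp
  show "\<bar>f x\<bar> \<le> wnorm w f * w x" using le[of x] w[of x] by (simp add: divide_le_eq)
  show "0 \<le> wnorm w f" using order_trans[OF _ le[of x]] w[of x] by simp
qed

section \<open>Propagation of errors for test functions with values in [0, 1]\<close>

context dmc_stable
begin

text \<open>Telescoping in time: \<open>A i\<close> starts the semigroup at the occupation measure
  \<open>i\<close> steps before \<open>n\<close>. Thus \<open>A 0\<close> is the mean of
  \<open>g\<close> under the last occupation measure, consecutive differences are propagated
  sampling errors, each at most \<tau> in mean whatever \<open>i\<close> is, and at
  \<open>i = m\<close> forgetting takes over.\<close>

lemma unit_error:
  "\<exists>C>0. \<forall>N g n. 1 \<le> N \<longrightarrow> unit_fun g \<longrightarrow>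
     (\<integral>\<omega>. \<bar>(\<integral>x. g x \<partial>emp N n \<omega>) - (\<integral>x. g x \<partial>flow n)\<bar> \<partial>M N) \<le> C * N powr (- \<alpha> / 16)"
proof -
  obtain C1 where C1: "0 < C1" and samp: "\<And>N g r i l. 1 \<le> N \<Longrightarrow> unit_fun g \<Longrightarrow> 1 \<le> r \<Longrightarrow>
     (\<integral>\<omega>. \<bar>nphi i (Suc l) (emp N (Suc l) \<omega>) g - nphi i (Suc l) (step l (emp N l \<omega>)) g\<bar> \<partial>M N) \<le>
       C1 * (r\<^sup>2 / sqrt N + 1 / r + r powr (- \<alpha>)) \<and>
     (\<integral>\<omega>. \<bar>nphi i 0 (emp N 0 \<omega>) g - nphi i 0 \<eta>0 g\<bar> \<partial>M N) \<le> C1 * (r\<^sup>2 / sqrt N + 1 / r + r powr (- \<alpha>))"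
    using sampling_errors by blast
  obtain a C2 where a: "0 \<le> a" "a < 1" and C2: "0 < C2" and forget:
    "\<And>N g r m k. 1 \<le> N \<Longrightarrow> unit_fun g \<Longrightarrow> 1 \<le> r \<Longrightarrow>
     (\<integral>\<omega>. \<bar>nphi m k (emp N k \<omega>) g - nphi m k (flow k) g\<bar> \<partial>M N) \<le> C2 * (a ^ m * r ^ 3 + 1 / r + r powr (- \<alpha>))"
    using forgetting by blast
  \<comment> \<open>Chosen so that \<open>m ^ s\<close> is at least \<open>N\<close> for
    \<open>m\<close> about \<open>N powr (\<alpha> / 16)\<close>; then \<open>a ^ m\<close> is at
    most \<open>K / N\<close>, which absorbs \<open>r ^ 3\<close>.\<close>
  define s where "s = nat \<lceil>16 / \<alpha>\<rceil>"
  have s: "1 \<le> real s * (\<alpha> / 16)"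
  proof -
    have "16 / \<alpha> \<le> real s" unfolding s_def using alpha by (simp add: le_of_int_ceiling)
    then show ?thesis using alpha by (simp add: field_simps)
  qed
  obtain K where K: "0 < K" "\<And>m. real m ^ s * a ^ m \<le> K"
    by (fact geometric_times_power_bounded[OF a])
  define C where "C = 9 * C1 + C2 * (K + 2)"
  have "(\<integral>\<omega>. \<bar>(\<integral>x. g x \<partial>emp N n \<omega>) - (\<integral>x. g x \<partial>flow n)\<bar> \<partial>M N) \<le> C * N powr (- \<alpha> / 16)"
    if N: "1 \<le> N" and g: "unit_fun g" for N g n
  proof -
    interpret D: dmc P G \<epsilon> \<eta>0 N "M N" "\<xi> N" by (rule dmc[OF N])
    define x where "x = real N"
    have x1: "1 \<le> x" using N by (simp add: x_def)
    \<comment> \<open>Now \<open>r^2 / sqrt N = N powr (- 1 / 4)\<close>,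
      \<open>1 / r = N powr (- 1 / 8)\<close> and
      \<open>r powr (- \<alpha>) = N powr (- \<alpha> / 8)\<close>, all at most
      \<open>b * b\<close>. Adding up about \<open>1 / b\<close> such errors leaves a multiple of
      \<open>b\<close>.\<close>
    define r where "r = x powr (1 / 8)"
    define b where "b = x powr (- \<alpha> / 16)"
    define m where "m = nat \<lceil>x powr (\<alpha> / 16)\<rceil>"
    have r: "1 \<le> r" using x1 by (simp add: r_def ge_one_powr_ge_zero)
    have b0: "0 < b" using x1 by (simp add: b_def)
    have mono: "x powr u \<le> x powr v" if "u \<le> v" for u v using that x1 by (rule powr_mono)
    have r2: "r\<^sup>2 / sqrt N \<le> x powr (- \<alpha> / 8)"
    proof -
      have "r\<^sup>2 / sqrt N = x powr (1 / 4) / x powr (1 / 2)"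
        using x1 by (simp add: r_def x_def powr_half_sqrt power2_eq_square powr_add[symmetric])
      also have "\<dots> = x powr (- 1 / 4)" by (simp add: powr_diff[symmetric])
      also have "\<dots> \<le> x powr (- \<alpha> / 8)" using alpha by (intro mono) simp
      finally show ?thesis .
    qed
    have r1: "1 / r \<le> x powr (- \<alpha> / 8)"
    proof -
      have "1 / r = x powr (- 1 / 8)" using x1 by (simp add: r_def powr_minus_divide)
      also have "\<dots> \<le> x powr (- \<alpha> / 8)" using alpha by (intro mono) simp
      finally show ?thesis .
    qed
    have ra: "r powr (- \<alpha>) = x powr (- \<alpha> / 8)" by (simp add: r_def powr_powr)
    have bb: "x powr (- \<alpha> / 8) = b * b" using x1 by (simp add: b_def powr_add[symmetric])
    have inv_b: "x powr (\<alpha> / 16) * b = 1" using x1 by (simp add: b_def powr_add[symmetric])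
    have b1: "b \<le> 1" using mono[of "- \<alpha> / 16" 0] alpha x1 by (simp add: b_def)
    have xa: "1 \<le> x powr (\<alpha> / 16)" using x1 alpha by (simp add: ge_one_powr_ge_zero)
    have m_low: "x powr (\<alpha> / 16) \<le> real m" unfolding m_def by (simp add: le_of_int_ceiling)
    have m_up: "real m + 1 \<le> 3 * x powr (\<alpha> / 16)"
    proof -
      have "real m \<le> x powr (\<alpha> / 16) + 1"
        unfolding m_def using xa by (simp add: of_nat_nat ceiling_le_iff)
      then show ?thesis using xa by linarith
    qed
    define \<tau> where "\<tau> = C1 * (r\<^sup>2 / sqrt N + 1 / r + r powr (- \<alpha>))"
    have \<tau>: "\<tau> \<le> 3 * C1 * (b * b)"
    proof -
      have "\<tau> \<le> C1 * (b * b + b * b + b * b)"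
        unfolding \<tau>_def using r2 r1 ra C1 unfolding bb by (intro mult_left_mono add_mono) auto
      then show ?thesis by simp
    qed
    have \<tau>0: "0 \<le> \<tau>" unfolding \<tau>_def using C1 r by simp
    have m\<tau>: "(real m + 1) * \<tau> \<le> 9 * C1 * b"
    proof -
      have "(real m + 1) * \<tau> \<le> (3 * x powr (\<alpha> / 16)) * (3 * C1 * (b * b))"
        using m_up \<tau> \<tau>0 by (intro mult_mono) auto
      also have "\<dots> = 9 * C1 * b * (x powr (\<alpha> / 16) * b)" by (simp add: mult_ac)
      finally show ?thesis using inv_b by simp
    qed
    have am: "a ^ m * r ^ 3 \<le> K * b"
    proof -
      have "x \<le> x powr (real s * (\<alpha> / 16))" using mono[OF s] x1 by simp
      also have "\<dots> = (x powr (\<alpha> / 16)) ^ s" using x1 by (simp add: powr_power mult.commute)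
      also have "\<dots> \<le> real m ^ s" using m_low by (intro power_mono) auto
      finally have xs: "x \<le> real m ^ s" .
      have "x * a ^ m \<le> real m ^ s * a ^ m" using xs a by (intro mult_right_mono) auto
      then have "x * a ^ m \<le> K" using K(2)[of m] by linarith
      then have "a ^ m \<le> K / x" using x1 by (simp add: le_divide_eq mult.commute)
      then have "a ^ m * r ^ 3 \<le> K / x * r ^ 3" using r by (intro mult_right_mono) auto
      also have "\<dots> = K * x powr (- 5 / 8)"
      proof -
        have "r ^ 3 = x powr (3 / 8)" using x1 by (simp add: r_def powr_power)
        moreover have "x powr (3 / 8) / x = x powr (3 / 8 - 1)" using powr_diff[of x "3 / 8" 1] x1 by simp
        ultimately have "r ^ 3 / x = x powr (- 5 / 8)" by simp
        then have "K * (r ^ 3 / x) = K * x powr (- 5 / 8)" by (rule arg_cong)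
        then show ?thesis by simp
      qed
      also have "\<dots> \<le> K * b" unfolding b_def using K(1) alpha by (intro mult_left_mono mono) auto
      finally show ?thesis .
    qed
    have F: "C2 * (a ^ m * r ^ 3 + 1 / r + r powr (- \<alpha>)) \<le> C2 * (K + 2) * b"
    proof -
      have "b * b \<le> b" using b0 b1 by (simp add: mult_le_cancel_left1)
      then have "a ^ m * r ^ 3 + 1 / r + r powr (- \<alpha>) \<le> K * b + b + b"
        using am r1 ra bb by linarith
      then have "C2 * (a ^ m * r ^ 3 + 1 / r + r powr (- \<alpha>)) \<le> C2 * (K * b + b + b)"
        using C2 by (intro mult_left_mono) auto
      then show ?thesis by (simp add: algebra_simps)
    qed
    note e = emp_props(1,2)[OF N] and dg = dominated_unit[OF g]
    define A where "A i \<omega> = nphi i (n - i) (emp N (n - i) \<omega>) g" for i \<omega>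
    define Y where "Y = (\<integral>x. g x \<partial>flow n)"
    have A01: "0 \<le> A i \<omega>" "A i \<omega> \<le> 1" for i \<omega>
      unfolding A_def by (rule nphi_bounds[OF e g])+
    have gm: "g \<in> borel_measurable borel" "\<And>x. 0 \<le> g x" "\<And>x. g x \<le> 1"
      using g by (auto simp: unit_fun_def)
    have Y01: "0 \<le> Y" "Y \<le> 1"
      unfolding Y_def by (rule D.integral_step_bounded[OF FK_flow_prob[OF init] gm])+
    have Am: "A i \<in> borel_measurable (M N)" for i unfolding A_def by (rule nphi_emp_meas[OF N dg])
    have intA: "integrable (M N) (\<lambda>\<omega>. \<bar>A i \<omega> - A j \<omega>\<bar>)" for i j
    proof -
      have "\<bar>A i \<omega> - A j \<omega>\<bar> \<le> 1" for \<omega> using A01[of i \<omega>] A01[of j \<omega>] by linarith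
      then show ?thesis using Am[of i] Am[of j] by (intro D.M.integrable_const_bound[where B = 1]) auto
    qed
    have intY: "integrable (M N) (\<lambda>\<omega>. \<bar>A i \<omega> - Y\<bar>)" for i
    proof -
      have "\<bar>A i \<omega> - Y\<bar> \<le> 1" for \<omega> using A01[of i \<omega>] Y01 by linarith
      then show ?thesis using Am[of i] by (intro D.M.integrable_const_bound[where B = 1]) auto
    qed
    \<comment> \<open>\<open>nphi_Suc\<close> moves the older occupation measure one step forward,
      so both terms start at time \<open>n - i\<close>.\<close>
    have one: "(\<integral>\<omega>. \<bar>A i \<omega> - A (Suc i) \<omega>\<bar> \<partial>M N) \<le> \<tau>" if i: "i < n" for i
    proof -
      define l where "l = n - Suc i"
      have l: "n - i = Suc l" "n - Suc i = l" using i by (auto simp: l_def)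
      show ?thesis
        unfolding A_def l nphi_Suc[OF e dg] \<tau>_def using samp[OF N g r, of i l] by simp
    qed
    have tele: "(\<integral>\<omega>. \<bar>A 0 \<omega> - A j \<omega>\<bar> \<partial>M N) \<le> real j * \<tau>" if "j \<le> n" for j
      using that
    proof (induction j)
      case (Suc j)
      have "(\<integral>\<omega>. \<bar>A 0 \<omega> - A (Suc j) \<omega>\<bar> \<partial>M N) \<le> (\<integral>\<omega>. \<bar>A 0 \<omega> - A j \<omega>\<bar> + \<bar>A j \<omega> - A (Suc j) \<omega>\<bar> \<partial>M N)"
        by (intro integral_mono Bochner_Integration.integrable_add intA) linarith
      also have "\<dots> = (\<integral>\<omega>. \<bar>A 0 \<omega> - A j \<omega>\<bar> \<partial>M N) + (\<integral>\<omega>. \<bar>A j \<omega> - A (Suc j) \<omega>\<bar> \<partial>M N)"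
        by (intro Bochner_Integration.integral_add intA)
      also have "\<dots> \<le> real j * \<tau> + \<tau>" using Suc one[of j] by (intro add_mono) auto
      finally show ?case by (simp add: algebra_simps)
    qed simp
    have split: "(\<integral>\<omega>. \<bar>A 0 \<omega> - Y\<bar> \<partial>M N) \<le> real j * \<tau> + (\<integral>\<omega>. \<bar>A j \<omega> - Y\<bar> \<partial>M N)" if "j \<le> n" for j
    proof -
      have "(\<integral>\<omega>. \<bar>A 0 \<omega> - Y\<bar> \<partial>M N) \<le> (\<integral>\<omega>. \<bar>A 0 \<omega> - A j \<omega>\<bar> + \<bar>A j \<omega> - Y\<bar> \<partial>M N)"
        by (intro integral_mono Bochner_Integration.integrable_add intA intY) linarith
      also have "\<dots> = (\<integral>\<omega>. \<bar>A 0 \<omega> - A j \<omega>\<bar> \<partial>M N) + (\<integral>\<omega>. \<bar>A j \<omega> - Y\<bar> \<partial>M N)"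
        by (intro Bochner_Integration.integral_add intA intY)
      finally show ?thesis using tele[OF that] by linarith
    qed
    have "(\<integral>\<omega>. \<bar>A 0 \<omega> - Y\<bar> \<partial>M N) \<le> C * b"
    proof (cases "m \<le> n")
      case True
      have "Y = nphi m (n - m) (flow (n - m)) g"
        unfolding Y_def using nphi_FK_flow[OF init init_V dg, of m "n - m"] True by simp
      then have "(\<integral>\<omega>. \<bar>A m \<omega> - Y\<bar> \<partial>M N) \<le> C2 * (K + 2) * b"
        unfolding A_def using order_trans[OF forget[OF N g r] F] by simp
      moreover have "real m * \<tau> \<le> 9 * C1 * b" using m\<tau> \<tau>0 by (simp add: algebra_simps)
      ultimately show ?thesis using split[OF True] by (simp add: C_def algebra_simps)
    next
      case False
      \<comment> \<open>Fewer than \<open>m\<close> steps have elapsed, so nothing need be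
        forgotten: telescoping reaches time 0 and adds one error, that of the initial walkers. This
        explains \<open>m + 1\<close> in the bound prepared above.\<close>
      have "Y = nphi n 0 \<eta>0 g"
        unfolding Y_def using nphi_FK_flow[OF init init_V dg, of n 0] by simp
      then have "(\<integral>\<omega>. \<bar>A n \<omega> - Y\<bar> \<partial>M N) \<le> \<tau>"
        unfolding A_def \<tau>_def using samp[OF N g r, of n] by simp
      then have "(\<integral>\<omega>. \<bar>A 0 \<omega> - Y\<bar> \<partial>M N) \<le> (real n + 1) * \<tau>"
        using split[of n] by (simp add: algebra_simps)
      also have "\<dots> \<le> (real m + 1) * \<tau>" using False \<tau>0 by (intro mult_right_mono) auto
      also have "\<dots> \<le> 9 * C1 * b" by (rule m\<tau>)
      also have "\<dots> \<le> C * b" using C2 K(1) b0 by (intro mult_right_mono) (auto simp: C_def)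
      finally show ?thesis .
    qed
    then show ?thesis
      unfolding A_def Y_def b_def x_def by (simp add: nphi_0[OF e(1)])
  qed
  moreover have "0 < C" using C1 C2 K(1) by (simp add: C_def add_pos_pos)
  ultimately show ?thesis by blast
qed

end

section \<open>Admissible normalising constants\<close>

context fk_model
begin

lemma chi_finite:
  assumes "chi P G * ennreal v \<le> ennreal q" "0 < v"
  shows "chi P G < \<top>"
proof (rule ccontr)
  assume "\<not> chi P G < \<top>"
  then have "chi P G * ennreal v = \<top>"
    using assms(2) by (simp add: less_top[symmetric] ennreal_top_mult)
  then show False using assms(1) by (simp add: top_unique)
qed

lemma chi_pos: "0 < chi P G"
proof -
  fix x
  interpret prob_space "P 1 x" using borel_probD(1)[OF kernel_prob] by simp
  have int: "integrable (P 1 x) (G 1)" by (intro integrable_G kernel_prob) simp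
  have "0 < ennreal (\<integral>y. G 1 y \<partial>P 1 x)" using integral_pos[OF int G_pos] by simp
  also have "\<dots> = (\<integral>\<^sup>+y. ennreal (G 1 y) \<partial>P 1 x)"
    using G_pos[of 1] by (intro nn_integral_eq_integral[symmetric] int) (auto simp: less_imp_le)
  also have "\<dots> \<le> chi P G" unfolding chi_def by (intro SUP_upper2[of 1] SUP_upper) auto
  finally show ?thesis .
qed

lemma integral_G_le_chi:
  assumes "chi P G < \<top>" "1 \<le> n"
  shows "(\<integral>y. G n y \<partial>P n x) \<le> enn2real (chi P G)"
proof -
  have int: "integrable (P n x) (G n)" by (intro integrable_G kernel_prob assms)
  have pos: "0 \<le> (\<integral>y. G n y \<partial>P n x)"
    using G_pos[of n] by (intro Bochner_Integration.integral_nonneg) (auto simp: less_imp_le)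
  have "ennreal (\<integral>y. G n y \<partial>P n x) = (\<integral>\<^sup>+y. ennreal (G n y) \<partial>P n x)"
    using G_pos[of n] by (intro nn_integral_eq_integral[symmetric] int) (auto simp: less_imp_le)
  also have "\<dots> \<le> chi P G" unfolding chi_def using assms(2) by (intro SUP_upper2[of n] SUP_upper) auto
  finally have "enn2real (ennreal (\<integral>y. G n y \<partial>P n x)) \<le> enn2real (chi P G)"
    using assms(1) by (intro enn2real_mono)
  then show ?thesis using pos by simp
qed

text \<open>The three assumptions on \<kappa> of \<open>fk_stable\<close>, isolated so that the
  alternatives \<chi> and \<open>E0\<close> are dealt with here only.\<close>

definition normalizer :: "('a \<Rightarrow> real) \<Rightarrow> ('a \<Rightarrow> real) \<Rightarrow> real \<Rightarrow> bool" where
  "normalizer V W \<kappa> \<longleftrightarrow> 0 < \<kappa> \<and> (\<forall>n\<ge>1. \<forall>x. \<kappa> * W x \<le> Q_op P G n W x) \<and>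
     (\<exists>C. \<forall>m k x. qit m k (\<lambda>_. 1) x \<le> C * \<kappa> ^ m * V x)"

text \<open>In \<open>Q_{k,k+m+1}(1) = G_k P(G_{k+1} P(...))\<close> every potential except the
  outermost stands under a transition and contributes at most \<chi>. The outermost is bounded by a
  multiple of \<open>V\<close> uniformly in time, since
  \<open>G \<le> G P(V) = Q(V) \<le> V / Vt\<close>.\<close>

lemma normalizer_chi:
  assumes V: "Q_lyapunov P G V" and W: "\<And>x. 0 < W x"
    and chi: "\<And>n x. 1 \<le> n \<Longrightarrow> chi P G * ennreal (W x) \<le> ennreal (Q_op P G n W x)"
  shows "normalizer V W (enn2real (chi P G))"
proof -
  interpret tame_weight P G V by (rule tame_weight_lyapunov[OF V])
  define \<kappa> where "\<kappa> = enn2real (chi P G)"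
  have fin: "chi P G < \<top>" using chi_finite[OF chi[of 1 undefined] W[of undefined]] by simp
  have \<kappa>: "0 < \<kappa>" unfolding \<kappa>_def using fin chi_pos by (simp add: enn2real_positive_iff)
  have chi_eq: "chi P G = ennreal \<kappa>" unfolding \<kappa>_def using fin by simp
  have QW: "\<kappa> * W x \<le> Q_op P G n W x" if "1 \<le> n" for n x
  proof (rule ccontr)
    assume "\<not> \<kappa> * W x \<le> Q_op P G n W x"
    moreover have "ennreal (\<kappa> * W x) \<le> ennreal (Q_op P G n W x)"
      using chi[OF that, of x] \<kappa> W[of x] by (simp add: chi_eq ennreal_mult)
    \<comment> \<open>\<open>ennreal\<close> sends negative reals to 0; positivity of the left side
      is what lets the comparison be pulled back to the reals.\<close>
    moreover have "0 < \<kappa> * W x" using \<kappa> W[of x] by simp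
    ultimately show False by (auto simp: ennreal_le_iff2)
  qed
  obtain Vt where Vt: "Vt \<in> C_infty" and QV: "\<And>n x. 1 \<le> n \<Longrightarrow> Q_op P G n V x \<le> V x / Vt x"
    using Q_op_lyapunov_le[OF V] by blast
  define i where "i = (INF x. Vt x)"
  have i: "0 < i" "\<And>x. i \<le> Vt x"
    using Vt unfolding C_infty_def i_def by (auto intro: cINF_lower)
  have GV: "G k x \<le> 1 / i * V x" for k x
  proof -
    interpret prob_space "P (Suc k) x" using borel_probD(1)[OF kernel_prob] by simp
    have "1 \<le> (\<integral>y. V y \<partial>P (Suc k) x)"
      using integral_mono[OF _ integrable_kernel[OF _ dominated_U], of "Suc k" x "\<lambda>_. 1"] U_ge1
      by (simp add: prob_space)
    then have "G k x * 1 \<le> G k x * (\<integral>y. V y \<partial>P (Suc k) x)"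
      using G_pos[of k x] by (intro mult_left_mono) auto
    also have "\<dots> \<le> V x / Vt x" using QV[of "Suc k" x] by (simp add: Q_op_def)
    also have "\<dots> \<le> V x / i" using i U_nonneg(1)[of x] by (intro divide_left_mono) (auto intro: mult_pos_pos less_le_trans)
    finally show ?thesis by simp
  qed
  have qG: "qit (Suc m) k (\<lambda>_. 1) x \<le> G k x * \<kappa> ^ m" for m k x
  proof (induction m arbitrary: k x)
    case 0
    interpret prob_space "P (Suc k) x" using borel_probD(1)[OF kernel_prob] by simp
    show ?case by (simp add: Q_op_def prob_space)
  next
    case (Suc m)
    have dG: "dominated V (\<lambda>y. \<kappa> ^ m * G (Suc k) y)"
      using GV[of "Suc k"] G_pos[of "Suc k"]
      by (intro dominated_cmult dominatedI[where c = "1 / i"] G_meas) (auto simp: less_imp_le)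
    have "qit (Suc (Suc m)) k (\<lambda>_. 1) x = Q_op P G (Suc k) (qit (Suc m) (Suc k) (\<lambda>_. 1)) x" by simp
    also have "\<dots> \<le> Q_op P G (Suc k) (\<lambda>y. \<kappa> ^ m * G (Suc k) y) x"
      using Suc[of "Suc k"] by (intro Q_op_mono dG dominated_qit dominated_1) (auto simp: mult.commute)
    also have "\<dots> = \<kappa> ^ m * (G k x * (\<integral>y. G (Suc k) y \<partial>P (Suc k) x))"
      unfolding Q_op_cmult by (simp add: Q_op_def)
    also have "\<dots> \<le> \<kappa> ^ m * (G k x * \<kappa>)"
      unfolding \<kappa>_def using integral_G_le_chi[OF fin, of "Suc k" x] G_pos[of k x] \<kappa>
      by (intro mult_left_mono) auto
    finally show ?case by (simp add: mult_ac)
  qed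
  have "qit m k (\<lambda>_. 1) x \<le> (1 + 1 / (i * \<kappa>)) * \<kappa> ^ m * V x" for m k x
  proof (cases m)
    case 0
    have "1 \<le> V x" by (rule U_ge1)
    moreover have "0 \<le> 1 / (i * \<kappa>) * V x" using i(1) \<kappa> U_nonneg(1)[of x] by simp
    ultimately show ?thesis using 0 by (simp add: distrib_right)
  next
    case (Suc l)
    have "qit m k (\<lambda>_. 1) x \<le> 1 / i * V x * \<kappa> ^ l"
      unfolding Suc using order_trans[OF qG mult_right_mono[OF GV]] \<kappa> by simp
    also have "\<dots> = 1 / (i * \<kappa>) * \<kappa> ^ m * V x" using \<kappa> by (simp add: Suc)
    also have "\<dots> \<le> (1 + 1 / (i * \<kappa>)) * \<kappa> ^ m * V x"
      using \<kappa> U_nonneg(1)[of x] by (intro mult_right_mono) auto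
    finally show ?thesis .
  qed
  then show ?thesis using \<kappa> QW unfolding normalizer_def \<kappa>_def[symmetric] by blast
qed

text \<open>\<open>Q(V) \<le> (E0 / 2) V + c h\<close>: off a compact set \<open>1 / Vt\<close> is
  small, and on it \<open>V / Vt\<close> is below a multiple of \<open>h\<close>. Since
  \<open>Q(h) = E0 h\<close>, iteration adds multiples of \<open>h\<close> in a geometric series
  with sum \<open>A = 2 * c / E0\<close>, and \<open>1 \<le> V\<close> and
  \<open>h \<le> w * V\<close> finish.\<close>

lemma normalizer_eigen:
  assumes V: "Q_lyapunov P G V" and hom: "time_homogeneous P G"
    and h: "h \<in> C_wt V" "\<And>x. 0 < h x" and E0: "0 < E0"
    and Qh: "\<And>x. Q_op P G 1 h x = E0 * h x"
    and W: "\<And>x. E0 * W x \<le> Q_op P G 1 W x"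
  shows "normalizer V W E0"
proof -
  interpret tame_weight P G V by (rule tame_weight_lyapunov[OF V])
  have Q_eq: "Q_op P G n f = Q_op P G 1 f" if "1 \<le> n" for n f
  proof (intro ext)
    fix x
    have "P n = P 1" "G (n - 1) = G 0" using hom that unfolding time_homogeneous_def by blast+
    then show "Q_op P G n f x = Q_op P G 1 f x" by (simp add: Q_op_def)
  qed
  obtain Vt where Vt: "Vt \<in> C_infty" and QV: "\<And>n x. 1 \<le> n \<Longrightarrow> Q_op P G n V x \<le> V x / Vt x"
    using Q_op_lyapunov_le[OF V] by blast
  note Vtp = C_infty_pos[OF Vt]
  have cont: "continuous_on UNIV Vt" "continuous_on UNIV h" "continuous_on UNIV V"
    using Vt h(1) Q_lyapunovD(4)[OF V] by (auto simp: C_infty_def C_wt_def)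
  define w where "w = wnorm V h"
  have hw: "h x \<le> w * V x" for x
    using C_wt_bound(1)[OF h(1) U_nonneg(2), of x] h(2)[of x] by (simp add: w_def)
  have w0: "0 \<le> w" unfolding w_def by (rule C_wt_bound(2)[OF h(1) U_nonneg(2)])
  have dh: "dominated V h"
    using hw h(2) cont(2) by (intro dominatedI[where c = w] borel_measurable_continuous_onI) (auto simp: less_imp_le)
  define S where "S = sublevel Vt (2 / E0)"
  have S: "compact S" unfolding S_def by (rule C_infty_sublevel_compact[OF Vt])
  have "continuous_on UNIV (\<lambda>x. V x / Vt x / h x)"
    using Vtp h(2) by (intro continuous_intros cont) (auto simp: less_imp_neq[symmetric])
  then have cS: "continuous_on S (\<lambda>x. V x / Vt x / h x)" by (rule continuous_on_subset) simp
  obtain c where c: "0 < c" "\<And>x. x \<in> S \<Longrightarrow> V x / Vt x / h x \<le> c"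
    by (fact continuous_bounded_above_on_compact[OF S cS])
  have drift: "Q_op P G n V x \<le> E0 / 2 * V x + c * h x" if n: "1 \<le> n" for n x
  proof (cases "x \<in> S")
    case True
    have "V x / Vt x \<le> c * h x" using c(2)[OF True] unfolding pos_divide_le_eq[OF h(2)] .
    moreover have "0 \<le> E0 / 2 * V x" using E0 U_nonneg(1)[of x] by simp
    ultimately show ?thesis using QV[OF n, of x] by linarith
  next
    case False
    then have "2 / E0 \<le> Vt x" by (simp add: S_def sublevel_def)
    then have "V x / Vt x \<le> V x / (2 / E0)"
      using E0 Vtp[of x] U_nonneg(1)[of x] by (intro divide_left_mono) auto
    moreover have "0 \<le> c * h x" using c(1) h(2)[of x] by simp
    moreover have "V x / (2 / E0) = E0 / 2 * V x" by simp
    ultimately show ?thesis using QV[OF n, of x] by linarith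
  qed
  define A where "A = 2 * c / E0"
  have A: "0 < A" using c E0 by (simp add: A_def)
  have main: "qit m k V x \<le> E0 ^ m * ((1/2) ^ m * V x + A * (1 - (1/2) ^ m) * h x)" for m k x
  proof (induction m arbitrary: k x)
    case (Suc m)
    let ?u = "\<lambda>x. E0 ^ m * (1/2) ^ m * V x" and ?v = "\<lambda>x. E0 ^ m * (A * (1 - (1/2) ^ m)) * h x"
    have d: "dominated V ?u" "dominated V ?v" by (intro dominated_cmult dominated_U dh)+
    have "qit (Suc m) k V x \<le> Q_op P G (Suc k) (\<lambda>x. ?u x + ?v x) x"
      unfolding qit.simps using Suc[of "Suc k"]
      by (intro Q_op_mono dominated_add d dominated_qit dominated_U) (auto simp: algebra_simps)
    also have "\<dots> = E0 ^ m * (1/2) ^ m * Q_op P G (Suc k) V x + E0 ^ m * (A * (1 - (1/2) ^ m)) * (E0 * h x)"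
      using Q_op_add[OF _ d, of "Suc k" x] Q_eq[of "Suc k" h] Qh[of x] by (simp add: Q_op_cmult)
    also have "\<dots> \<le> E0 ^ m * (1/2) ^ m * (E0 / 2 * V x + c * h x) + E0 ^ m * (A * (1 - (1/2) ^ m)) * (E0 * h x)"
      using drift[of "Suc k" x] E0 by (intro add_right_mono mult_left_mono) auto
    also have "c = A * E0 / 2" using E0 by (simp add: A_def)
    also have "E0 ^ m * (1/2) ^ m * (E0 / 2 * V x + A * E0 / 2 * h x) + E0 ^ m * (A * (1 - (1/2) ^ m)) * (E0 * h x) =
       E0 ^ Suc m * ((1/2) ^ Suc m * V x + A * (1 - (1/2) ^ Suc m) * h x)"
      by (simp add: algebra_simps)
    finally show ?case .
  qed simp
  have "qit m k (\<lambda>_. 1) x \<le> (1 + A * w) * E0 ^ m * V x" for m k x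
  proof -
    have p: "(1/2 :: real) ^ m \<le> 1" by (simp add: power_le_one)
    have "qit m k (\<lambda>_. 1) x \<le> qit m k V x" by (rule qit_mono[OF dominated_1 dominated_U U_ge1])
    also have "\<dots> \<le> E0 ^ m * ((1/2) ^ m * V x + A * (1 - (1/2) ^ m) * h x)" by (rule main)
    also have "\<dots> \<le> E0 ^ m * (1 * V x + A * 1 * (w * V x))"
      using p E0 A hw[of x] h(2)[of x] U_nonneg(1)[of x] w0
      by (intro mult_left_mono add_mono mult_mono mult_right_mono) (auto simp: less_imp_le)
    finally show ?thesis by (simp add: algebra_simps)
  qed
  moreover have "E0 * W x \<le> Q_op P G n W x" if "1 \<le> n" for n x
    unfolding Q_eq[OF that] by (rule W)
  ultimately show ?thesis using E0 unfolding normalizer_def by blast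
qed

text \<open>The minimum is one of its two arguments. If it is \<chi>, homogeneity turns the relaxed
  inequality into the general one for all \<open>n\<close>, so the eigenvalue is used only when it
  is below \<chi>.\<close>

lemma normalizer_exists:
  assumes V: "Q_lyapunov P G V" and W: "\<And>x. 0 < W x"
    and A4: "(\<forall>n\<ge>1. \<forall>x. chi P G * ennreal (W x) \<le> ennreal (Q_op P G n W x)) \<or>
       time_homogeneous P G \<and>
         (\<exists>h E0 \<eta>inf. leading_eigen_triple P G V h E0 \<eta>inf \<and>
           (\<forall>x. min (chi P G) (ennreal E0) * ennreal (W x) \<le> ennreal (Q_op P G 1 W x)))"
  shows "\<exists>\<kappa>. normalizer V W \<kappa>"
  using A4
proof
  assume "\<forall>n\<ge>1. \<forall>x. chi P G * ennreal (W x) \<le> ennreal (Q_op P G n W x)"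
  then show ?thesis using normalizer_chi[OF V, of W] W by blast
next
  assume "time_homogeneous P G \<and>
         (\<exists>h E0 \<eta>inf. leading_eigen_triple P G V h E0 \<eta>inf \<and>
           (\<forall>x. min (chi P G) (ennreal E0) * ennreal (W x) \<le> ennreal (Q_op P G 1 W x)))"
  then obtain h E0 \<eta>inf where hom: "time_homogeneous P G" and triple: "leading_eigen_triple P G V h E0 \<eta>inf"
    and le: "\<And>x. min (chi P G) (ennreal E0) * ennreal (W x) \<le> ennreal (Q_op P G 1 W x)" by blast
  show ?thesis
  proof (cases "chi P G \<le> ennreal E0")
    case True
    have "chi P G * ennreal (W x) \<le> ennreal (Q_op P G n W x)" if "1 \<le> n" for n x
    proof -
      have "P n = P 1" "G (n - 1) = G 0" using hom that unfolding time_homogeneous_def by blast+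
      then have "Q_op P G n W x = Q_op P G 1 W x" by (simp add: Q_op_def)
      then show ?thesis using le[of x] True by (simp add: min_absorb1)
    qed
    then show ?thesis using normalizer_chi[OF V, of W] W by blast
  next
    case False
    have E0: "0 < E0" using triple by (simp add: leading_eigen_triple_def)
    have "E0 * W x \<le> Q_op P G 1 W x" for x
    proof (rule ccontr)
      assume "\<not> E0 * W x \<le> Q_op P G 1 W x"
      moreover have "ennreal (E0 * W x) \<le> ennreal (Q_op P G 1 W x)"
        using le[of x] False E0 W[of x] by (simp add: min_absorb2 ennreal_mult)
      moreover have "0 < E0 * W x" using E0 W[of x] by simp
      ultimately show False by (auto simp: ennreal_le_iff2)
    qed
    then show ?thesis
      using normalizer_eigen[OF V hom, of h E0 W] triple unfolding leading_eigen_triple_def by blast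
  qed
qed

end

text \<open>Cutting at \<open>Y \<le> R\<close> with \<open>Y = V powr (lam / (4 * p))\<close>
  leaves a bounded part, whose error is \<open>2 * L * R\<close> times that of a function with
  values in \<open>[0, 1]\<close>, and a tail below \<open>L / R * Y^2\<close>. With
  \<open>R^p = N powr (b / 2)\<close> both contribute order \<open>N powr (- b / 2)\<close> to the
  moment of order \<open>p\<close>, where \<open>b = \<alpha> / 16\<close>; the root of order
  \<open>p\<close> gives the exponent \<open>b / (2 * p)\<close>.\<close>

lemma (in dmc_stable) weighted_error:
  fixes lam p :: nat
  assumes p: "1 \<le> p" and lam: "\<And>x. V x ^ lam \<le> Vbar x"
  shows "\<exists>c. \<forall>f \<in> C_wt (\<lambda>x. V x powr (lam / (4 * p))). \<forall>N\<ge>1. \<forall>n.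
     integrable (flow n) f \<and>
     integrable (M N) (\<lambda>\<omega>. \<bar>(\<integral>x. f x \<partial>flow n) - (\<integral>x. f x \<partial>emp N n \<omega>)\<bar> ^ p) \<and>
     (\<integral>\<omega>. \<bar>(\<integral>x. f x \<partial>flow n) - (\<integral>x. f x \<partial>emp N n \<omega>)\<bar> ^ p \<partial>M N) powr (1 / p)
       \<le> c * wnorm (\<lambda>x. V x powr (lam / (4 * p))) f * N powr (- (\<alpha> / (16 * p)) / 2)"
proof -
  obtain C where C: "0 < C" and unit: "\<And>N g n. 1 \<le> N \<Longrightarrow> unit_fun g \<Longrightarrow>
     (\<integral>\<omega>. \<bar>(\<integral>x. g x \<partial>emp N n \<omega>) - (\<integral>x. g x \<partial>flow n)\<bar> \<partial>M N) \<le> C * N powr (- \<alpha> / 16)"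
    using unit_error by blast
  obtain B where B: "1 \<le> B" and mVb: "moments_le Vbar B" using moments by blast
  interpret Vb: tame_weight P G Vbar by (rule tame_weight_lyapunov[OF lyap_Vbar])
  define q where "q = real lam / real (4 * p)"
  define Y where "Y x = V x powr q" for x
  define D where "D = 3 ^ p * (2 ^ p * C + 2 * B)"
  have D: "0 < D" using C B(1) by (simp add: D_def add_pos_pos)
  have Y1: "1 \<le> Y x" for x unfolding Y_def q_def using U_ge1[of x] by (intro ge_one_powr_ge_zero) auto
  have Ym: "Y \<in> borel_measurable borel" unfolding Y_def using U_meas by measurable
  have Y4: "Y x ^ (4 * p) \<le> Vbar x" for x
  proof -
    have "Y x ^ (4 * p) = V x powr (real lam)"
      unfolding Y_def q_def using U_ge1[of x] p by (simp add: powr_power)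
    also have "\<dots> = V x ^ lam" using U_nonneg(2)[of x] by (rule powr_realpow)
    finally show ?thesis using lam[of x] by simp
  qed
  have Ypow: "Y x ^ k \<le> Vbar x" if "k \<le> 4 * p" for k x
    using power_increasing[OF that Y1[of x]] Y4[of x] by linarith
  have dY: "dominated Vbar (\<lambda>x. Y x ^ k)" if "k \<le> 4 * p" for k
    using Ypow[OF that] Y1 Ym
    by (intro dominatedI[where c = 1] borel_measurable_power) (auto simp: abs_of_nonneg order_trans[OF zero_le_one])
  show ?thesis
  proof (intro exI[of _ "D powr (1 / p)"] ballI allI impI)
    fix f and N n :: nat
    assume f: "f \<in> C_wt (\<lambda>x. V x powr (lam / (4 * p)))" and N: "1 \<le> N"
    interpret D: dmc P G \<epsilon> \<eta>0 N "M N" "\<xi> N" by (rule dmc[OF N])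
    note B2 = moments_leD(1,2)[OF mVb, of n]
    define L where "L = wnorm (\<lambda>x. V x powr (lam / (4 * p))) f"
    have wpos: "0 < V x powr (lam / (4 * p))" for x using U_nonneg(2)[of x] by simp
    have fL: "\<bar>f x\<bar> \<le> L * Y x" for x
      using C_wt_bound(1)[OF f wpos] unfolding L_def Y_def q_def .
    have L: "0 \<le> L" unfolding L_def by (rule C_wt_bound(2)[OF f wpos])
    have fm: "f \<in> borel_measurable borel"
      using f by (auto simp: C_wt_def intro: borel_measurable_continuous_onI)
    have Y_le: "Y x \<le> Vbar x" for x using Ypow[of 1 x] p by simp
    have df: "dominated Vbar f"
    proof (rule dominatedI[OF fm])
      show "\<bar>f x\<bar> \<le> L * Vbar x" for x
        using order_trans[OF fL mult_left_mono[OF Y_le L]] .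
    qed
    let ?\<eta> = "flow n" and ?e = "emp N n"
    note \<eta>p = FK_flow_prob[OF init, of n]
    have ei: "integrable (?e \<omega>) h" if "h \<in> borel_measurable borel" for \<omega> and h :: "'a \<Rightarrow> real"
      by (rule D.integrable_emp[OF that])
    have \<eta>i: "integrable ?\<eta> h" if "dominated Vbar h" for h
      by (rule integrable_dominated[OF borel_probD(2)[OF \<eta>p] B2(1) that])
    define x where "x = real N"
    have x1: "1 \<le> x" using N by (simp add: x_def)
    define b where "b = \<alpha> / 16"
    define R where "R = x powr (b / (2 * p))"
    have b: "0 < b" using alpha by (simp add: b_def)
    have R: "1 \<le> R" unfolding R_def using x1 b by (intro ge_one_powr_ge_zero) auto
    have Rp: "R ^ p = x powr (b / 2)" unfolding R_def using x1 p by (simp add: powr_power)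
    define f1 where "f1 z = (if Y z \<le> R then f z else 0)" for z
    \<comment> \<open>Affine rescaling to \<open>[0, 1]\<close>. If \<open>L * R = 0\<close>,
      division by zero gives \<open>g = 1 / 2\<close>, consistent with
      \<open>f1 = 0\<close>.\<close>
    define g where "g z = (f1 z / (L * R) + 1) / 2" for z
    have f1m: "f1 \<in> borel_measurable borel" unfolding f1_def using Ym fm by measurable
    have gm: "g \<in> borel_measurable borel" unfolding g_def using f1m by simp
    have f1b: "\<bar>f1 z\<bar> \<le> L * R" for z
    proof (cases "Y z \<le> R")
      case True
      then show ?thesis using order_trans[OF fL[of z] mult_left_mono[OF True L]] by (simp add: f1_def)
    next
      case False
      then show ?thesis using L R by (simp add: f1_def)
    qed
    have f1g: "f1 z = 2 * (L * R) * g z - L * R" for z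
    proof (cases "L * R = 0")
      case True
      have "f1 z = 0" using f1b[of z] unfolding True by simp
      then show ?thesis unfolding True by simp
    next
      case False
      then show ?thesis unfolding g_def by (simp add: field_simps)
    qed
    have g01: "unit_fun g"
      unfolding unit_fun_def
    proof (intro conjI allI gm)
      fix z
      have "\<bar>f1 z / (L * R)\<bar> \<le> 1"
        using f1b[of z] L R by (cases "L = 0") (auto simp: abs_mult divide_le_eq)
      moreover have "0 \<le> (t + 1) / 2 \<and> (t + 1) / 2 \<le> 1" if "\<bar>t\<bar> \<le> 1" for t :: real
        using that by auto
      ultimately show "0 \<le> g z" "g z \<le> 1" unfolding g_def by blast+
    qed
    then have g0: "0 \<le> g z" "g z \<le> 1" for z by (auto simp: unit_fun_def)
    have tail: "\<bar>f z - f1 z\<bar> \<le> L / R * Y z ^ 2" for z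
    proof (cases "Y z \<le> R")
      case True
      then show ?thesis using L R by (simp add: f1_def)
    next
      case False
      have "L * Y z * R \<le> L * Y z * Y z" using False L Y1[of z] by (intro mult_left_mono) auto
      then have "L * Y z \<le> L / R * Y z ^ 2" using R by (simp add: field_simps power2_eq_square)
      then show ?thesis using fL[of z] False by (simp add: f1_def)
    qed
    have p2: "2 \<le> 4 * p" "2 * p \<le> 4 * p" using p by auto
    have dg: "dominated Vbar g"
      by (rule Vb.dominated_unit[OF g01])
    have df1: "dominated Vbar f1"
      unfolding f1g[abs_def] by (intro dominated_diff dominated_cmult dg Vb.dominated_1)
    have tail_int: "\<bar>(\<integral>z. f z \<partial>\<mu>) - (\<integral>z. f1 z \<partial>\<mu>)\<bar> \<le> L / R * (\<integral>z. Y z ^ 2 \<partial>\<mu>)"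
      if "integrable \<mu> f" "integrable \<mu> f1" "integrable \<mu> (\<lambda>z. Y z ^ 2)" for \<mu>
    proof -
      have "\<bar>(\<integral>z. f z \<partial>\<mu>) - (\<integral>z. f1 z \<partial>\<mu>)\<bar> = \<bar>\<integral>z. f z - f1 z \<partial>\<mu>\<bar>" using that by simp
      also have "\<dots> \<le> (\<integral>z. \<bar>f z - f1 z\<bar> \<partial>\<mu>)" by (rule integral_abs_bound)
      also have "\<dots> \<le> (\<integral>z. L / R * Y z ^ 2 \<partial>\<mu>)" using that tail by (intro integral_mono) auto
      finally show ?thesis by simp
    qed
    \<comment> \<open>The tail is quadratic in \<open>Y\<close>, so after Jensen's inequality the
      exponent is \<open>2 * p\<close>, within the range \<open>4 * p\<close> that
      \<open>Vbar\<close> covers.\<close>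
    have Y2p: "(\<integral>z. Y z ^ 2 \<partial>\<mu>) ^ p \<le> (\<integral>z. Vbar z \<partial>\<mu>)" "0 \<le> (\<integral>z. Y z ^ 2 \<partial>\<mu>)"
      if \<mu>: "borel_prob \<mu>" "integrable \<mu> Vbar" for \<mu>
    proof -
      interpret prob_space \<mu> using borel_probD[OF \<mu>(1)] by simp
      note i = integrable_dominated[OF borel_probD(2)[OF \<mu>(1)] \<mu>(2) dY]
      have "(\<integral>z. Y z ^ 2 \<partial>\<mu>) ^ p \<le> (\<integral>z. (Y z ^ 2) ^ p \<partial>\<mu>)"
        using i[OF p2(1)] i[OF p2(2)] p by (intro power_integral_le) (auto simp: power_mult)
      also have "\<dots> \<le> (\<integral>z. Vbar z \<partial>\<mu>)"
        using i[OF p2(2)] \<mu>(2) Ypow[OF p2(2)] by (intro integral_mono) (auto simp: power_mult[symmetric])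
      finally show "(\<integral>z. Y z ^ 2 \<partial>\<mu>) ^ p \<le> (\<integral>z. Vbar z \<partial>\<mu>)" .
      show "0 \<le> (\<integral>z. Y z ^ 2 \<partial>\<mu>)" by (intro Bochner_Integration.integral_nonneg) simp
    qed
    have f1_diff: "(\<integral>z. f1 z \<partial>?\<eta>) - (\<integral>z. f1 z \<partial>?e \<omega>) = 2 * (L * R) * ((\<integral>z. g z \<partial>?\<eta>) - (\<integral>z. g z \<partial>?e \<omega>))" for \<omega>
    proof -
      have i1: "(\<integral>z. f1 z \<partial>\<mu>) = 2 * (L * R) * (\<integral>z. g z \<partial>\<mu>) - L * R" if "borel_prob \<mu>" "integrable \<mu> g" for \<mu>
      proof -
        interpret prob_space \<mu> using borel_probD[OF that(1)] by simp
        show ?thesis unfolding f1g using that(2) by (simp add: prob_space)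
      qed
      show ?thesis
        unfolding i1[OF \<eta>p \<eta>i[OF dg]] i1[OF emp_props(1)[OF N] ei[OF gm]] by (simp add: algebra_simps)
    qed
    define T where "T \<omega> = \<bar>(\<integral>z. f z \<partial>?\<eta>) - (\<integral>z. f z \<partial>?e \<omega>)\<bar>" for \<omega>
    define dlt where "dlt \<omega> = \<bar>(\<integral>z. g z \<partial>?e \<omega>) - (\<integral>z. g z \<partial>?\<eta>)\<bar>" for \<omega>
    have dlt01: "0 \<le> dlt \<omega>" "dlt \<omega> \<le> 1" for \<omega>
    proof -
      show "0 \<le> dlt \<omega>" by (simp add: dlt_def)
      have "0 \<le> (\<integral>z. g z \<partial>\<mu>)" "(\<integral>z. g z \<partial>\<mu>) \<le> 1" if "borel_prob \<mu>" for \<mu>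
        using D.integral_step_bounded(2,3)[OF that gm g0] by auto
      from this[OF \<eta>p] this[OF emp_props(1)[OF N], of n \<omega>] show "dlt \<omega> \<le> 1" unfolding dlt_def by linarith
    qed
    have pw: "T \<omega> ^ p \<le> 3 ^ p * L ^ p * ((2 * R) ^ p * dlt \<omega> + 1 / R ^ p * (B + (\<integral>z. Vbar z \<partial>?e \<omega>)))" for \<omega>
    proof -
      let ?a = "2 * (L * R) * dlt \<omega>" and ?b = "L / R * (\<integral>z. Y z ^ 2 \<partial>?\<eta>)" and ?c = "L / R * (\<integral>z. Y z ^ 2 \<partial>?e \<omega>)"
      have Y2m: "(\<lambda>z. Y z ^ 2) \<in> borel_measurable borel" using Ym by simp
      note te = tail_int[OF ei[OF fm] ei[OF f1m] ei[OF Y2m], of \<omega>]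
      note t\<eta> = tail_int[OF \<eta>i[OF df] \<eta>i[OF df1] \<eta>i[OF dY[OF p2(1)]]]
      have "\<bar>(\<integral>z. f1 z \<partial>?\<eta>) - (\<integral>z. f1 z \<partial>?e \<omega>)\<bar> = ?a"
        unfolding f1_diff dlt_def using L R by (simp add: abs_mult abs_minus_commute)
      then have T: "T \<omega> \<le> ?a + ?b + ?c" unfolding T_def using te t\<eta> by linarith
      note Ye = Y2p[OF emp_props(1)[OF N] ei[OF Vbar_meas, of \<omega>]] and Y\<eta> = Y2p[OF \<eta>p B2(1)]
      have nn: "0 \<le> ?a" "0 \<le> ?b" "0 \<le> ?c" using L R dlt01(1)[of \<omega>] Ye(2) Y\<eta>(2) by auto
      have "T \<omega> ^ p \<le> (?a + ?b + ?c) ^ p" using T by (intro power_mono) (auto simp: T_def)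
      also have "\<dots> \<le> 3 ^ p * (?a ^ p + ?b ^ p + ?c ^ p)" by (rule add3_power_le[OF nn])
      also have "\<dots> \<le> 3 ^ p * (L ^ p * ((2 * R) ^ p * dlt \<omega>) + L ^ p * (1 / R ^ p * B) + L ^ p * (1 / R ^ p * (\<integral>z. Vbar z \<partial>?e \<omega>)))"
      proof (intro mult_left_mono add_mono)
        \<comment> \<open>Because the error for \<open>g\<close> lies in \<open>[0, 1]\<close>, its
          first moment controls all higher ones.\<close>
        have "dlt \<omega> ^ p \<le> dlt \<omega>" using power_decreasing[OF p dlt01(1,2), of \<omega>] by simp
        then have "L ^ p * ((2 * R) ^ p * dlt \<omega> ^ p) \<le> L ^ p * ((2 * R) ^ p * dlt \<omega>)"
          using L R by (intro mult_left_mono) auto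
        then show "?a ^ p \<le> L ^ p * ((2 * R) ^ p * dlt \<omega>)" by (simp add: power_mult_distrib mult_ac)
        have "L ^ p * (1 / R ^ p * (\<integral>z. Y z ^ 2 \<partial>?\<eta>) ^ p) \<le> L ^ p * (1 / R ^ p * B)"
          using L R order_trans[OF Y\<eta>(1) B2(2)] by (intro mult_left_mono) auto
        then show "?b ^ p \<le> L ^ p * (1 / R ^ p * B)" by (simp add: power_mult_distrib power_divide)
        have "L ^ p * (1 / R ^ p * (\<integral>z. Y z ^ 2 \<partial>?e \<omega>) ^ p) \<le> L ^ p * (1 / R ^ p * (\<integral>z. Vbar z \<partial>?e \<omega>))"
          using L R Ye(1) by (intro mult_left_mono) auto
        then show "?c ^ p \<le> L ^ p * (1 / R ^ p * (\<integral>z. Vbar z \<partial>?e \<omega>))" by (simp add: power_mult_distrib power_divide)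
      qed simp
      finally show ?thesis by (simp add: algebra_simps)
    qed
    have "dlt \<in> borel_measurable (M N)"
      unfolding dlt_def[abs_def] using D.emp_meas[OF gm, of n] by simp
    then have dlt_int: "integrable (M N) dlt"
      using dlt01 by (intro D.M.integrable_const_bound[where B = 1]) auto
    have Vint: "integrable (M N) (\<lambda>\<omega>. \<integral>z. Vbar z \<partial>?e \<omega>)" "(\<integral>\<omega>. (\<integral>z. Vbar z \<partial>?e \<omega>) \<partial>M N) \<le> B"
      using moments_leD(3,4)[OF mVb N, of n] by auto
    let ?rhs = "\<lambda>\<omega>. 3 ^ p * L ^ p * ((2 * R) ^ p * dlt \<omega> + 1 / R ^ p * (B + (\<integral>z. Vbar z \<partial>?e \<omega>)))"
    have rhs_int: "integrable (M N) ?rhs"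
      using dlt_int Vint(1) by (intro integrable_mult_right Bochner_Integration.integrable_add) auto
    have Tint: "integrable (M N) (\<lambda>\<omega>. T \<omega> ^ p)"
    proof (rule Bochner_Integration.integrable_bound[OF rhs_int])
      show "(\<lambda>\<omega>. T \<omega> ^ p) \<in> borel_measurable (M N)"
        unfolding T_def using D.emp_meas[OF fm, of n] by simp
      show "AE \<omega> in M N. norm (T \<omega> ^ p) \<le> norm (?rhs \<omega>)"
      proof (rule AE_I2)
        fix \<omega>
        have "0 \<le> T \<omega> ^ p" by (simp add: T_def)
        then show "norm (T \<omega> ^ p) \<le> norm (?rhs \<omega>)" using pw[of \<omega>] unfolding real_norm_def by linarith
      qed
    qed
    have T0: "0 \<le> (\<integral>\<omega>. T \<omega> ^ p \<partial>M N)"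
      by (intro Bochner_Integration.integral_nonneg) (simp add: T_def)
    have "(\<integral>\<omega>. T \<omega> ^ p \<partial>M N) \<le> (\<integral>\<omega>. ?rhs \<omega> \<partial>M N)" using pw by (intro integral_mono Tint rhs_int)
    also have "\<dots> = 3 ^ p * L ^ p * ((2 * R) ^ p * (\<integral>\<omega>. dlt \<omega> \<partial>M N) + 1 / R ^ p * (B + (\<integral>\<omega>. (\<integral>z. Vbar z \<partial>?e \<omega>) \<partial>M N)))"
      using dlt_int Vint(1) by (simp add: D.M.prob_space)
    also have "\<dots> \<le> 3 ^ p * L ^ p * ((2 * R) ^ p * (C * x powr (- b)) + 1 / R ^ p * (B + B))"
      using unit[OF N g01, of n] Vint(2) L R unfolding dlt_def x_def b_def
      by (intro mult_left_mono add_mono) auto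
    also have "(2 * R) ^ p * (C * x powr (- b)) = 2 ^ p * C * x powr (- b / 2)"
      using x1 unfolding power_mult_distrib Rp by (simp add: powr_add[symmetric] mult_ac)
    also have "1 / R ^ p = x powr (- b / 2)"
      unfolding Rp using x1 by (simp add: powr_minus_divide)
    also have "3 ^ p * L ^ p * (2 ^ p * C * x powr (- b / 2) + x powr (- b / 2) * (B + B)) = L ^ p * (D * x powr (- b / 2))"
      by (simp add: D_def algebra_simps)
    finally have "(\<integral>\<omega>. T \<omega> ^ p \<partial>M N) powr (1 / p) \<le> (L ^ p * (D * x powr (- b / 2))) powr (1 / p)"
      using T0 by (intro powr_mono2) auto
    also have "\<dots> = (L ^ p) powr (1 / p) * (D powr (1 / p) * (x powr (- b / 2)) powr (1 / p))"
      using L D by (simp add: powr_mult)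
    also have "(L ^ p) powr (1 / p) = L"
    proof (cases "L = 0")
      case False
      then have "L ^ p = L powr real p" using L by (simp add: powr_realpow)
      then show ?thesis using p L False by (simp add: powr_powr)
    qed (use p in simp)
    also have "(x powr (- b / 2)) powr (1 / p) = x powr (- (\<alpha> / (16 * p)) / 2)"
      unfolding powr_powr b_def by (simp add: mult.commute)
    finally have "(\<integral>\<omega>. T \<omega> ^ p \<partial>M N) powr (1 / p) \<le> D powr (1 / p) * L * x powr (- (\<alpha> / (16 * p)) / 2)"
      by (simp add: mult_ac)
    then show "integrable ?\<eta> f \<and>
       integrable (M N) (\<lambda>\<omega>. \<bar>(\<integral>x. f x \<partial>?\<eta>) - (\<integral>x. f x \<partial>?e \<omega>)\<bar> ^ p) \<and>
       (\<integral>\<omega>. \<bar>(\<integral>x. f x \<partial>?\<eta>) - (\<integral>x. f x \<partial>?e \<omega>)\<bar> ^ p \<partial>M N) powr (1 / p)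
         \<le> D powr (1 / p) * wnorm (\<lambda>x. V x powr (lam / (4 * p))) f * N powr (- (\<alpha> / (16 * p)) / 2)"
      using Tint \<eta>i[OF df] unfolding T_def L_def x_def by simp
  qed
qed

text \<open>The constants are chosen before \<open>f\<close>, \<open>N\<close> and \<open>n\<close>,
  so the bound for all \<open>n\<close> is the bound on the supremum. The integrability clauses
  exclude that an integral has its default value 0.\<close>

theorem theorem1:
  fixes P :: "nat \<Rightarrow> 'a::polish_space \<Rightarrow> 'a measure"
    and G :: "nat \<Rightarrow> 'a \<Rightarrow> real"
    and \<eta>0 \<gamma> \<nu> :: "'a measure"
    and V Vbar W Wbar :: "'a \<Rightarrow> real"
    and pd :: "nat \<Rightarrow> 'a \<Rightarrow> 'a \<Rightarrow> real"
    and \<alpha> :: real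
    and lam p :: nat
    and \<epsilon> :: "nat \<Rightarrow> 'a measure \<Rightarrow> real"
    and M :: "nat \<Rightarrow> 'w measure"
    and \<xi> :: "nat \<Rightarrow> nat \<Rightarrow> nat \<Rightarrow> 'w \<Rightarrow> 'a"
  assumes lc: "locally_compact_space (euclidean :: 'a topology)"
    and transitions: "feller_transitions P"
    and pot: "potentials G"
    and init: "\<eta>0 \<in> space (prob_algebra borel)"
    and A1: "Q_lyapunov P G V"
      "\<And>n. (\<lambda>x. Q_op P G (Suc n) V x / V x) \<in> C_zero"
    and A2: "local_densities P V pd \<nu>"
    and A3: "\<gamma> \<in> P_wt V"
      "bdd_above (range (\<lambda>n. \<integral>x. G n x \<partial>phi P G 0 n \<gamma>))"
    and A4: "W \<in> C_wt V" "\<And>x. 0 < W x" "0 < \<alpha>" "\<alpha> \<le> 1"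
      "Wbar \<in> C_wt V" "Q_lyapunov P G Wbar" "\<And>x. W x powr (- \<alpha>) \<le> Wbar x"
      "(\<forall>n\<ge>1. \<forall>x. chi P G * ennreal (W x) \<le> ennreal (Q_op P G n W x)) \<or>
       time_homogeneous P G \<and>
         (\<exists>h E0 \<eta>inf. leading_eigen_triple P G V h E0 \<eta>inf \<and>
           (\<forall>x. min (chi P G) (ennreal E0) * ennreal (W x) \<le> ennreal (Q_op P G 1 W x)))"
    and A5: "0 < lam" "even lam" "Q_lyapunov P G Vbar" "\<And>x. V x ^ lam \<le> Vbar x"
    and A6: "integrable \<eta>0 V" "integrable \<eta>0 Vbar" "integrable \<eta>0 Wbar"
    and tuning: "tuning_parameters G \<epsilon>"
    and walkers: "\<And>N. 1 \<le> N \<Longrightarrow> dmc_walkers P G \<epsilon> \<eta>0 N (M N) (\<xi> N)"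
    and p: "1 \<le> p"
  shows "\<exists>(c::real) (\<beta>::real). 0 < \<beta> \<and> \<beta> \<le> 1 \<and>
    (\<forall>f \<in> C_wt (\<lambda>x. V x powr (lam / (4 * p))). \<forall>N\<ge>1. \<forall>n.
       integrable (FK_flow P G \<eta>0 n) f \<and>
       integrable (M N) (\<lambda>\<omega>. \<bar>(\<integral>x. f x \<partial>FK_flow P G \<eta>0 n) -
          (\<integral>x. f x \<partial>empirical N (\<lambda>i. \<xi> N n i \<omega>))\<bar> ^ p) \<and>
       (\<integral>\<omega>. \<bar>(\<integral>x. f x \<partial>FK_flow P G \<eta>0 n) -
          (\<integral>x. f x \<partial>empirical N (\<lambda>i. \<xi> N n i \<omega>))\<bar> ^ p \<partial>M N) powr (1 / p)
         \<le> c * wnorm (\<lambda>x. V x powr (lam / (4 * p))) f * N powr (- \<beta> / 2))"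
proof -
  interpret fk_model P G by unfold_locales (rule transitions pot)+
  obtain \<kappa> where \<kappa>: "normalizer V W \<kappa>" using normalizer_exists[OF A1(1) A4(2,8)] by blast
  \<comment> \<open>With \<open>V \<ge> 1\<close> this gives
    \<open>V^2 \<le> V^lam \<le> Vbar\<close>, the second moment behind the sampling errors.\<close>
  have lam2: "2 \<le> lam" using A5(1,2) by presburger
  interpret dmc_stable P G V W \<kappa> pd \<nu> \<eta>0 Vbar Wbar \<alpha> \<epsilon> M \<xi>
  proof unfold_locales
    show "(V x)\<^sup>2 \<le> Vbar x" for x
      using power_increasing[OF lam2 Q_lyapunovD(2)[OF A1(1), of x]] A5(4)[of x] by linarith
  qed (use \<kappa> A1(1) A2 A4 A5(3) A6 init tuning walkers in \<open>auto simp: normalizer_def\<close>)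
  have "0 < \<alpha> / real (16 * p)" "\<alpha> / real (16 * p) \<le> 1"
    using A4(3,4) p by (simp_all add: divide_le_eq)
  then show ?thesis using weighted_error[OF p A5(4)] by blast
qed

end
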